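(* Let $\Omega\subset\mathbb{C}^n$, $n>1$, be a bounded domain with $C^2$-boundary. Let $P\in\partial\Omega$ be a boundary point which is not pseudoconvex, i.e. the Levi form of $\partial\Omega$ at $P$ has at least one strictly negative eigenvalue. For $\delta>0$ small, let $P_\delta$ be the point on the inner normal to $\partial\Omega$ at $P$ at distance $\delta$ from $P$, and let $\nu$ be a unit complex normal vector to $\partial\Omega$ at $P$. Then $$F_K^\Omega(P_\delta,\nu)\approx\frac{1}{\delta^{3/4}},\qquad F_S^\Omega(P_\delta,\nu)\approx\frac{1}{\delta^{1/2}},\qquad F_C^\Omega(P_\delta,\nu)\approx 1$$ for all sufficiently small $\delta>0$.
   Context: $\mathbb{D}$ is the unit disc in $\mathbb{C}$. For an open set $\Omega\subset\mathbb{C}^n$, $P\in\Omega$ and $\xi=(\xi_1,\dots,\xi_n)\in\mathbb{C}^n$: - Kobayashi metric: $F_K^\Omega(P,\xi)=\inf\{\alpha>0:\ \exists\,\phi:\mathbb{D}\to\Omega \text{ holomorphic with } \phi(0)=P,\ \phi'(0)=\xi/\alpha\}$. - Carathéodory metric: $F_C^\Omega(P,\xi)=\sup\{|\sum_{i=1}^n\frac{\partial f(P)}{\partial z_i}\xi_i|:\ f:\Omega\to\mathbb{D}\text{ holomorphic},\ f(P)=0\}$. - Sibony metric: $F_S^\Omega(P,\xi)=\sup\{(\sum_{i,j=1}^n\frac{\partial^2u(P)}{\partial z_i\partial\bar z_j}\xi_i\bar\xi_j)^{1/2}:\ u\in A_\Omega(P)\}$, where $A_\Omega(P)$ is the set of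 plurisubharmonic functions $u$ on $\Omega$ such that $u(P)=0$, $u$ is $C^2$ near $P$, $\log u$ is plurisubharmonic on $\Omega$ (with $\log 0=-\infty$), and $0\le u\le 1$ on $\Omega$. The Levi form at $P$ is that of a $C^2$ defining function $r$ of $\Omega$ ($\Omega=\{r<0\}$ near $P$, $dr\neq0$ on $\partial\Omega$), restricted to the complex tangent space of $\partial\Omega$ at $P$. For positive functions $a(\delta)$, $b(\delta)$, $a\approx b$ means that there is a constant $C\geq 1$ independent of $\delta$ (it may depend on $\Omega$ and $P$) with $C^{-1}b(\delta)\le a(\delta)\le C\,b(\delta)$. *)

theory Defs
  imports "HOL-Analysis.Analysis"
begin

text \<open>
  Wirtinger derivatives: \<open>\<partial>/\<partial>z\<^sub>i = (\<partial>/\<partial>x\<^sub>i - \<i> \<partial>/\<partial>y\<^sub>i) / 2\<close> and its conjugate.  For a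
  holomorphic function, \<open>dz i\<close> is the usual complex partial derivative.
\<close>

definition dir_deriv :: "('a::real_normed_vector \<Rightarrow> complex) \<Rightarrow> 'a \<Rightarrow> 'a \<Rightarrow> complex" where
  "dir_deriv f v z = vector_derivative (\<lambda>t::real. f (z + t *\<^sub>R v)) (at 0)"

definition dz :: "'n \<Rightarrow> (complex ^ 'n::finite \<Rightarrow> complex) \<Rightarrow> complex ^ 'n \<Rightarrow> complex" where
  "dz i f z = (dir_deriv f (axis i 1) z - \<i> * dir_deriv f (axis i \<i>) z) / 2"

definition dzbar :: "'n \<Rightarrow> (complex ^ 'n::finite \<Rightarrow> complex) \<Rightarrow> complex ^ 'n \<Rightarrow> complex" where
  "dzbar i f z = (dir_deriv f (axis i 1) z + \<i> * dir_deriv f (axis i \<i>) z) / 2"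

definition C2_on :: "'a::real_normed_vector set \<Rightarrow> ('a \<Rightarrow> real) \<Rightarrow> bool" where
  "C2_on U f \<longleftrightarrow> (\<exists>(f' :: 'a \<Rightarrow> 'a \<Rightarrow>\<^sub>L real) (f'' :: 'a \<Rightarrow> 'a \<Rightarrow>\<^sub>L ('a \<Rightarrow>\<^sub>L real)).
     (\<forall>x\<in>U. (f has_derivative blinfun_apply (f' x)) (at x)) \<and>
     (\<forall>x\<in>U. (f' has_derivative blinfun_apply (f'' x)) (at x)) \<and>
     continuous_on U f'')"

text \<open>The sesquilinear form \<open>\<Sum>\<^sub>i\<^sub>,\<^sub>j (\<partial>\<^sup>2u/\<partial>z\<^sub>i\<partial>zbar\<^sub>j)(P) \<xi>\<^sub>i cnj(\<eta>\<^sub>j)\<close>.\<close>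

definition complex_hessian ::
  "(complex ^ 'n::finite \<Rightarrow> real) \<Rightarrow> complex ^ 'n \<Rightarrow> complex ^ 'n \<Rightarrow> complex ^ 'n \<Rightarrow> complex" where
  "complex_hessian u P \<xi> \<eta> =
     (\<Sum>i\<in>UNIV. \<Sum>j\<in>UNIV. dz i (dzbar j (\<lambda>z. complex_of_real (u z))) P * \<xi> $ i * cnj (\<eta> $ j))"

definition herm_inner :: "complex ^ 'n::finite \<Rightarrow> complex ^ 'n \<Rightarrow> complex" where
  "herm_inner \<xi> \<eta> = (\<Sum>i\<in>UNIV. \<xi> $ i * cnj (\<eta> $ i))"

definition holomorphic_fun_on :: "(complex ^ 'n::finite \<Rightarrow> complex) \<Rightarrow> (complex ^ 'n) set \<Rightarrow> bool" where
  "holomorphic_fun_on f S \<longleftrightarrow>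
     (\<forall>z\<in>S. \<exists>D. (f has_derivative D) (at z) \<and> (\<forall>c v. D (c *s v) = c * D v))"

text \<open>
  The mean of an extended-real function over a circle, as the integral of the positive part minus
  that of the negative part.  For an upper semicontinuous function with values below \<open>\<infinity>\<close> the
  positive part has finite integral, so the difference is never \<open>\<infinity> - \<infinity>\<close>.
\<close>

definition circle_mean :: "(complex \<Rightarrow> ereal) \<Rightarrow> complex \<Rightarrow> real \<Rightarrow> ereal" where
  "circle_mean u z r =
     (enn2ereal (\<integral>\<^sup>+t\<in>{0..2*pi}. e2ennreal (u (z + of_real r * cis t)) \<partial>lborel) -
      enn2ereal (\<integral>\<^sup>+t\<in>{0..2*pi}. e2ennreal (- u (z + of_real r * cis t)) \<partial>lborel)) / ereal (2*pi)"

definition usc_on :: "'a::topological_space set \<Rightarrow> ('a \<Rightarrow> ereal) \<Rightarrow> bool" where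
  "usc_on S u \<longleftrightarrow> (\<forall>z\<in>S. \<forall>c. u z < c \<longrightarrow> (\<forall>\<^sub>F w in at z within S. u w < c))"

text \<open>The constant function \<open>-\<infinity>\<close> is allowed as a (pluri)subharmonic function.\<close>

definition subharmonic_on :: "complex set \<Rightarrow> (complex \<Rightarrow> ereal) \<Rightarrow> bool" where
  "subharmonic_on S u \<longleftrightarrow>
     (\<forall>z\<in>S. u z < \<infinity>) \<and> usc_on S u \<and>
     (\<forall>z r. r > 0 \<and> cball z r \<subseteq> S \<longrightarrow> u z \<le> circle_mean u z r)"

definition plurisubharmonic_on :: "(complex ^ 'n::finite) set \<Rightarrow> (complex ^ 'n \<Rightarrow> ereal) \<Rightarrow> bool" where
  "plurisubharmonic_on S u \<longleftrightarrow>
     (\<forall>z\<in>S. u z < \<infinity>) \<and> usc_on S u \<and>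
     (\<forall>a b. subharmonic_on {\<zeta>. a + \<zeta> *s b \<in> S} (\<lambda>\<zeta>. u (a + \<zeta> *s b)))"

definition ext_ln :: "real \<Rightarrow> ereal" where
  "ext_ln x = (if x = 0 then -\<infinity> else ereal (ln x))"

definition kobayashi_metric :: "(complex ^ 'n::finite) set \<Rightarrow> complex ^ 'n \<Rightarrow> complex ^ 'n \<Rightarrow> ereal" where
  "kobayashi_metric \<Omega> P \<xi> =
     (INF \<alpha>\<in>{\<alpha>::real. \<alpha> > 0 \<and> (\<exists>\<phi> :: complex \<Rightarrow> complex ^ 'n.
         \<phi> ` ball 0 1 \<subseteq> \<Omega> \<and> (\<forall>i. (\<lambda>z. \<phi> z $ i) holomorphic_on ball 0 1) \<and>
         \<phi> 0 = P \<and> (\<chi> i. deriv (\<lambda>z. \<phi> z $ i) 0) = (1 / \<alpha>) *\<^sub>R \<xi>)}. ereal \<alpha>)"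

definition caratheodory_metric :: "(complex ^ 'n::finite) set \<Rightarrow> complex ^ 'n \<Rightarrow> complex ^ 'n \<Rightarrow> ereal" where
  "caratheodory_metric \<Omega> P \<xi> =
     (SUP f\<in>{f. holomorphic_fun_on f \<Omega> \<and> f ` \<Omega> \<subseteq> ball 0 1 \<and> f P = 0}.
        ereal (cmod (\<Sum>i\<in>UNIV. dz i f P * \<xi> $ i)))"

definition sibony_class :: "(complex ^ 'n::finite) set \<Rightarrow> complex ^ 'n \<Rightarrow> (complex ^ 'n \<Rightarrow> real) set" where
  "sibony_class \<Omega> P =
     {u. plurisubharmonic_on \<Omega> (\<lambda>z. ereal (u z)) \<and> u P = 0 \<and>
         (\<exists>U. open U \<and> P \<in> U \<and> C2_on U u) \<and>
         plurisubharmonic_on \<Omega> (\<lambda>z. ext_ln (u z)) \<and>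
         (\<forall>z\<in>\<Omega>. 0 \<le> u z \<and> u z \<le> 1)}"

text \<open>The complex Hessian of a real \<open>C\<^sup>2\<close> function is Hermitian, so \<open>Re\<close> below discards nothing.\<close>

definition sibony_metric :: "(complex ^ 'n::finite) set \<Rightarrow> complex ^ 'n \<Rightarrow> complex ^ 'n \<Rightarrow> ereal" where
  "sibony_metric \<Omega> P \<xi> =
     (SUP u\<in>sibony_class \<Omega> P. ereal (sqrt (Re (complex_hessian u P \<xi> \<xi>))))"

text \<open>
  Since \<open>dr \<noteq> 0\<close> at the boundary points in \<open>U\<close>, the boundary is locally \<open>{r = 0}\<close>
  and \<open>\<Omega>\<close> lies locally on one side of it.
\<close>

definition local_defining_function ::
  "(complex ^ 'n::finite) set \<Rightarrow> complex ^ 'n \<Rightarrow> (complex ^ 'n) set \<Rightarrow> (complex ^ 'n \<Rightarrow> real) \<Rightarrow> bool" where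
  "local_defining_function \<Omega> P U r \<longleftrightarrow>
     open U \<and> P \<in> U \<and> C2_on U r \<and> \<Omega> \<inter> U = {z\<in>U. r z < 0} \<and>
     (\<forall>z\<in>frontier \<Omega> \<inter> U. \<exists>v. frechet_derivative r (at z) v \<noteq> 0)"

definition has_C2_boundary :: "(complex ^ 'n::finite) set \<Rightarrow> bool" where
  "has_C2_boundary \<Omega> \<longleftrightarrow> (\<forall>p\<in>frontier \<Omega>. \<exists>U r. local_defining_function \<Omega> p U r)"

definition complex_tangent_space :: "(complex ^ 'n::finite \<Rightarrow> real) \<Rightarrow> complex ^ 'n \<Rightarrow> (complex ^ 'n) set" where
  "complex_tangent_space r P =
     {\<xi>. (\<Sum>i\<in>UNIV. dz i (\<lambda>z. complex_of_real (r z)) P * \<xi> $ i) = 0}"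

text \<open>
  Eigenvalues of the Levi form on the complex tangent space, i.e. of the self-adjoint operator
  representing it there with respect to the standard Hermitian inner product.
\<close>

definition levi_eigenvalue :: "(complex ^ 'n::finite \<Rightarrow> real) \<Rightarrow> complex ^ 'n \<Rightarrow> real \<Rightarrow> bool" where
  "levi_eigenvalue r P \<mu> \<longleftrightarrow>
     (\<exists>\<xi>\<in>complex_tangent_space r P. \<xi> \<noteq> 0 \<and>
        (\<forall>\<eta>\<in>complex_tangent_space r P. complex_hessian r P \<xi> \<eta> = of_real \<mu> * herm_inner \<xi> \<eta>))"

definition inner_unit_normal :: "(complex ^ 'n::finite \<Rightarrow> real) \<Rightarrow> complex ^ 'n \<Rightarrow> complex ^ 'n \<Rightarrow> bool" where
  "inner_unit_normal r P N \<longleftrightarrow>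
     norm N = 1 \<and> (\<forall>v. frechet_derivative r (at P) v = 0 \<longrightarrow> N \<bullet> v = 0) \<and>
     frechet_derivative r (at P) N < 0"

definition unit_complex_normal :: "(complex ^ 'n::finite \<Rightarrow> real) \<Rightarrow> complex ^ 'n \<Rightarrow> complex ^ 'n \<Rightarrow> bool" where
  "unit_complex_normal r P \<nu> \<longleftrightarrow>
     norm \<nu> = 1 \<and> (\<forall>\<xi>\<in>complex_tangent_space r P. herm_inner \<nu> \<xi> = 0)"

definition comparable_near_0 :: "(real \<Rightarrow> ereal) \<Rightarrow> (real \<Rightarrow> real) \<Rightarrow> bool" where
  "comparable_near_0 a b \<longleftrightarrow>
     (\<exists>C\<ge>1. \<forall>\<^sub>F \<delta> in at_right 0. ereal (b \<delta> / C) \<le> a \<delta> \<and> a \<delta> \<le> ereal (C * b \<delta>))"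

end

theory Submission
  imports Defs "HOL-Complex_Analysis.Complex_Analysis"
begin

text \<open>
  Let \<open>N\<close> be the inner normal, \<open>T\<close> a unit tangential eigenvector of the Levi form with negative
  eigenvalue, \<open>\<omega>\<close> the complex normal coordinate and \<open>p\<close> the point at distance \<open>\<delta>\<close>.  After a
  quadratic change of coordinates the domain contains \<open>{Re w > - l |\<zeta>|\<^sup>2}\<close> (up to \<open>|w| / 4\<close>) in the plane
  spanned by \<open>N\<close> and \<open>T\<close>; from outside it lies in \<open>{Re \<omega> > - M |z - P|\<^sup>2}\<close>.

  Kobayashi: the disc \<open>\<zeta> = \<rho> t\<^sup>2, w = \<delta> + c \<delta>\<^sup>3\<^sup>/\<^sup>4 t\<close> stays inside.  Conversely, a disc
  with normal derivative at 0 is tangential only to order \<open>t\<^sup>2\<close>, so \<open>h = \<omega> / (1 + M \<omega>)\<close> satisfies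
  \<open>Re h > - C s\<^sup>4\<close> on \<open>|t| < s\<close>, and \<open>s = \<delta>\<^sup>1\<^sup>/\<^sup>4\<close> gives \<open>|h'(0)| \<le> C \<delta>\<^sup>3\<^sup>/\<^sup>4\<close>.

  Caratheodory: difference quotients of \<open>f\<close> in the normal direction are holomorphic on a tangential
  disc of fixed size, and near the rim of that disc \<open>\<Omega>\<close> contains normal discs of fixed size.

  Sibony: the parabolas in the directions \<open>\<plusminus> c N + T\<close> with \<open>c\<^sup>2 = l \<delta> / 4\<close> stay inside at
  a fixed size, so the Levi form of a competitor is bounded in both directions, and the parallelogram law
  gives \<open>C / \<delta>\<close> in the direction \<open>N\<close>.  Conversely, \<open>|\<surd>(h + \<delta>) - \<surd>(h(p) + \<delta>)|\<^sup>2 + |z - p|\<^sup>2\<close>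
  is a competitor near the normal; it is glued to \<open>A |z - p| powr (2 + 2 / ln (1 / \<delta>))\<close>, which dominates
  where \<open>Re h\<close> is negative.
\<close>

text \<open>The exponents come from one balance. Along \<open>T\<close> the boundary recedes by
  \<open>l |\<zeta>|^2\<close>. A disc with normal derivative at 0 moves tangentially only like
  \<open>t^2\<close>, so the gain is \<open>|t|^4\<close>, and \<open>\<delta> + |t|^4\<close>
  against \<open>c |t|\<close> allows \<open>c\<close> of order \<open>\<delta>^(3/4)\<close>. Levi
  forms can be averaged over two directions, so the discs that test a Sibony competitor may be
  tangential to first order: the gain is \<open>|t|^2\<close>, and \<open>\<delta> + |t|^2\<close>
  against \<open>c |t|\<close> allows \<open>c\<close> of order \<open>\<delta>^(1/2)\<close>. Two
  obstacles shape the rest. Plurisubharmonicity is given by means over affine complex lines, while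
  the useful discs are parabolas, so a competitor cannot simply be composed with them. And a glued
  function must be plurisubharmonic together with its logarithm; both properties are drawn from one
  statement, that a bound of \<open>u\<close> by \<open>|exp h|\<close> on a circle persists at the
  centre.\<close>

no_notation fps_nth (infixl "$" 75)

section \<open>Hermitian products and the complex Hessian\<close>

lemma Re_herm_inner: "Re (herm_inner x y) = x \<bullet> y"
  by (simp add: herm_inner_def inner_vec_def inner_complex_def)

lemma herm_inner_add_left: "herm_inner (x + y) z = herm_inner x z + herm_inner y z"
  by (simp add: herm_inner_def algebra_simps sum.distrib)

lemma herm_inner_diff_left: "herm_inner (x - y) z = herm_inner x z - herm_inner y z"
  by (simp add: herm_inner_def algebra_simps sum_subtractf)

lemma herm_inner_scale_left: "herm_inner (c *s x) z = c * herm_inner x z"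
  by (simp add: herm_inner_def algebra_simps sum_distrib_left)

lemma herm_inner_scaleR_left: "herm_inner (c *\<^sub>R x) z = of_real c * herm_inner x z"
  by (simp add: herm_inner_def algebra_simps sum_distrib_left scaleR_conv_of_real[where 'a=complex])

lemma herm_inner_zero_left [simp]: "herm_inner 0 z = 0"
  by (simp add: herm_inner_def)

lemma cnj_herm_inner: "cnj (herm_inner x y) = herm_inner y x"
  by (simp add: herm_inner_def mult.commute)

lemma herm_inner_scale_right: "herm_inner z (c *s x) = cnj c * herm_inner z x"
  by (metis cnj_herm_inner complex_cnj_mult herm_inner_scale_left)

lemma herm_inner_diff_right: "herm_inner z (x - y) = herm_inner z x - herm_inner z y"
  by (metis cnj_herm_inner complex_cnj_diff herm_inner_diff_left)

lemma herm_inner_self: "herm_inner x x = of_real ((norm x)\<^sup>2)"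
proof -
  have "Im (herm_inner x x) = 0"
    by (simp add: herm_inner_def)
  then show ?thesis
    by (simp add: complex_eq_iff Re_herm_inner power2_norm_eq_inner)
qed

lemma norm_smult_vec: "norm (c *s x) = cmod c * norm (x :: complex ^ 'n::finite)"
proof -
  have "of_real ((norm (c *s x))\<^sup>2) = (of_real ((cmod c * norm x)\<^sup>2) :: complex)"
    unfolding herm_inner_self[symmetric] herm_inner_scale_left herm_inner_scale_right
    using complex_norm_square[of c] by (auto simp add: herm_inner_self power_mult_distrib mult_ac)
  then have "(norm (c *s x))\<^sup>2 = (cmod c * norm x)\<^sup>2"
    using of_real_eq_iff by blast
  then show ?thesis
    by simp
qed

lemma scaleR_eq_smult: "c *\<^sub>R x = complex_of_real c *s (x :: complex ^ 'n::finite)"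
  by (simp add: vec_eq_iff scaleR_conv_of_real[where 'a = complex])

lemma smult_zero_left [simp]: "(0::complex) *s (x :: complex ^ 'n::finite) = 0"
  by (simp add: vec_eq_iff)

text \<open>Multiplying \<open>x\<close> by a suitable unit complex number makes the product real
  and nonnegative, and the real Cauchy-Schwarz inequality applies.\<close>

lemma norm_herm_inner_le: "cmod (herm_inner x y) \<le> norm x * norm y"
proof (cases "herm_inner x y = 0")
  case False
  define c where "c = cnj (sgn (herm_inner x y))"
  have c1: "cmod c = 1"
    using False by (simp add: c_def norm_sgn)
  have "c * herm_inner x y = of_real (cmod (herm_inner x y))"
    using False unfolding c_def sgn_eq
    by (simp add: mult.commute complex_norm_square[symmetric] power2_eq_square)
  then have "cmod (herm_inner x y) = Re (herm_inner (c *s x) y)"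
    by (simp add: herm_inner_scale_left)
  also have "\<dots> \<le> norm (c *s x) * norm y"
    unfolding Re_herm_inner by (rule norm_cauchy_schwarz)
  finally show ?thesis
    by (simp add: norm_smult_vec c1)
qed simp

lemma bounded_linear_herm_inner: "bounded_linear (\<lambda>x. herm_inner x y)"
proof (rule bounded_linear_intro[where K = "norm y"])
  show "herm_inner (r *\<^sub>R x) y = r *\<^sub>R herm_inner x y" for r x
    by (simp add: scaleR_eq_smult herm_inner_scale_left scaleR_conv_of_real)
qed (auto simp: herm_inner_add_left norm_herm_inner_le)

lemma bounded_linear_smult_left: "bounded_linear (\<lambda>c::complex. c *s (x :: complex ^ 'n::finite))"
proof (rule bounded_linear_intro[where K = "norm x"])
  show "(r *\<^sub>R c) *s x = r *\<^sub>R (c *s x)" for r c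
    by (simp add: vec_eq_iff)
qed (auto simp: norm_smult_vec vec_eq_iff algebra_simps)

lemmas has_derivative_smult_left [derivative_intros] =
  bounded_linear.has_derivative[OF bounded_linear_smult_left]
lemmas has_derivative_herm_inner [derivative_intros] =
  bounded_linear.has_derivative[OF bounded_linear_herm_inner]
lemmas continuous_on_smult_left [continuous_intros] =
  bounded_linear.continuous_on[OF bounded_linear_smult_left]
lemmas continuous_on_herm_inner [continuous_intros] =
  bounded_linear.continuous_on[OF bounded_linear_herm_inner]

text \<open>Pythagoras for the complex normal coordinate and the complex tangential part. It
  separates the summand \<open>|\<omega>|^2\<close> of the outer quadratic bound, which a Moebius
  map absorbs, from the tangential summand, which has to be estimated.\<close>

lemma norm_decomp:
  assumes "norm N = 1"
  shows "(norm v)\<^sup>2 = (cmod (herm_inner v N))\<^sup>2 + (norm (v - herm_inner v N *s N))\<^sup>2"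
proof -
  define w where "w = herm_inner v N"
  have NN: "herm_inner N N = 1"
    using assms by (simp add: herm_inner_self)
  have "of_real ((norm (v - w *s N))\<^sup>2) = herm_inner v v - w * cnj w"
    unfolding herm_inner_self[symmetric] herm_inner_diff_left herm_inner_diff_right
      herm_inner_scale_left herm_inner_scale_right NN
    using cnj_herm_inner[of v N] by (simp add: w_def algebra_simps)
  also have "\<dots> = of_real ((norm v)\<^sup>2 - (cmod w)\<^sup>2)"
    by (simp add: herm_inner_self complex_norm_square[symmetric])
  finally have "(norm (v - w *s N))\<^sup>2 = (norm v)\<^sup>2 - (cmod w)\<^sup>2"
    using of_real_eq_iff by blast
  then show ?thesis
    by (simp add: w_def)
qed

text \<open>The remainder along the segment is differentiated once, and differentiability of
  \<open>f'\<close> at the single point \<open>x\<close> makes that derivative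
  \<open>o(|v|^2)\<close>; the mean value theorem then gives an error with \<open>e\<close>
  arbitrarily small.\<close>

lemma taylor_second_order:
  fixes f :: "'a::real_normed_vector \<Rightarrow> real"
  assumes "open U" "x \<in> U"
    and f': "\<And>y. y \<in> U \<Longrightarrow> (f has_derivative blinfun_apply (f' y)) (at y)"
    and f'': "(f' has_derivative blinfun_apply f'') (at x)"
    and "e > 0"
  obtains d where "d > 0" "\<And>v. norm v < d \<Longrightarrow> x + v \<in> U"
    "\<And>v. norm v < d \<Longrightarrow> \<bar>f (x + v) - f x - f' x v - f'' v v / 2\<bar> \<le> e * (norm v)\<^sup>2"
proof -
  obtain d1 where d1: "d1 > 0" "\<And>y. norm (y - x) < d1 \<Longrightarrow> norm (f' y - f' x - f'' (y - x)) \<le> e * norm (y - x)"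
    using f'' \<open>e > 0\<close> unfolding has_derivative_at_alt by blast
  obtain d2 where d2: "d2 > 0" "ball x d2 \<subseteq> U"
    using assms(1,2) open_contains_ball by blast
  define d where "d = min d1 d2"
  have inU: "x + v \<in> U" if "norm v < d" for v
    using that d2(2) by (auto simp: d_def dist_norm subset_eq)
  show ?thesis
  proof (rule that[of d])
    show "d > 0" using d1 d2 by (simp add: d_def)
    show "x + v \<in> U" if "norm v < d" for v by (rule inU[OF that])
    fix v :: 'a assume v: "norm v < d"
    define g where "g t = f (x + t *\<^sub>R v) - t * f' x v - t\<^sup>2 / 2 * f'' v v" for t
    have sc: "norm (t *\<^sub>R v) < d" if "0 \<le> t" "t \<le> 1" for t
    proof -
      have "norm (t *\<^sub>R v) \<le> norm v"
        using that by (simp add: mult_left_le_one_le)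
      then show ?thesis using v by simp
    qed
    have der: "(g has_real_derivative (f' (x + t *\<^sub>R v) v - f' x v - t * f'' v v)) (at t)"
      if t: "0 \<le> t" "t \<le> 1" for t
    proof -
      have "((\<lambda>t. f (x + t *\<^sub>R v)) has_derivative (\<lambda>s. f' (x + t *\<^sub>R v) (s *\<^sub>R v))) (at t)"
        by (rule has_derivative_compose[of "\<lambda>t. x + t *\<^sub>R v", OF _ f'[OF inU[OF sc[OF t]]]])
           (auto intro!: derivative_eq_intros)
      then have "((\<lambda>t. f (x + t *\<^sub>R v)) has_real_derivative f' (x + t *\<^sub>R v) v) (at t)"
        by (simp add: has_field_derivative_def blinfun.scaleR_right mult.commute[of _ "f' _ _"] mult_commute_abs)
      then show ?thesis
        unfolding g_def by (auto intro!: derivative_eq_intros)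
    qed
    have "\<exists>z>0. z < 1 \<and> g 1 - g 0 = (1 - 0) * (f' (x + z *\<^sub>R v) v - f' x v - z * f'' v v)"
      by (rule MVT2) (use der in auto)
    then obtain z where z: "0 < z" "z < 1" "g 1 - g 0 = f' (x + z *\<^sub>R v) v - f' x v - z * f'' v v"
      by auto
    have "norm (z *\<^sub>R v) < d1"
      using sc[of z] z by (simp add: d_def)
    then have "norm (f' (x + z *\<^sub>R v) - f' x - f'' (z *\<^sub>R v)) \<le> e * norm (z *\<^sub>R v)"
      using d1(2)[of "x + z *\<^sub>R v"] by simp
    then have le: "norm (f' (x + z *\<^sub>R v) - f' x - f'' (z *\<^sub>R v)) * norm v \<le> e * norm (z *\<^sub>R v) * norm v"
      by (rule mult_right_mono) simp
    have "\<bar>g 1 - g 0\<bar> = norm ((f' (x + z *\<^sub>R v) - f' x - f'' (z *\<^sub>R v)) v)"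
      by (simp add: z(3) blinfun.diff_left blinfun.scaleR_right blinfun.scaleR_left)
    also have "\<dots> \<le> norm (f' (x + z *\<^sub>R v) - f' x - f'' (z *\<^sub>R v)) * norm v"
      by (rule norm_blinfun)
    also have "\<dots> \<le> e * norm (z *\<^sub>R v) * norm v"
      by (rule le)
    also have "\<dots> = z * (e * (norm v)\<^sup>2)"
      using z by (simp add: power2_eq_square)
    also have "\<dots> \<le> e * (norm v)\<^sup>2"
      using z \<open>e > 0\<close> by (simp add: mult_left_le_one_le)
    finally show "\<bar>f (x + v) - f x - f' x v - f'' v v / 2\<bar> \<le> e * (norm v)\<^sup>2"
      by (simp add: g_def algebra_simps)
  qed
qed

section \<open>Wirtinger derivatives in terms of the Frechet derivative\<close>

lemma dir_deriv_complex:
  assumes "(f has_derivative D) (at z)"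
  shows "dir_deriv f v z = D v"
proof -
  have "((\<lambda>t. f (z + t *\<^sub>R v)) has_derivative (\<lambda>s. D (s *\<^sub>R v))) (at 0)"
    by (rule has_derivative_compose[of "\<lambda>t. z + t *\<^sub>R v"])
       (use assms in \<open>auto intro!: derivative_eq_intros\<close>)
  then have "((\<lambda>t. f (z + t *\<^sub>R v)) has_vector_derivative D v) (at 0)"
    using has_derivative_linear[OF assms] by (simp add: has_vector_derivative_def linear_scale)
  then show ?thesis
    unfolding dir_deriv_def by (rule vector_derivative_at)
qed

lemma dir_deriv_of_real:
  assumes "(f has_derivative D) (at z)"
  shows "dir_deriv (\<lambda>z. complex_of_real (f z)) v z = of_real (D v)"
proof -
  have "((\<lambda>z. complex_of_real (f z)) has_derivative (\<lambda>v. of_real (D v))) (at z)"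
    using assms by (rule has_derivative_of_real)
  then show ?thesis
    by (rule dir_deriv_complex)
qed

text \<open>The right-hand side is the complex-linear part of the real-linear map \<open>D\<close>,
  so it is determined by its values at the coordinate vectors. It vanishes exactly when
  \<open>D\<close> annihilates both \<open>\<xi>\<close> and \<open>\<i> *s \<xi>\<close>, which is
  how membership in the complex tangent space is used.\<close>

lemma sum_dz_real:
  fixes f :: "complex ^ 'n::finite \<Rightarrow> real"
  assumes "(f has_derivative D) (at z)"
  shows "(\<Sum>i\<in>UNIV. dz i (\<lambda>z. complex_of_real (f z)) z * \<xi> $ i)
    = (of_real (D \<xi>) - \<i> * of_real (D (\<i> *s \<xi>))) / 2"
proof -
  have lin: "linear D"
    using assms by (rule has_derivative_linear)
  define E where "E v = (of_real (D v) - \<i> * of_real (D (\<i> *s v))) / 2" for v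
  have E_add: "E (x + y) = E x + E y" for x y
    by (simp add: E_def linear_add[OF lin] vector_add_ldistrib algebra_simps add_divide_distrib diff_divide_distrib)
  have E_sum: "E (sum g A) = (\<Sum>i\<in>A. E (g i))" if "finite A" for g and A :: "'n set"
    using that
  proof (induction A rule: finite_induct)
    case empty
    have "\<i> *s (0 :: complex^'n) = 0"
      by (simp add: vec_eq_iff)
    then show ?case
      by (simp add: E_def linear_0[OF lin])
  qed (simp add: E_add)
  have E_scale: "E (c *s x) = c * E x" for c x
  proof -
    have 1: "c *s x = Re c *\<^sub>R x + Im c *\<^sub>R (\<i> *s x)"
      by (simp add: vec_eq_iff complex_eq_iff)
    have 2: "\<i> *s (c *s x) = Re c *\<^sub>R (\<i> *s x) - Im c *\<^sub>R x"
      by (simp add: vec_eq_iff complex_eq_iff)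
    show ?thesis
      unfolding E_def 2 unfolding 1 linear_add[OF lin] linear_diff[OF lin] linear_scale[OF lin]
      by (simp add: complex_eq_iff algebra_simps add_divide_distrib diff_divide_distrib)
  qed
  have "dz i (\<lambda>z. complex_of_real (f z)) z = E (axis i 1)" for i
  proof -
    have "\<i> *s axis i 1 = (axis i \<i> :: complex ^ 'n)"
      by (simp add: vec_eq_iff axis_def)
    then show ?thesis
      by (simp add: dz_def E_def dir_deriv_of_real[OF assms])
  qed
  then have "(\<Sum>i\<in>UNIV. dz i (\<lambda>z. complex_of_real (f z)) z * \<xi> $ i) = (\<Sum>i\<in>UNIV. E ((\<xi> $ i) *s axis i 1))"
    by (simp add: E_scale mult.commute)
  also have "\<dots> = E \<xi>"
    by (simp add: E_sum[symmetric] basis_expansion)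
  finally show ?thesis
    by (simp add: E_def)
qed

lemma sum_dz_holomorphic:
  fixes f :: "complex ^ 'n::finite \<Rightarrow> complex"
  assumes D: "(f has_derivative D) (at z)" and hom: "\<And>c v. D (c *s v) = c * D v"
  shows "(\<Sum>i\<in>UNIV. dz i f z * \<xi> $ i) = D \<xi>"
proof -
  have lin: "linear D"
    using D by (rule has_derivative_linear)
  have "dz i f z = D (axis i 1)" for i
  proof -
    have "axis i \<i> = \<i> *s (axis i 1 :: complex ^ 'n)"
      by (simp add: vec_eq_iff axis_def)
    then have "D (axis i \<i>) = \<i> * D (axis i 1)"
      using hom by simp
    then show ?thesis
      by (simp add: dz_def dir_deriv_complex[OF D])
  qed
  then have "(\<Sum>i\<in>UNIV. dz i f z * \<xi> $ i) = (\<Sum>i\<in>UNIV. D ((\<xi> $ i) *s axis i 1))"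
    by (simp add: hom mult.commute)
  also have "\<dots> = D (\<Sum>i\<in>UNIV. (\<xi> $ i) *s axis i 1)"
    by (simp add: linear_sum[OF lin])
  finally show ?thesis
    by (simp add: basis_expansion)
qed

text \<open>The expression is the sesquilinear part of the real bilinear form \<open>f''\<close>, so
  it suffices to compare both sides on coordinate vectors. The first argument of \<open>f''\<close>
  is the direction of the outer derivative \<open>dz i\<close>, the second that of
  \<open>dzbar j\<close>.\<close>

lemma complex_hessian_eq:
  fixes u :: "complex ^ 'n::finite \<Rightarrow> real"
  assumes U: "open U" "P \<in> U"
    and f': "\<And>y. y \<in> U \<Longrightarrow> (u has_derivative blinfun_apply (f' y)) (at y)"
    and f'': "(f' has_derivative blinfun_apply f'') (at P)"
  shows "complex_hessian u P \<xi> \<eta> =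
    (of_real (f'' \<xi> \<eta> + f'' (\<i> *s \<xi>) (\<i> *s \<eta>))
      + \<i> * of_real (f'' \<xi> (\<i> *s \<eta>) - f'' (\<i> *s \<xi>) \<eta>)) / 4"
proof -
  define B where "B \<xi> \<eta> = (of_real (f'' \<xi> \<eta> + f'' (\<i> *s \<xi>) (\<i> *s \<eta>))
      + \<i> * of_real (f'' \<xi> (\<i> *s \<eta>) - f'' (\<i> *s \<xi>) \<eta>)) / 4" for \<xi> \<eta> :: "complex ^ 'n"
  have i0: "\<i> *s (0 :: complex^'n) = 0"
    by (simp add: vec_eq_iff)
  have c_eq: "c *s x = Re c *\<^sub>R x + Im c *\<^sub>R (\<i> *s x)" for c and x :: "complex^'n"
    by (simp add: vec_eq_iff complex_eq_iff)
  have ic_eq: "\<i> *s (c *s x) = Re c *\<^sub>R (\<i> *s x) - Im c *\<^sub>R x" for c and x :: "complex^'n"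
    by (simp add: vec_eq_iff complex_eq_iff)
  note bl = blinfun.add_left blinfun.add_right blinfun.diff_left blinfun.diff_right
    blinfun.scaleR_left blinfun.scaleR_right blinfun.zero_left blinfun.zero_right
  have add1: "B (x + y) z = B x z + B y z" for x y z
    by (simp add: B_def vector_add_ldistrib bl add_divide_distrib diff_divide_distrib algebra_simps)
  have add2: "B z (x + y) = B z x + B z y" for x y z
    by (simp add: B_def vector_add_ldistrib bl add_divide_distrib diff_divide_distrib algebra_simps)
  have sum1: "B (sum g A) z = (\<Sum>i\<in>A. B (g i) z)" if "finite A" for g and A :: "'n set" and z
    using that by (induction A rule: finite_induct) (simp_all add: add1, simp add: B_def i0 bl)
  have sum2: "B z (sum g A) = (\<Sum>i\<in>A. B z (g i))" if "finite A" for g and A :: "'n set" and z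
    using that by (induction A rule: finite_induct) (simp_all add: add2, simp add: B_def i0 bl)
  have sc1: "B (c *s x) z = c * B x z" for c x z
    unfolding B_def ic_eq unfolding c_eq[of c] bl by (simp add: complex_eq_iff bl field_simps)
  have sc2: "B z (c *s x) = cnj c * B z x" for c x z
    unfolding B_def ic_eq unfolding c_eq[of c] bl by (simp add: complex_eq_iff bl field_simps)
  have iax: "axis i \<i> = \<i> *s (axis i 1 :: complex ^ 'n)" for i
    by (simp add: vec_eq_iff axis_def)
  have inner: "dzbar j (\<lambda>z. complex_of_real (u z)) z
     = (of_real (f' z (axis j 1)) + \<i> * of_real (f' z (axis j \<i>))) / 2" if "z \<in> U" for j z
    by (simp add: dzbar_def dir_deriv_of_real[OF f'[OF that]])
  have second: "dir_deriv (dzbar j (\<lambda>z. complex_of_real (u z))) v P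
     = (of_real (f'' v (axis j 1)) + \<i> * of_real (f'' v (axis j \<i>))) / 2" for j v
  proof -
    have app: "((\<lambda>z. blinfun_apply (f' z) w) has_derivative (\<lambda>v. f'' v w)) (at P)" for w
      by (rule bounded_linear.has_derivative[OF blinfun.bounded_linear_left f''])
    let ?g = "\<lambda>z. (complex_of_real (f' z (axis j 1)) + \<i> * complex_of_real (f' z (axis j \<i>))) / 2"
    have "(?g has_derivative (\<lambda>v. (complex_of_real (f'' v (axis j 1)) + \<i> * complex_of_real (f'' v (axis j \<i>))) / 2)) (at P)"
      by (rule bounded_linear.has_derivative[OF bounded_linear_divide has_derivative_add[OF
            has_derivative_of_real[OF app] has_derivative_mult_right[OF has_derivative_of_real[OF app]]]])
    then have "(dzbar j (\<lambda>z. complex_of_real (u z)) has_derivative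
       (\<lambda>v. (complex_of_real (f'' v (axis j 1)) + \<i> * complex_of_real (f'' v (axis j \<i>))) / 2)) (at P)"
      by (rule has_derivative_transform_within_open[OF _ U]) (simp add: inner)
    then show ?thesis
      by (rule dir_deriv_complex)
  qed
  have "dz i (dzbar j (\<lambda>z. complex_of_real (u z))) P = B (axis i 1) (axis j 1)" for i j
    by (simp add: dz_def second iax B_def complex_eq_iff)
  then have "complex_hessian u P \<xi> \<eta> = (\<Sum>i\<in>UNIV. \<Sum>j\<in>UNIV. B ((\<xi> $ i) *s axis i 1) ((\<eta> $ j) *s axis j 1))"
    by (simp add: complex_hessian_def sc1 sc2 mult_ac)
  also have "\<dots> = B \<xi> \<eta>"
    by (simp add: sum1[symmetric] sum2[symmetric] basis_expansion)
  finally show ?thesis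
    by (simp add: B_def)
qed

section \<open>The sub-mean value property\<close>

text \<open>On the unit circle \<open>z * cnj z = 1\<close>, so one factor \<open>z\<close> can be
  split off both polynomials at once; in the mixed term \<open>p0 * cnj (z * poly q z)\<close>
  conjugation does not change the real part. The induction therefore lowers the degree of
  \<open>q\<close> while \<open>p\<close> stays arbitrary.\<close>

lemma Re_mult_cnj_poly_on_circle:
  fixes p q :: "complex poly"
  shows "\<exists>s. \<forall>z. cmod z = 1 \<longrightarrow> Re (poly p z * cnj (poly q z)) = Re (poly s z)"
proof (induction q arbitrary: p)
  case 0
  then show ?case
    by (intro exI[of _ 0]) simp
next
  case (pCons c q)
  obtain p0 p' where p: "p = pCons p0 p'"
    by (rule pCons_cases)
  obtain s where s: "\<And>z. cmod z = 1 \<Longrightarrow> Re (poly p' z * cnj (poly q z)) = Re (poly s z)"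
    using pCons.IH[of p'] by blast
  show ?case
  proof (intro exI[of _ "smult (cnj c) p + s + smult (cnj p0) (pCons 0 q)"] allI impI)
    fix z :: complex assume z: "cmod z = 1"
    have zz: "z * cnj z = 1"
      using z complex_norm_square[of z] by simp
    have "poly p z * cnj (poly (pCons c q) z) =
        cnj c * poly p z + p0 * cnj (z * poly q z) + (z * cnj z) * (poly p' z * cnj (poly q z))"
      by (simp add: p algebra_simps)
    then have "Re (poly p z * cnj (poly (pCons c q) z)) =
        Re (cnj c * poly p z) + Re (p0 * cnj (z * poly q z)) + Re (poly s z)"
      using s[OF z] by (simp add: zz)
    also have "Re (p0 * cnj (z * poly q z)) = Re (cnj p0 * (z * poly q z))"
      by (simp add: algebra_simps)
    finally show "Re (poly p z * cnj (poly (pCons c q) z)) =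
       Re (poly (smult (cnj c) p + s + smult (cnj p0) (pCons 0 q)) z)"
      by (simp only: poly_add poly_smult poly_pCons plus_complex.sel add_0 add_ac)
  qed
qed

text \<open>Real parts of polynomials form an algebra on the circle: \<open>Re a * Re b\<close> is
  half of \<open>Re (a * b) + Re (a * cnj b)\<close>, and the conjugate product is again the real
  part of a polynomial there.\<close>

lemma real_polynomial_function_on_circle:
  fixes g :: "complex \<Rightarrow> real"
  assumes "real_polynomial_function g"
  shows "\<exists>p. \<forall>z. cmod z = 1 \<longrightarrow> g z = Re (poly p z)"
  using assms
proof (induction g rule: real_polynomial_function.induct)
  case (linear f)
  have "f z = Re (poly [:0, Complex (f 1) (- f \<i>):] z)" for z
  proof -
    have "f z = f (Re z *\<^sub>R 1 + Im z *\<^sub>R \<i>)"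
      by (rule arg_cong[of _ _ f]) (simp add: complex_eq_iff)
    also have "\<dots> = Re z * f 1 + Im z * f \<i>"
      using linear by (simp add: linear_simps)
    finally show ?thesis
      by simp
  qed
  then show ?case by blast
next
  case (const c)
  then show ?case
    by (intro exI[of _ "[:of_real c:]"]) simp
next
  case (add f g)
  then obtain p q where "\<forall>z. cmod z = 1 \<longrightarrow> f z = Re (poly p z)" "\<forall>z. cmod z = 1 \<longrightarrow> g z = Re (poly q z)"
    by blast
  then show ?case
    by (intro exI[of _ "p + q"]) simp
next
  case (mult f g)
  then obtain p q where pq: "\<forall>z. cmod z = 1 \<longrightarrow> f z = Re (poly p z)" "\<forall>z. cmod z = 1 \<longrightarrow> g z = Re (poly q z)"
    by blast
  obtain s where s: "\<forall>z. cmod z = 1 \<longrightarrow> Re (poly p z * cnj (poly q z)) = Re (poly s z)"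
    using Re_mult_cnj_poly_on_circle by blast
  have "Re a * Re b = (Re (a * b) + Re (a * cnj b)) / 2" for a b
    by simp
  then show ?case
    using pq s by (intro exI[of _ "smult (1/2) (p * q + s)"]) (auto simp: field_simps)
qed

text \<open>Stone-Weierstrass stands in for the Poisson integral: it gives a majorant
  \<open>Re h\<close> that is harmonic on the whole plane and within \<open>e\<close> of
  \<open>f\<close> on the circle, so that its value at the centre exceeds the mean of
  \<open>f\<close> by at most \<open>e\<close>. Shifting the approximation by \<open>e / 2\<close>
  makes it one-sided.\<close>

lemma continuous_on_circle_approx:
  fixes f :: "complex \<Rightarrow> real"
  assumes "r > 0" "continuous_on (sphere z r) f" "e > 0"
  obtains h where "h holomorphic_on UNIV"
    "\<And>w. w \<in> sphere z r \<Longrightarrow> f w \<le> Re (h w)" "\<And>w. w \<in> sphere z r \<Longrightarrow> Re (h w) \<le> f w + e"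
proof -
  have "continuous_on (sphere 0 1) (\<lambda>\<xi>. f (z + of_real r * \<xi>))"
    by (rule continuous_on_compose2[OF assms(2)])
       (use \<open>r > 0\<close> in \<open>auto intro!: continuous_intros simp: dist_norm norm_mult\<close>)
  then obtain g where g: "real_polynomial_function g"
      "\<And>\<xi>. \<xi> \<in> sphere 0 1 \<Longrightarrow> \<bar>f (z + of_real r * \<xi>) - g \<xi>\<bar> < e / 2"
    using Stone_Weierstrass_real_polynomial_function[of "sphere 0 1" "\<lambda>\<xi>. f (z + of_real r * \<xi>)" "e/2"] \<open>e > 0\<close>
    by auto
  obtain p where p: "\<And>\<xi>. cmod \<xi> = 1 \<Longrightarrow> g \<xi> = Re (poly p \<xi>)"
    using real_polynomial_function_on_circle[OF g(1)] by blast
  define h where "h w = poly p ((w - z) / of_real r) + of_real (e / 2)" for w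
  have main: "f w \<le> Re (h w) \<and> Re (h w) \<le> f w + e" if "w \<in> sphere z r" for w
  proof -
    have 1: "cmod ((w - z) / of_real r) = 1"
      using that \<open>r > 0\<close> by (simp add: norm_divide dist_norm norm_minus_commute)
    have "z + of_real r * ((w - z) / of_real r) = w"
      using \<open>r > 0\<close> by simp
    then have "\<bar>f w - Re (poly p ((w - z) / of_real r))\<bar> < e / 2"
      using g(2)[of "(w - z) / of_real r"] p[OF 1] 1 by simp
    moreover have "Re (h w) = Re (poly p ((w - z) / of_real r)) + e / 2"
      by (simp add: h_def)
    ultimately show ?thesis
      by linarith
  qed
  show ?thesis
  proof (rule that[of h])
    show "h holomorphic_on UNIV"
      unfolding h_def using \<open>r > 0\<close> by (auto intro!: holomorphic_intros)
  qed (use main in auto)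
qed

section \<open>Circle means as integrals\<close>

lemma holomorphic_mean_value:
  assumes "h holomorphic_on S" "open S" "cball z r \<subseteq> S" "r > 0"
  shows "((\<lambda>t. h (z + of_real r * cis t)) has_integral (2 * of_real pi * h z)) {0..2*pi}"
proof -
  have "((\<lambda>u. h u / (u - z)) has_contour_integral (2 * of_real pi * \<i> * h z)) (circlepath z r)"
    using assms
    by (intro Cauchy_integral_circlepath)
       (auto intro: holomorphic_on_imp_continuous_on holomorphic_on_subset
             dest: order_trans[OF ball_subset_cball])
  then have "((\<lambda>t. h (z + of_real r * cis t) / (z + of_real r * cis t - z) * of_real r * \<i> * cis t)
       has_integral (2 * of_real pi * \<i> * h z)) {0..2*pi}"
    unfolding circlepath_def by (subst (asm) has_contour_integral_part_circlepath_iff) auto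
  then have "((\<lambda>t. \<i> * h (z + of_real r * cis t)) has_integral (\<i> * (2 * of_real pi * h z))) {0..2*pi}"
    using \<open>r > 0\<close> by (simp add: mult_ac)
  then show ?thesis
    by (subst (asm) has_integral_mult_right_iff) auto
qed

lemma Re_holomorphic_mean_value:
  assumes "h holomorphic_on S" "open S" "cball z r \<subseteq> S" "r > 0"
  shows "((\<lambda>t. Re (h (z + of_real r * cis t))) has_integral (2 * pi * Re (h z))) {0..2*pi}"
  using has_integral_Re[OF holomorphic_mean_value[OF assms]] by simp

lemma nn_integral_Icc_continuous:
  fixes g :: "real \<Rightarrow> real"
  assumes "continuous_on {a..b} g" "\<And>t. t \<in> {a..b} \<Longrightarrow> 0 \<le> g t"
  shows "(\<integral>\<^sup>+t\<in>{a..b}. ennreal (g t) \<partial>lborel) = ennreal (integral {a..b} g)"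
proof -
  note si = borel_integrable_atLeastAtMost'[OF assms(1)]
  have "(\<integral>\<^sup>+t\<in>{a..b}. ennreal (g t) \<partial>lborel) = (\<integral>\<^sup>+t. ennreal (indicator {a..b} t *\<^sub>R g t) \<partial>lborel)"
    by (intro nn_integral_cong) (auto split: split_indicator)
  also have "\<dots> = ennreal (LINT t|lborel. indicator {a..b} t *\<^sub>R g t)"
    using si assms(2) unfolding set_integrable_def
    by (intro nn_integral_eq_integral) (auto split: split_indicator)
  also have "(LINT t|lborel. indicator {a..b} t *\<^sub>R g t) = integral {a..b} g"
    using set_borel_integral_eq_integral(2)[OF si] by (simp add: set_lebesgue_integral_def)
  finally show ?thesis .
qed

text \<open>\<open>ennreal\<close> sends negative numbers to 0, so the two integrals are those of
  the positive and the negative part of \<open>q\<close>, the form in which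
  \<open>circle_mean\<close> is defined.\<close>

lemma circle_parts:
  fixes q :: "real \<Rightarrow> real"
  assumes "continuous_on {0..2*pi} q" "(q has_integral 2 * pi * m) {0..2*pi}"
  obtains a b where "a \<ge> 0" "b \<ge> 0" "a - b = 2 * pi * m"
    "(\<integral>\<^sup>+t\<in>{0..2*pi}. ennreal (q t) \<partial>lborel) = ennreal a"
    "(\<integral>\<^sup>+t\<in>{0..2*pi}. ennreal (- q t) \<partial>lborel) = ennreal b"
proof (rule that)
  let ?I = "{0..2*pi::real}"
  have c1: "continuous_on ?I (\<lambda>t. max 0 (q t))" and c2: "continuous_on ?I (\<lambda>t. max 0 (- q t))"
    by (intro continuous_intros assms)+
  show "0 \<le> integral ?I (\<lambda>t. max 0 (q t))" "0 \<le> integral ?I (\<lambda>t. max 0 (- q t))"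
    by (intro integral_nonneg integrable_continuous_interval c1 c2; simp)+
  have "integral ?I (\<lambda>t. max 0 (q t)) - integral ?I (\<lambda>t. max 0 (- q t))
      = integral ?I (\<lambda>t. max 0 (q t) - max 0 (- q t))"
    by (intro integral_diff[symmetric] integrable_continuous_interval c1 c2)
  also have "\<dots> = integral ?I q"
    by (intro integral_cong) auto
  also have "\<dots> = 2 * pi * m"
    using assms(2) by (rule integral_unique)
  finally show "integral ?I (\<lambda>t. max 0 (q t)) - integral ?I (\<lambda>t. max 0 (- q t)) = 2 * pi * m" .
  have pos: "ennreal (max 0 x) = ennreal x" for x
    by (simp add: max_def ennreal_neg)
  show "(\<integral>\<^sup>+t\<in>?I. ennreal (q t) \<partial>lborel) = ennreal (integral ?I (\<lambda>t. max 0 (q t)))"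
    by (subst nn_integral_Icc_continuous[OF c1, symmetric]) (auto simp: pos)
  show "(\<integral>\<^sup>+t\<in>?I. ennreal (- q t) \<partial>lborel) = ennreal (integral ?I (\<lambda>t. max 0 (- q t)))"
    by (subst nn_integral_Icc_continuous[OF c2, symmetric]) (auto simp: pos)
qed

lemma circle_mean_le:
  assumes q: "continuous_on {0..2*pi} q" "(q has_integral 2 * pi * m) {0..2*pi}"
    and le: "\<And>t. t \<in> {0..2*pi} \<Longrightarrow> f (z + of_real r * cis t) \<le> ereal (q t)"
  shows "circle_mean f z r \<le> ereal m"
proof -
  obtain a b where ab: "a \<ge> 0" "b \<ge> 0" "a - b = 2 * pi * m"
    "(\<integral>\<^sup>+t\<in>{0..2*pi}. ennreal (q t) \<partial>lborel) = ennreal a"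
    "(\<integral>\<^sup>+t\<in>{0..2*pi}. ennreal (- q t) \<partial>lborel) = ennreal b"
    using circle_parts[OF q] .
  define A where "A = (\<integral>\<^sup>+t\<in>{0..2*pi}. e2ennreal (f (z + of_real r * cis t)) \<partial>lborel)"
  define B where "B = (\<integral>\<^sup>+t\<in>{0..2*pi}. e2ennreal (- f (z + of_real r * cis t)) \<partial>lborel)"
  have "A \<le> ennreal a"
    unfolding A_def ab(4)[symmetric]
    using e2ennreal_mono[OF le] by (intro nn_integral_mono) (auto split: split_indicator)
  then have A: "enn2ereal A \<le> ereal a"
    using ab(1) by (metis enn2ereal_ennreal less_eq_ennreal.rep_eq)
  have "e2ennreal (ereal (- q t)) \<le> e2ennreal (- f (z + of_real r * cis t))" if "t \<in> {0..2*pi}" for t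
    using le[OF that] by (intro e2ennreal_mono) (metis ereal_minus_le_minus uminus_ereal.simps(1))
  then have "ennreal b \<le> B"
    unfolding B_def ab(5)[symmetric]
    by (intro nn_integral_mono) (auto split: split_indicator)
  then have B: "ereal b \<le> enn2ereal B"
    using ab(2) by (metis enn2ereal_ennreal less_eq_ennreal.rep_eq)
  have "enn2ereal A - enn2ereal B \<le> ereal a - ereal b"
    using A B by (rule ereal_minus_mono)
  then have "(enn2ereal A - enn2ereal B) / ereal (2 * pi) \<le> ereal (2 * pi * m) / ereal (2 * pi)"
    using ab(3) by (intro ereal_divide_right_mono) auto
  then show ?thesis
    by (simp add: circle_mean_def A_def B_def)
qed

lemma circle_mean_ge:
  assumes q: "continuous_on {0..2*pi} q" "(q has_integral 2 * pi * m) {0..2*pi}"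
    and le: "\<And>t. t \<in> {0..2*pi} \<Longrightarrow> ereal (q t) \<le> f (z + of_real r * cis t)"
  shows "ereal m \<le> circle_mean f z r"
proof -
  obtain a b where ab: "a \<ge> 0" "b \<ge> 0" "a - b = 2 * pi * m"
    "(\<integral>\<^sup>+t\<in>{0..2*pi}. ennreal (q t) \<partial>lborel) = ennreal a"
    "(\<integral>\<^sup>+t\<in>{0..2*pi}. ennreal (- q t) \<partial>lborel) = ennreal b"
    using circle_parts[OF q] .
  define A where "A = (\<integral>\<^sup>+t\<in>{0..2*pi}. e2ennreal (f (z + of_real r * cis t)) \<partial>lborel)"
  define B where "B = (\<integral>\<^sup>+t\<in>{0..2*pi}. e2ennreal (- f (z + of_real r * cis t)) \<partial>lborel)"
  have "ennreal a \<le> A"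
    unfolding A_def ab(4)[symmetric]
    using e2ennreal_mono[OF le] by (intro nn_integral_mono) (auto split: split_indicator)
  then have A: "ereal a \<le> enn2ereal A"
    using ab(1) by (metis enn2ereal_ennreal less_eq_ennreal.rep_eq)
  have "e2ennreal (- f (z + of_real r * cis t)) \<le> e2ennreal (ereal (- q t))" if "t \<in> {0..2*pi}" for t
    using le[OF that] by (intro e2ennreal_mono) (simp add: ereal_uminus_le_reorder)
  then have "B \<le> ennreal b"
    unfolding B_def ab(5)[symmetric]
    by (intro nn_integral_mono) (auto split: split_indicator)
  then have B: "enn2ereal B \<le> ereal b"
    using ab(2) by (metis enn2ereal_ennreal less_eq_ennreal.rep_eq)
  have "ereal a - ereal b \<le> enn2ereal A - enn2ereal B"
    using A B by (rule ereal_minus_mono)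
  then have "ereal (2 * pi * m) / ereal (2 * pi) \<le> (enn2ereal A - enn2ereal B) / ereal (2 * pi)"
    using ab(3) by (intro ereal_divide_right_mono) auto
  then show ?thesis
    by (simp add: circle_mean_def A_def B_def)
qed

text \<open>The numbers \<open>- ln (u + 1 / Suc n)\<close> increase to \<open>- ln u\<close>, also
  for \<open>u = 0\<close>, where the limit is infinite. This prepares monotone convergence for the
  negative part of the mean of \<open>ext_ln u\<close>.\<close>

lemma e2ennreal_uminus_ext_ln_le:
  assumes "u \<ge> 0"
  shows "e2ennreal (- ext_ln u) \<le> (SUP n. ennreal (- ln (u + 1 / Suc n)))"
proof (cases "u = 0")
  case True
  have "(SUP n. ennreal (- ln (u + 1 / Suc n))) = top"
  proof (rule ccontr)
    assume "(SUP n. ennreal (- ln (u + 1 / Suc n))) \<noteq> top"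
    then obtain M where M: "M \<ge> 0" "(SUP n. ennreal (- ln (u + 1 / Suc n))) = ennreal M"
      by (cases "SUP n. ennreal (- ln (u + 1 / Suc n))") auto
    obtain n where n: "exp M < real n"
      using reals_Archimedean2 by blast
    have "ennreal (- ln (u + 1 / Suc n)) \<le> ennreal M"
      unfolding M(2)[symmetric] by (rule SUP_upper) simp
    then have "ln (real (Suc n)) \<le> M"
      using True M(1) by (simp add: ln_div)
    then have "real (Suc n) \<le> exp M"
      using ln_ge_iff[of "real (Suc n)"] by (metis exp_le_cancel_iff exp_ln of_nat_0_less_iff zero_less_Suc)
    then show False
      using n by simp
  qed
  then show ?thesis
    by (metis top_greatest)
next
  case False
  then have u: "u > 0"
    using assms by simp
  have "(\<lambda>n. - ln (u + 1 / Suc n)) \<longlonglongrightarrow> - ln (u + 0)"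
    using u by (intro tendsto_intros LIMSEQ_inverse_real_of_nat[unfolded inverse_eq_divide]) auto
  then have "(\<lambda>n. ennreal (- ln (u + 1 / Suc n))) \<longlonglongrightarrow> ennreal (- ln u)"
    by (intro tendsto_ennrealI) simp
  then have "ennreal (- ln u) \<le> (SUP n. ennreal (- ln (u + 1 / Suc n)))"
    by (rule LIMSEQ_le_const2) (intro exI[of _ 0] allI impI SUP_upper, auto)
  then show ?thesis
    using u by (simp add: ext_ln_def)
qed

lemma e2ennreal_ext_ln: "u \<ge> 0 \<Longrightarrow> e2ennreal (ext_ln u) = ennreal (ln (max 1 u))"
  by (auto simp: ext_ln_def max_def e2ennreal_neg ennreal_neg ln_le_zero_iff)

text \<open>On the circle, \<open>ln (u + e)\<close> is approximated from above by the real part of a polynomial,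
  whose value at the centre is its mean.\<close>

lemma submean_of_holomorphic_majorants:
  fixes u :: "complex \<Rightarrow> real"
  assumes "r > 0" and cont: "continuous_on (sphere z r) u"
    and nonneg: "\<And>w. w \<in> insert z (sphere z r) \<Longrightarrow> 0 \<le> u w"
    and major: "\<And>h. h holomorphic_on UNIV \<Longrightarrow>
        (\<And>w. w \<in> sphere z r \<Longrightarrow> u w \<le> exp (Re (h w))) \<Longrightarrow> u z \<le> exp (Re (h z))"
  shows "ereal (u z) \<le> circle_mean (\<lambda>w. ereal (u w)) z r"
    and "ext_ln (u z) \<le> circle_mean (\<lambda>w. ext_ln (u w)) z r"
proof -
  define v where "v t = u (z + of_real r * cis t)" for t
  let ?I = "{0..2*pi::real}"
  have on_sphere: "z + of_real r * cis t \<in> sphere z r" for t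
    using \<open>r > 0\<close> by (simp add: dist_norm norm_mult)
  have v0: "0 \<le> v t" for t
    using nonneg on_sphere by (simp add: v_def)
  have contv: "continuous_on ?I v"
    unfolding v_def
    by (rule continuous_on_compose2[OF cont]) (use on_sphere in \<open>auto intro!: continuous_intros\<close>)
  define m where "m e = integral ?I (\<lambda>t. ln (v t + e)) / (2 * pi)" for e
  have contln: "continuous_on ?I (\<lambda>t. ln (v t + e))" if "e > 0" for e
    using that v0 by (intro continuous_intros contv) (auto simp: add_nonneg_eq_0_iff)
  have intln: "((\<lambda>t. ln (v t + e)) has_integral 2 * pi * m e) ?I" if "e > 0" for e
    using integrable_integral[OF integrable_continuous_interval[OF contln[OF that]]]
    by (simp add: m_def)
  \<comment> \<open>Logarithmic sub-mean inequality, with \<open>u + e\<close> in place of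
    \<open>u\<close> so that the logarithm is continuous on the circle; \<open>k\<close> is the
    error of the harmonic majorant and tends to 0.\<close>
  have *: "u z \<le> exp (m e)" if e: "e > 0" for e
  proof -
    have "u z \<le> exp (m e + k)" if k: "k > 0" for k
    proof -
      have "continuous_on (sphere z r) (\<lambda>w. ln (u w + e))"
        using e nonneg by (intro continuous_intros cont) (force simp: add_nonneg_eq_0_iff)
      then obtain h where h: "h holomorphic_on UNIV"
        "\<And>w. w \<in> sphere z r \<Longrightarrow> ln (u w + e) \<le> Re (h w)"
        "\<And>w. w \<in> sphere z r \<Longrightarrow> Re (h w) \<le> ln (u w + e) + k"
        by (rule continuous_on_circle_approx[OF \<open>r > 0\<close> _ k]) blast
      have "u z \<le> exp (Re (h z))"
      proof (rule major[OF h(1)])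
        fix w assume w: "w \<in> sphere z r"
        have "0 \<le> u w"
          using nonneg w by simp
        then have "u w \<le> exp (ln (u w + e))"
          using e by simp
        also have "\<dots> \<le> exp (Re (h w))"
          using h(2)[OF w] by simp
        finally show "u w \<le> exp (Re (h w))" .
      qed
      also have "2 * pi * Re (h z) \<le> 2 * pi * m e + 2 * pi * k"
      proof (rule has_integral_le)
        show "((\<lambda>t. Re (h (z + of_real r * cis t))) has_integral (2 * pi * Re (h z))) ?I"
          using h(1) \<open>r > 0\<close> by (intro Re_holomorphic_mean_value[where S = UNIV]) auto
        show "((\<lambda>t. ln (v t + e) + k) has_integral (2 * pi * m e + 2 * pi * k)) ?I"
          using has_integral_add[OF intln[OF e] has_integral_const_real[of k 0 "2*pi"]]
          by (simp add: mult.commute)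
      qed (use h(3) on_sphere in \<open>simp add: v_def\<close>)
      then have "Re (h z) \<le> m e + k"
        by (simp add: distrib_left[symmetric])
      then have "exp (Re (h z)) \<le> exp (m e + k)"
        by simp
      finally show ?thesis .
    qed
    then have "u z \<le> exp (m e) * exp k" if "k > 0" for k
      using that by (simp add: exp_add)
    then have "\<forall>\<^sub>F k in at_right 0. u z \<le> exp (m e) * exp k"
      by (auto simp: eventually_at_filter)
    moreover have "((\<lambda>k. exp (m e) * exp k) \<longlongrightarrow> exp (m e) * exp 0) (at_right 0)"
      by (intro tendsto_intros)
    ultimately show ?thesis
      using tendsto_lowerbound[of "\<lambda>k. exp (m e) * exp k" "exp (m e)" "at_right (0::real)" "u z"] by simp
  qed
  show "ereal (u z) \<le> circle_mean (\<lambda>w. ereal (u w)) z r"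
  proof (rule circle_mean_ge[OF contv, where m = "u z + (integral ?I v / (2 * pi) - u z)", THEN order_trans[rotated]])
    let ?M = "integral ?I v / (2 * pi)"
    have M: "(v has_integral 2 * pi * ?M) ?I"
      using integrable_integral[OF integrable_continuous_interval[OF contv]] by simp
    then show "(v has_integral 2 * pi * (u z + (?M - u z))) ?I"
      by simp
    have M0: "?M \<ge> 0"
      by (intro divide_nonneg_pos integral_nonneg integrable_continuous_interval contv v0) auto
    have "u z \<le> ?M + e" if e: "e > 0" for e
    proof -
      have gen: "(x + e) / (M + e) - 1 = (1 / (M + e)) * (x - M)" if "M \<ge> 0" for x M :: real
        using that e by (simp add: divide_simps)
      \<comment> \<open>Jensen's inequality: \<open>ln\<close> lies below its tangent at
        \<open>?M + e\<close>, and the linear term of the tangent has mean 0.\<close>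
      have "2 * pi * m e \<le> 2 * pi * ln (?M + e)"
      proof (rule has_integral_le[OF intln[OF e]])
        have "((\<lambda>t. ln (?M + e) + (1 / (?M + e)) * (v t - ?M)) has_integral
            (2 * pi * ln (?M + e) + (1 / (?M + e)) * (2 * pi * ?M - 2 * pi * ?M))) ?I"
          using has_integral_const_real[of "ln (?M + e)" 0 "2*pi"] has_integral_const_real[of ?M 0 "2*pi"]
          by (intro has_integral_add has_integral_mult_right has_integral_diff M) simp_all
        then show "((\<lambda>t. ln (?M + e) + (1 / (?M + e)) * (v t - ?M)) has_integral 2 * pi * ln (?M + e)) ?I"
          by simp
        fix t
        have "ln ((v t + e) / (?M + e)) \<le> (v t + e) / (?M + e) - 1"
          using v0[of t] M0 e by (intro ln_le_minus_one divide_pos_pos) auto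
        also have "ln ((v t + e) / (?M + e)) = ln (v t + e) - ln (?M + e)"
          using v0[of t] M0 e by (simp add: ln_div add_nonneg_pos)
        also have "(v t + e) / (?M + e) - 1 = (1 / (?M + e)) * (v t - ?M)"
          by (rule gen[OF M0])
        finally show "ln (v t + e) \<le> ln (?M + e) + (1 / (?M + e)) * (v t - ?M)"
          by simp
      qed
      then have "m e \<le> ln (?M + e)"
        by simp
      then have "exp (m e) \<le> ?M + e"
        using M0 e by (metis add_nonneg_pos exp_le_cancel_iff exp_ln)
      then show ?thesis
        using *[OF e] by linarith
    qed
    then have "u z \<le> ?M"
      by (rule field_le_epsilon)
    then show "ereal (u z) \<le> ereal (u z + (?M - u z))"
      by simp
  qed (simp add: v_def)
  show "ext_ln (u z) \<le> circle_mean (\<lambda>w. ext_ln (u w)) z r"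
  proof (cases "u z = 0")
    case True
    then show ?thesis by (simp add: ext_ln_def)
  next
    case False
    then have uz: "u z > 0"
      using nonneg[of z] by simp
    define x where "x = ln (u z)"
    have xm: "x \<le> m e" if "e > 0" for e
      using *[OF that] uz unfolding x_def by (metis ln_exp ln_le_cancel_iff exp_gt_zero)
    define e where "e n = 1 / real (Suc n)" for n
    have e: "e n > 0" for n
      by (simp add: e_def)
    have conta: "continuous_on ?I (\<lambda>t. ln (max 1 (v t)))"
      by (intro continuous_intros contv) auto
    define a where "a = integral ?I (\<lambda>t. ln (max 1 (v t)))"
    have a: "((\<lambda>t. ln (max 1 (v t))) has_integral a) ?I"
      unfolding a_def by (rule integrable_integral[OF integrable_continuous_interval[OF conta]])
    have a0: "a \<ge> 0"
      by (rule has_integral_nonneg[OF a]) simp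
    define A where "A = (\<integral>\<^sup>+t\<in>?I. e2ennreal (ext_ln (v t)) \<partial>lborel)"
    define B where "B = (\<integral>\<^sup>+t\<in>?I. e2ennreal (- ext_ln (v t)) \<partial>lborel)"
    have A: "A = ennreal a"
      unfolding A_def a_def e2ennreal_ext_ln[OF v0]
      by (rule nn_integral_Icc_continuous[OF conta]) simp
    have ln_le: "ln (v t + e n) \<le> ln (max 1 (v t)) + e n" for t n
    proof -
      have "ln (v t + e n) \<le> ln (max 1 (v t) * (1 + e n))"
        using v0[of t] e[of n] by (intro ln_mono) (auto simp: max_def algebra_simps intro: add_nonneg_pos)
      also have "\<dots> = ln (max 1 (v t)) + ln (1 + e n)"
        using e[of n] by (intro ln_mult_pos) auto
      also have "ln (1 + e n) \<le> e n"
        using e[of n] by (intro ln_add_one_self_le_self) auto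
      finally show ?thesis
        by simp
    qed
    have int_ln_e: "((\<lambda>t. ln (max 1 (v t)) + e n) has_integral (a + 2 * pi * e n)) ?I" for n
      using has_integral_add[OF a has_integral_const_real[of "e n" 0 "2*pi"]] by (simp add: mult.commute)
    \<comment> \<open>The negative part is the positive part minus the mean: the positive part has
      integral at most \<open>a + 2 * pi * e n\<close>, and the mean of
      \<open>ln (v t + e n)\<close> is at least \<open>x\<close>.\<close>
    have b_le: "(\<integral>\<^sup>+t\<in>?I. ennreal (- ln (v t + e n)) \<partial>lborel) \<le> ennreal (a - 2 * pi * x + 2 * pi * e n)" for n
    proof -
      obtain an bn where ab: "an \<ge> 0" "bn \<ge> 0" "an - bn = 2 * pi * m (e n)"
        "(\<integral>\<^sup>+t\<in>?I. ennreal (ln (v t + e n)) \<partial>lborel) = ennreal an"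
        "(\<integral>\<^sup>+t\<in>?I. ennreal (- ln (v t + e n)) \<partial>lborel) = ennreal bn"
        using circle_parts[OF contln[OF e] intln[OF e]] .
      have "ennreal an \<le> (\<integral>\<^sup>+t\<in>?I. ennreal (ln (max 1 (v t)) + e n) \<partial>lborel)"
        unfolding ab(4)[symmetric]
        by (intro nn_integral_mono mult_right_mono ennreal_leI ln_le) simp
      also have "\<dots> = ennreal (integral ?I (\<lambda>t. ln (max 1 (v t)) + e n))"
        using e[of n] by (intro nn_integral_Icc_continuous continuous_intros conta) auto
      also have "integral ?I (\<lambda>t. ln (max 1 (v t)) + e n) = a + 2 * pi * e n"
        by (rule integral_unique[OF int_ln_e])
      finally have "an \<le> a + 2 * pi * e n"
        using a0 e[of n] by (subst (asm) ennreal_le_iff) auto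
      moreover have "2 * pi * x \<le> an - bn"
        using ab(3) xm[OF e[of n]] by simp
      ultimately show ?thesis
        unfolding ab(5) by (intro ennreal_leI) linarith
    qed
    let ?f = "\<lambda>n t. ennreal (- ln (v t + e n)) * indicator ?I t"
    have e_mono: "e k \<le> e n" if "n \<le> k" for n k
      using that by (simp add: e_def frac_le)
    have inc: "incseq ?f"
    proof (intro incseq_SucI le_funI mult_right_mono ennreal_leI)
      fix n t
      show "- ln (v t + e n) \<le> - ln (v t + e (Suc n))"
        using v0[of t] e[of n] e[of "Suc n"] e_mono[of n "Suc n"] by (simp add: add_nonneg_pos)
    qed simp
    have meas: "?f n \<in> borel_measurable lborel" for n
    proof -
      have "(\<lambda>t. ennreal (indicator ?I t *\<^sub>R (- ln (v t + e n)))) \<in> borel_measurable borel"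
        by (intro measurable_compose[OF _ measurable_ennreal] borel_measurable_continuous_on_indicator
              continuous_intros contln e) auto
      also have "(\<lambda>t. ennreal (indicator ?I t *\<^sub>R (- ln (v t + e n)))) = ?f n"
        by (auto simp: fun_eq_iff split: split_indicator)
      finally show ?thesis by simp
    qed
    have "B \<le> (\<integral>\<^sup>+t. (SUP n. ?f n t) \<partial>lborel)"
      unfolding B_def
      using e2ennreal_uminus_ext_ln_le[OF v0]
      by (intro nn_integral_mono) (auto simp: e_def split: split_indicator)
    also have "\<dots> = (SUP n. integral\<^sup>N lborel (?f n))"
      by (rule nn_integral_monotone_convergence_SUP[OF inc meas])
    also have "\<dots> \<le> ennreal (a - 2 * pi * x)"
    proof (rule SUP_least)
      fix n
      have "integral\<^sup>N lborel (?f n) \<le> ennreal (a - 2 * pi * x + 2 * pi * e k)" if "n \<le> k" for k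
      proof -
        have "integral\<^sup>N lborel (?f n) \<le> integral\<^sup>N lborel (?f k)"
          using incseqD[OF inc that] by (intro nn_integral_mono) (rule le_funD)
        then show ?thesis
          using b_le[of k] by (rule order_trans)
      qed
      moreover have "(\<lambda>k. ennreal (a - 2 * pi * x + 2 * pi * e k)) \<longlonglongrightarrow> ennreal (a - 2 * pi * x + 2 * pi * 0)"
        unfolding e_def
        by (intro tendsto_ennrealI tendsto_intros LIMSEQ_inverse_real_of_nat[unfolded inverse_eq_divide])
      ultimately show "integral\<^sup>N lborel (?f n) \<le> ennreal (a - 2 * pi * x)"
        by (intro LIMSEQ_le_const[of _ "ennreal (a - 2 * pi * x)"]) auto
    qed
    finally have B: "B \<le> ennreal (a - 2 * pi * x)" .
    \<comment> \<open>This sign is needed because \<open>ennreal (a - 2 * pi * x)\<close> would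
      otherwise be truncated to 0 and the bound on \<open>B\<close> could not be read as a bound by
      the real number.\<close>
    have "2 * pi * x \<le> a"
    proof -
      have "2 * pi * x \<le> a + 2 * pi * e n" for n
      proof -
        have "2 * pi * m (e n) \<le> a + 2 * pi * e n"
          using has_integral_le[OF intln[OF e] int_ln_e ln_le] .
        then show ?thesis
          using mult_left_mono[OF xm[OF e[of n]], of "2 * pi"] pi_ge_zero by linarith
      qed
      moreover have "(\<lambda>k. a + 2 * pi * e k) \<longlonglongrightarrow> a + 2 * pi * 0"
        unfolding e_def by (intro tendsto_intros LIMSEQ_inverse_real_of_nat[unfolded inverse_eq_divide])
      ultimately show ?thesis
        by (intro LIMSEQ_le_const[of _ a]) auto
    qed
    then have "enn2ereal B \<le> ereal (a - 2 * pi * x)"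
      using B by (metis diff_ge_0_iff_ge enn2ereal_ennreal less_eq_ennreal.rep_eq)
    moreover have "enn2ereal A = ereal a"
      using A a0 by simp
    ultimately have "ereal a - ereal (a - 2 * pi * x) \<le> enn2ereal A - enn2ereal B"
      by (intro ereal_minus_mono) auto
    then have "ereal (2 * pi * x) / ereal (2 * pi) \<le> (enn2ereal A - enn2ereal B) / ereal (2 * pi)"
      by (intro ereal_divide_right_mono) auto
    then show ?thesis
      using uz by (simp add: circle_mean_def A_def B_def v_def x_def ext_ln_def)
  qed
qed

section \<open>Plurisubharmonicity from holomorphic majorants\<close>

lemma usc_on_ereal:
  assumes "continuous_on S u"
  shows "usc_on S (\<lambda>z. ereal (u z))"
  unfolding usc_on_def
proof (intro ballI allI impI)
  fix z c assume z: "z \<in> S" and c: "ereal (u z) < c"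
  have "((\<lambda>z. ereal (u z)) \<longlongrightarrow> ereal (u z)) (at z within S)"
    using assms z by (intro tendsto_intros) (auto simp: continuous_on_def)
  then show "\<forall>\<^sub>F w in at z within S. ereal (u w) < c"
    using c by (rule order_tendstoD)
qed

lemma usc_on_ext_ln:
  assumes "continuous_on S u" "\<And>z. z \<in> S \<Longrightarrow> 0 \<le> u z"
  shows "usc_on S (\<lambda>z. ext_ln (u z))"
  unfolding usc_on_def
proof (intro ballI allI impI)
  fix z c assume z: "z \<in> S" and c: "ext_ln (u z) < c"
  obtain m where m: "ext_ln (u z) < ereal m" "ereal m < c"
    using ereal_dense2[OF c] by blast
  have less: "ext_ln x < ereal m \<longleftrightarrow> x < exp m" if "x \<ge> 0" for x
    using that ln_less_cancel_iff[of x "exp m"] by (auto simp: ext_ln_def)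
  have "(u \<longlongrightarrow> u z) (at z within S)"
    using assms(1) z by (auto simp: continuous_on_def)
  then have "\<forall>\<^sub>F w in at z within S. u w < exp m"
    using m(1) less[OF assms(2)[OF z]] by (intro order_tendstoD) auto
  moreover have "\<forall>\<^sub>F w in at z within S. w \<in> S"
    by (simp add: eventually_at_filter)
  ultimately show "\<forall>\<^sub>F w in at z within S. ext_ln (u w) < c"
  proof eventually_elim
    case (elim w)
    then have "ext_ln (u w) < ereal m"
      using less assms(2) by blast
    then show ?case
      using m(2) by (rule less_trans)
  qed
qed

lemma ext_ln_neq_infty [simp]: "ext_ln x \<noteq> \<infinity>"
  by (simp add: ext_ln_def)

text \<open>Since \<open>exp (Re h)\<close> is \<open>|exp h|\<close>, the hypothesis
  \<open>major\<close> is a maximum principle for \<open>u / |exp h|\<close>. It expresses that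
  \<open>log u\<close> is subharmonic on complex lines, and it yields both plurisubharmonicity
  conditions of \<open>sibony_class\<close> at once.\<close>

lemma plurisubharmonic_of_holomorphic_majorants:
  fixes u :: "complex ^ 'n::finite \<Rightarrow> real"
  assumes cont: "continuous_on \<Omega> u" and nonneg: "\<And>z. z \<in> \<Omega> \<Longrightarrow> 0 \<le> u z"
    and major: "\<And>a b z r h. r > 0 \<Longrightarrow> (\<And>w. w \<in> cball z r \<Longrightarrow> a + w *s b \<in> \<Omega>) \<Longrightarrow>
        h holomorphic_on UNIV \<Longrightarrow> (\<And>w. w \<in> sphere z r \<Longrightarrow> u (a + w *s b) \<le> exp (Re (h w))) \<Longrightarrow>
        u (a + z *s b) \<le> exp (Re (h z))"
  shows "plurisubharmonic_on \<Omega> (\<lambda>z. ereal (u z))"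
    and "plurisubharmonic_on \<Omega> (\<lambda>z. ext_ln (u z))"
proof -
  let ?S = "\<lambda>a b. {\<zeta>. a + \<zeta> *s b \<in> \<Omega>}"
  have contl: "continuous_on (?S a b) (\<lambda>\<zeta>. u (a + \<zeta> *s b))" for a b
    by (rule continuous_on_compose2[OF cont]) (auto intro!: continuous_intros)
  have sub: "ereal (u (a + z *s b)) \<le> circle_mean (\<lambda>\<zeta>. ereal (u (a + \<zeta> *s b))) z r \<and>
      ext_ln (u (a + z *s b)) \<le> circle_mean (\<lambda>\<zeta>. ext_ln (u (a + \<zeta> *s b))) z r"
    if r: "r > 0" and sub: "cball z r \<subseteq> ?S a b" for a b z r
  proof -
    have c: "continuous_on (sphere z r) (\<lambda>\<zeta>. u (a + \<zeta> *s b))"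
      by (rule continuous_on_subset[OF contl]) (use sub sphere_cball in blast)
    have n: "0 \<le> u (a + w *s b)" if "w \<in> insert z (sphere z r)" for w
      using that sub r by (intro nonneg) (auto simp: subset_eq)
    have m: "u (a + z *s b) \<le> exp (Re (h z))"
      if "h holomorphic_on UNIV" "\<And>w. w \<in> sphere z r \<Longrightarrow> u (a + w *s b) \<le> exp (Re (h w))" for h
      by (rule major[OF r _ that]) (use sub in blast)
    show ?thesis
      using submean_of_holomorphic_majorants[where u = "\<lambda>\<zeta>. u (a + \<zeta> *s b)" and r = r and z = z] r c n m
      by auto
  qed
  show "plurisubharmonic_on \<Omega> (\<lambda>z. ereal (u z))"
    unfolding plurisubharmonic_on_def subharmonic_on_def
    using usc_on_ereal[OF cont] usc_on_ereal[OF contl] sub by auto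
  show "plurisubharmonic_on \<Omega> (\<lambda>z. ext_ln (u z))"
    unfolding plurisubharmonic_on_def subharmonic_on_def
    using usc_on_ext_ln[OF cont nonneg] usc_on_ext_ln[OF contl] nonneg sub
    by auto
qed

section \<open>Maximum principles and gluing\<close>

lemma holomorphic_fun_on_compose:
  fixes \<phi> :: "complex \<Rightarrow> complex ^ 'n::finite"
  assumes f: "holomorphic_fun_on f S" and "open T"
    and \<phi>: "\<And>w. w \<in> T \<Longrightarrow> (\<phi> has_derivative (\<lambda>h. h *s \<phi>' w)) (at w)" "\<And>w. w \<in> T \<Longrightarrow> \<phi> w \<in> S"
  shows "(\<lambda>w. f (\<phi> w)) holomorphic_on T"
proof (rule holomorphic_onI)
  fix w assume w: "w \<in> T"
  obtain D where D: "(f has_derivative D) (at (\<phi> w))" "\<And>c v. D (c *s v) = c * D v"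
    using f \<phi>(2)[OF w] unfolding holomorphic_fun_on_def by blast
  have "((\<lambda>w. f (\<phi> w)) has_derivative (\<lambda>h. D (h *s \<phi>' w))) (at w)"
    by (rule has_derivative_compose[OF \<phi>(1)[OF w] D(1)])
  then have "((\<lambda>w. f (\<phi> w)) has_field_derivative D (\<phi>' w)) (at w)"
    by (simp add: has_field_derivative_def D(2) mult.commute[of _ "D _"] mult_commute_abs)
  then show "(\<lambda>w. f (\<phi> w)) field_differentiable at w within T"
    using field_differentiable_at_within field_differentiable_def by blast
qed

lemma holomorphic_fun_on_imp_continuous_on:
  "holomorphic_fun_on f S \<Longrightarrow> continuous_on S f"
  by (meson continuous_at_imp_continuous_on has_derivative_continuous holomorphic_fun_on_def)

text \<open>Pairing the vector \<open>(G w, L w)\<close> with its value at the fixed point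
  \<open>z\<close> gives a scalar holomorphic function \<open>k\<close> with
  \<open>k z = U z\<close>, and by Cauchy-Schwarz \<open>|k w|\<close> is at most
  \<open>sqrt (U z) * sqrt (U w)\<close>. The scalar maximum modulus principle for
  \<open>k * exp (- h / 2)\<close> then bounds the sum of squares.\<close>

lemma vector_maximum_modulus:
  fixes a b p :: "complex ^ 'n::finite"
  assumes G: "G holomorphic_on interior S" "continuous_on (closure S) G" and S: "bounded S" "z \<in> S"
    and h: "h holomorphic_on UNIV"
    and le: "\<And>w. w \<in> frontier S \<Longrightarrow> (cmod (G w))\<^sup>2 + (norm (a + w *s b - p))\<^sup>2 \<le> exp (Re (h w))"
  shows "(cmod (G z))\<^sup>2 + (norm (a + z *s b - p))\<^sup>2 \<le> exp (Re (h z))"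
proof -
  define L where "L w = a + w *s b - p" for w
  define U where "U w = (cmod (G w))\<^sup>2 + (norm (L w))\<^sup>2" for w
  define k where "k w = cnj (G z) * G w + herm_inner (L w) (L z)" for w
  define f where "f w = k w * exp (- h w / 2)" for w
  have "k w = cnj (G z) * G w + (herm_inner (a - p) (L z) + w * herm_inner b (L z))" for w
    by (simp add: k_def L_def herm_inner_add_left herm_inner_diff_left herm_inner_scale_left)
  then have f_eq: "f = (\<lambda>w. (cnj (G z) * G w + (herm_inner (a - p) (L z) + w * herm_inner b (L z))) * exp (- h w / 2))"
    by (auto simp: f_def)
  have U0: "U w \<ge> 0" for w
    by (simp add: U_def)
  have k_le: "cmod (k w) \<le> sqrt (U z) * sqrt (U w)" for w
  proof -
    have "cmod (k w) \<le> cmod (G z) * cmod (G w) + norm (L z) * norm (L w)"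
      unfolding k_def using norm_herm_inner_le[of "L w" "L z"]
      by (intro order_trans[OF norm_triangle_ineq]) (simp add: norm_mult mult.commute)
    also have "\<dots> = (cmod (G z), norm (L z)) \<bullet> (cmod (G w), norm (L w))"
      by simp
    also have "\<dots> \<le> norm (cmod (G z), norm (L z)) * norm (cmod (G w), norm (L w))"
      by (rule norm_cauchy_schwarz)
    finally show ?thesis
      by (simp add: U_def norm_Pair)
  qed
  have "cmod (f z) \<le> sqrt (U z)"
  proof (rule maximum_modulus_frontier[OF _ _ S(1) _ S(2)])
    show "f holomorphic_on interior S"
      unfolding f_eq by (intro holomorphic_intros G holomorphic_on_subset[OF h]) auto
    show "continuous_on (closure S) f"
      unfolding f_eq
      by (intro continuous_intros G continuous_on_subset[OF holomorphic_on_imp_continuous_on[OF h]]) auto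
    fix w assume "w \<in> frontier S"
    then have "U w \<le> exp (Re (h w))"
      using le by (simp add: U_def L_def)
    then have "sqrt (U w) \<le> sqrt (exp (Re (h w)))"
      by simp
    also have "sqrt (exp (Re (h w))) = exp (Re (h w) / 2)"
      by (rule real_sqrt_unique) (simp_all add: exp_double[symmetric])
    finally have "sqrt (U w) * exp (- Re (h w) / 2) \<le> exp (Re (h w) / 2) * exp (- Re (h w) / 2)"
      by (rule mult_right_mono) simp
    then have *: "sqrt (U w) * exp (- Re (h w) / 2) \<le> 1"
      by (simp add: exp_add[symmetric])
    have "cmod (f w) \<le> sqrt (U z) * sqrt (U w) * exp (- Re (h w) / 2)"
      unfolding f_def norm_mult using k_le[of w] by (intro mult_mono) (auto simp: U0)
    also have "\<dots> \<le> sqrt (U z)"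
      using mult_left_mono[OF *, of "sqrt (U z)"] U0[of z] by (simp add: mult.assoc)
    finally show "cmod (f w) \<le> sqrt (U z)" .
  qed
  moreover have "k z = of_real (U z)"
    by (simp add: k_def U_def herm_inner_self complex_norm_square[symmetric] mult.commute)
  ultimately have *: "U z * exp (- Re (h z) / 2) \<le> sqrt (U z)"
    by (simp add: f_def norm_mult U0)
  have "U z \<le> exp (Re (h z))"
  proof (cases "U z = 0")
    case False
    then have Uz: "sqrt (U z) > 0"
      using U0[of z] by simp
    have "sqrt (U z) * (sqrt (U z) * exp (- Re (h z) / 2)) \<le> sqrt (U z) * 1"
      using * U0[of z] by (simp add: mult.assoc[symmetric])
    then have "sqrt (U z) * exp (- Re (h z) / 2) \<le> 1"
      using Uz by (simp only: mult_le_cancel_left_pos)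
    then have "sqrt (U z) * exp (- Re (h z) / 2) * exp (Re (h z) / 2) \<le> 1 * exp (Re (h z) / 2)"
      by (rule mult_right_mono) simp
    then have "sqrt (U z) \<le> exp (Re (h z) / 2)"
      by (simp add: mult.assoc exp_add[symmetric])
    then have "(sqrt (U z))\<^sup>2 \<le> (exp (Re (h z) / 2))\<^sup>2"
      using Uz by (intro power_mono) auto
    then show ?thesis
      using U0[of z] by (simp add: exp_double[symmetric])
  qed simp
  then show ?thesis
    by (simp add: U_def L_def)
qed

text \<open>Taking the power \<open>2 / s\<close> turns the inequality into one for the squared
  norm, with majorant \<open>(h - ln A) * (2 / s)\<close>; this is the vector maximum principle with
  \<open>G = 0\<close>.\<close>

lemma norm_powr_majorant:
  fixes a b p :: "complex ^ 'n::finite"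
  assumes "A > 0" "s > 0" "r > 0" and h: "h holomorphic_on UNIV"
    and le: "\<And>w. w \<in> sphere z r \<Longrightarrow> A * norm (a + w *s b - p) powr s \<le> exp (Re (h w))"
    and z: "\<zeta> \<in> cball z r"
  shows "A * norm (a + \<zeta> *s b - p) powr s \<le> exp (Re (h \<zeta>))"
proof -
  have iff: "A * x powr s \<le> exp y \<longleftrightarrow> x\<^sup>2 \<le> exp ((y - ln A) * (2 / s))" if "x \<ge> 0" for x y
  proof (cases "x = 0")
    case False
    then have x: "x > 0" using that by simp
    have "A * x powr s = exp (ln A + s * ln x)"
      using x \<open>A > 0\<close> by (simp add: exp_add powr_def)
    moreover have "x\<^sup>2 = exp (2 * ln x)"
      using x by (simp add: exp_double)
    ultimately show ?thesis
      using \<open>s > 0\<close> by (auto simp: field_simps)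
  qed simp
  define h' where "h' w = (h w - of_real (ln A)) * of_real (2 / s)" for w
  have Re_h': "Re (h' w) = (Re (h w) - ln A) * (2 / s)" for w
    unfolding h'_def Re_complex_of_real[symmetric] by (simp only: times_complex.sel Im_complex_of_real minus_complex.sel Re_complex_of_real mult_zero_right diff_zero)
  have "(cmod 0)\<^sup>2 + (norm (a + \<zeta> *s b - p))\<^sup>2 \<le> exp (Re (h' \<zeta>))"
  proof (rule vector_maximum_modulus[where G = "\<lambda>_. 0" and S = "cball z r"])
    show "h' holomorphic_on UNIV"
      unfolding h'_def by (intro holomorphic_intros h)
    fix w assume "w \<in> frontier (cball z r)"
    then have "w \<in> sphere z r"
      using \<open>r > 0\<close> by simp
    then show "(cmod 0)\<^sup>2 + (norm (a + w *s b - p))\<^sup>2 \<le> exp (Re (h' w))"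
      using le[of w] by (simp only: iff[OF norm_ge_zero] Re_h') simp
  qed (use z in auto)
  then show ?thesis
    by (simp only: iff[OF norm_ge_zero] Re_h') simp
qed

text \<open>The maximum modulus principle is applied on \<open>{u2 < u1}\<close>, whose closure cannot reach the
  frontier of \<open>G\<close>.\<close>

lemma plurisubharmonic_glued:
  fixes p :: "complex ^ 'n::finite" and g :: "complex ^ 'n \<Rightarrow> complex"
  assumes "open G" "open V" "closure G \<subseteq> V" and g: "holomorphic_fun_on g V" and "A > 0" "s > 0" "k > 0"
    and u1: "\<And>z. u1 z = (cmod (g z))\<^sup>2 + (norm (z - p))\<^sup>2"
    and u2: "\<And>z. u2 z = A * norm (z - p) powr s"
    and bd: "\<And>z. z \<in> \<Omega> \<inter> frontier G \<Longrightarrow> u1 z < u2 z"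
    and u: "\<And>z. u z = (if z \<in> G then max (u1 z) (u2 z) else u2 z)"
  shows "plurisubharmonic_on \<Omega> (\<lambda>z. ereal (k * u z))"
    and "plurisubharmonic_on \<Omega> (\<lambda>z. ext_ln (k * u z))"
proof -
  have cont1: "continuous_on V u1"
    unfolding u1 by (intro continuous_intros holomorphic_fun_on_imp_continuous_on g)
  have cont2: "continuous_on S u2" for S
    unfolding u2 using \<open>s > 0\<close> by (intro continuous_intros continuous_on_powr') auto
  have iso1: "isCont u1 z" if "z \<in> V" for z
    using cont1 \<open>open V\<close> that by (simp add: continuous_on_eq_continuous_at)
  have iso2: "isCont u2 z" for z
    using cont2[of UNIV] by (simp add: continuous_on_eq_continuous_at)
  have less_near: "\<forall>\<^sub>F w in nhds z. u1 w < u2 w" if "z \<in> V" "u1 z < u2 z" for z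
  proof -
    have "((\<lambda>w. u2 w - u1 w) \<longlongrightarrow> u2 z - u1 z) (nhds z)"
      using iso1[OF that(1)] iso2[of z] by (intro tendsto_diff) (simp_all only: tendsto_at_iff_tendsto_nhds isCont_def)
    then have "\<forall>\<^sub>F w in nhds z. 0 < u2 w - u1 w"
      using that(2) by (intro order_tendstoD) auto
    then show ?thesis
      by eventually_elim simp
  qed
  have "isCont u z" if z: "z \<in> \<Omega>" for z
  proof -
    consider "z \<in> G" | "z \<in> frontier G" | "z \<notin> closure G"
      using \<open>open G\<close> by (auto simp: frontier_def interior_open)
    then show ?thesis
    proof cases
      case 1
      have "\<forall>\<^sub>F w in nhds z. u w = max (u1 w) (u2 w)"
        using eventually_nhds_in_open[OF \<open>open G\<close> 1] by eventually_elim (simp add: u)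
      moreover have "isCont (\<lambda>w. max (u1 w) (u2 w)) z"
        using 1 \<open>closure G \<subseteq> V\<close> closure_subset by (intro continuous_max iso1 iso2) blast
      ultimately show ?thesis
        by (rule iffD2[OF isCont_cong])
    next
      case 2
      then have "z \<in> V"
        using \<open>closure G \<subseteq> V\<close> by (auto simp: frontier_def)
      then have "\<forall>\<^sub>F w in nhds z. u1 w < u2 w"
        using less_near bd 2 z by blast
      then have "\<forall>\<^sub>F w in nhds z. u w = u2 w"
        by eventually_elim (simp add: u)
      then show ?thesis
        by (rule iffD2[OF isCont_cong]) (rule iso2)
    next
      case 3
      have "\<forall>\<^sub>F w in nhds z. w \<in> - closure G"
        using 3 by (intro eventually_nhds_in_open) auto
      then have "\<forall>\<^sub>F w in nhds z. u w = u2 w"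
        by eventually_elim (use closure_subset in \<open>auto simp: u\<close>)
      then show ?thesis
        by (rule iffD2[OF isCont_cong]) (rule iso2)
    qed
  qed
  then have cont: "continuous_on \<Omega> u"
    by (intro continuous_at_imp_continuous_on) auto
  have nonneg: "0 \<le> u z" for z
    using \<open>A > 0\<close> by (simp add: u u2 le_max_iff_disj)
  have u2_le: "u2 z \<le> u z" for z
    by (simp add: u)
  have major: "u (a + z *s b) \<le> exp (Re (h z))"
    if r: "r > 0" and sub: "\<And>w. w \<in> cball z r \<Longrightarrow> a + w *s b \<in> \<Omega>" and h: "h holomorphic_on UNIV"
      and le: "\<And>w. w \<in> sphere z r \<Longrightarrow> u (a + w *s b) \<le> exp (Re (h w))" for a b z r h
  proof -
    define L where "L w = a + w *s b" for w
    have contL: "isCont L w" for w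
      unfolding L_def by (rule continuous_on_interior[of UNIV]) (auto intro!: continuous_intros)
    have limL: "filterlim L (nhds (L w)) (nhds w)" for w
      using contL unfolding isCont_def tendsto_at_iff_tendsto_nhds .
    \<comment> \<open>Because \<open>u2 \<le> u\<close>, the bound on the circle passes from
      \<open>u\<close> to \<open>u2\<close>; and \<open>u2\<close> obeys the maximum principle
      everywhere, so it is majorized on the whole disc.\<close>
    have u2_major: "u2 (L w) \<le> exp (Re (h w))" if "w \<in> cball z r" for w
      unfolding u2 L_def using \<open>A > 0\<close> \<open>s > 0\<close> r h
    proof (rule norm_powr_majorant[OF _ _ _ _ _ that])
      fix w assume "w \<in> sphere z r"
      then show "A * norm (a + w *s b - p) powr s \<le> exp (Re (h w))"
        using le[of w] u2_le[of "a + w *s b"] by (simp add: u2)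
    qed
    show ?thesis
    proof (cases "L z \<in> G \<and> u2 (L z) < u1 (L z)")
      case False
      then have "u (L z) = u2 (L z)"
        by (auto simp: u)
      then show ?thesis
        using u2_major[of z] r by (simp add: L_def)
    next
      case True
      define S where "S = {w \<in> cball z r. L w \<in> G \<and> u2 (L w) < u1 (L w)}"
      have clS: "w \<in> cball z r \<and> L w \<in> G" if w: "w \<in> closure S" for w
      proof -
        have wc: "w \<in> cball z r"
        proof -
          have "closure S \<subseteq> cball z r"
            by (rule closure_minimal) (auto simp: S_def)
          then show ?thesis
            using w by blast
        qed
        have "L ` closure S \<subseteq> closure (L ` S)"
          using contL by (intro image_closure_subset continuous_at_imp_continuous_on)
             (auto intro: closure_subset[THEN subsetD])
        also have "\<dots> \<subseteq> closure G"
          by (intro closure_mono) (auto simp: S_def)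
        finally have Lw: "L w \<in> closure G"
          using w by blast
        have "L w \<notin> frontier G"
        proof
          assume fr: "L w \<in> frontier G"
          have "u1 (L w) < u2 (L w)"
            using fr sub[OF wc] by (intro bd) (simp add: L_def)
          then have "\<forall>\<^sub>F y in nhds (L w). u1 y < u2 y"
            using Lw \<open>closure G \<subseteq> V\<close> by (intro less_near) auto
          then have "\<forall>\<^sub>F x in nhds w. u1 (L x) < u2 (L x)"
            by (rule eventually_compose_filterlim[OF _ limL])
          then obtain X where X: "open X" "w \<in> X" "\<And>x. x \<in> X \<Longrightarrow> u1 (L x) < u2 (L x)"
            unfolding eventually_nhds by blast
          then obtain x where "x \<in> X" "x \<in> S"
            using w open_Int_closure_eq_empty[OF X(1), of S] by blast
          then show False
            using X(3)[of x] by (simp add: S_def)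
        qed
        then show ?thesis
          using Lw wc \<open>open G\<close> by (auto simp: frontier_def interior_open)
      qed
      define W where "W = {w. L w \<in> V}"
      have "open W"
      proof -
        have "open (L -` V)"
          using contL \<open>open V\<close> by (intro continuous_open_vimage) (auto intro: continuous_at_imp_continuous_on)
        then show ?thesis
          by (simp add: W_def vimage_def)
      qed
      have gL: "(\<lambda>w. g (L w)) holomorphic_on W"
        by (rule holomorphic_fun_on_compose[OF g \<open>open W\<close>, of _ "\<lambda>_. b"])
           (auto simp: W_def L_def intro!: derivative_eq_intros)
      have SW: "closure S \<subseteq> W"
        using clS \<open>closure G \<subseteq> V\<close> closure_subset by (force simp: W_def)
      have "(cmod (g (L z)))\<^sup>2 + (norm (a + z *s b - p))\<^sup>2 \<le> exp (Re (h z))"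
      proof (rule vector_maximum_modulus[where S = S and G = "\<lambda>w. g (L w)"])
        show "(\<lambda>w. g (L w)) holomorphic_on interior S"
          using gL SW closure_subset interior_subset by (intro holomorphic_on_subset[OF gL]) blast
        show "continuous_on (closure S) (\<lambda>w. g (L w))"
          using holomorphic_on_imp_continuous_on[OF gL] SW by (rule continuous_on_subset)
        show "bounded S"
          by (rule bounded_subset[of "cball z r"]) (auto simp: S_def)
        show "z \<in> S"
          using True r by (simp add: S_def)
        fix w assume w: "w \<in> frontier S"
        then have wc: "w \<in> cball z r" and Lw: "L w \<in> G"
          using clS[of w] by (auto simp: frontier_def)
        \<comment> \<open>A frontier point of \<open>S\<close> either has
          \<open>u1 \<le> u2\<close>, where \<open>u2\<close> is already majorized, or lies on the
          circle, where \<open>u = u1\<close> is majorized by hypothesis; any other point would be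
          interior to \<open>S\<close>.\<close>
        have "u1 (L w) \<le> exp (Re (h w))"
        proof (cases "u2 (L w) < u1 (L w)")
          case False
          then show ?thesis
            using u2_major[OF wc] by simp
        next
          case less: True
          have "w \<in> sphere z r"
          proof (rule ccontr)
            assume "w \<notin> sphere z r"
            then have wb: "w \<in> ball z r"
              using wc by (simp add: less_le)
            have LV: "L w \<in> V"
              using Lw \<open>closure G \<subseteq> V\<close> closure_subset by blast
            have "((\<lambda>y. u1 y - u2 y) \<longlongrightarrow> u1 (L w) - u2 (L w)) (nhds (L w))"
              using iso1[OF LV] iso2[of "L w"]
              by (intro tendsto_diff) (simp_all only: tendsto_at_iff_tendsto_nhds isCont_def)
            then have "\<forall>\<^sub>F y in nhds (L w). 0 < u1 y - u2 y"
              using less by (intro order_tendstoD) auto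
            then have 1: "\<forall>\<^sub>F x in nhds w. 0 < u1 (L x) - u2 (L x)"
              by (rule eventually_compose_filterlim[OF _ limL])
            have 2: "\<forall>\<^sub>F x in nhds w. L x \<in> G"
              using eventually_nhds_in_open[OF \<open>open G\<close> Lw] by (rule eventually_compose_filterlim[OF _ limL])
            have 3: "\<forall>\<^sub>F x in nhds w. x \<in> ball z r"
              using wb by (intro eventually_nhds_in_open) auto
            have "\<forall>\<^sub>F x in nhds w. x \<in> S"
              using 1 2 3 by eventually_elim (auto simp: S_def)
            then have "w \<in> interior S"
              by (meson eventually_nhds interiorI subsetI)
            then show False
              using w by (simp add: frontier_def)
          qed
          then show ?thesis
            using le[of w] Lw by (simp add: u L_def)
        qed
        then show "(cmod (g (L w)))\<^sup>2 + (norm (a + w *s b - p))\<^sup>2 \<le> exp (Re (h w))"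
          by (simp add: u1 L_def)
      qed (rule h)
      moreover have "u (L z) = u1 (L z)"
        using True by (simp add: u)
      ultimately show ?thesis
        by (simp add: u1 L_def)
    qed
  qed
  have cont_k: "continuous_on \<Omega> (\<lambda>z. k * u z)"
    by (intro continuous_intros cont)
  have nonneg_k: "0 \<le> k * u z" for z
    using \<open>k > 0\<close> nonneg[of z] by simp
  have major_k: "k * u (a + z *s b) \<le> exp (Re (h z))"
    if "r > 0" "\<And>w. w \<in> cball z r \<Longrightarrow> a + w *s b \<in> \<Omega>" "h holomorphic_on UNIV"
      and le: "\<And>w. w \<in> sphere z r \<Longrightarrow> k * u (a + w *s b) \<le> exp (Re (h w))" for a b z r h
  proof -
    \<comment> \<open>A positive factor is absorbed into the majorant, which becomes
      \<open>h - ln k\<close>.\<close>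
    have iff: "k * x \<le> exp (Re y) \<longleftrightarrow> x \<le> exp (Re (y - of_real (ln k)))" for x y
      using \<open>k > 0\<close> by (simp add: exp_diff pos_le_divide_eq mult.commute)
    have "u (a + z *s b) \<le> exp (Re (h z - of_real (ln k)))"
    proof (rule major[OF that(1,2)])
      show "(\<lambda>w. h w - of_real (ln k)) holomorphic_on UNIV"
        by (intro holomorphic_intros that(3))
    qed (use le in \<open>simp_all only: iff\<close>)
    then show ?thesis
      by (simp only: iff)
  qed
  show "plurisubharmonic_on \<Omega> (\<lambda>z. ereal (k * u z))"
    by (rule plurisubharmonic_of_holomorphic_majorants(1)[OF cont_k nonneg_k]) (rule major_k)
  show "plurisubharmonic_on \<Omega> (\<lambda>z. ext_ln (k * u z))"
    by (rule plurisubharmonic_of_holomorphic_majorants(2)[OF cont_k nonneg_k]) (rule major_k)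
qed

section \<open>The domain near a boundary point\<close>

lemma complex_linear_combination: "c *s x = Re c *\<^sub>R x + Im c *\<^sub>R (\<i> *s (x :: complex ^ 'n::finite))"
  by (simp add: vec_eq_iff complex_eq_iff)

lemma defining_function_eq_0:
  fixes r :: "complex ^ 'n::finite \<Rightarrow> real"
  assumes "open \<Omega>" "P \<in> frontier \<Omega>" "local_defining_function \<Omega> P U r"
  shows "r P = 0"
proof -
  have U: "open U" "P \<in> U" "\<Omega> \<inter> U = {z \<in> U. r z < 0}" "C2_on U r"
    using assms(3) by (auto simp: local_defining_function_def)
  obtain f' :: "complex ^ 'n \<Rightarrow> ((complex ^ 'n) \<Rightarrow>\<^sub>L real)"
    where "\<forall>x\<in>U. (r has_derivative blinfun_apply (f' x)) (at x)"
    using U(4) unfolding C2_on_def by blast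
  then have "(r has_derivative blinfun_apply (f' P)) (at P)"
    using U(2) by simp
  then have "isCont r P"
    by (rule has_derivative_continuous)
  have mem: "z \<in> \<Omega> \<longleftrightarrow> r z < 0" if "z \<in> U" for z
    using U(3) that by blast
  have "P \<notin> \<Omega>"
    using assms(1,2) by (simp add: frontier_def interior_open)
  then have "r P \<ge> 0"
    using mem[OF U(2)] by simp
  moreover have "r P \<le> 0"
  proof (rule ccontr)
    assume "\<not> r P \<le> 0"
    then have "\<forall>\<^sub>F z in at P. 0 < r z"
      using \<open>isCont r P\<close> unfolding isCont_def by (intro order_tendstoD) auto
    then have "\<forall>\<^sub>F z in nhds P. 0 < r z"
      using \<open>\<not> r P \<le> 0\<close> by (auto simp: eventually_at_filter elim!: eventually_mono)
    moreover have "\<forall>\<^sub>F z in nhds P. z \<in> U"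
      using U by (intro eventually_nhds_in_open)
    ultimately have "\<forall>\<^sub>F z in nhds P. z \<notin> \<Omega>"
      by eventually_elim (simp add: mem)
    then obtain X where "open X" "P \<in> X" "X \<inter> \<Omega> = {}"
      unfolding eventually_nhds by blast
    then have "P \<notin> closure \<Omega>"
      using open_Int_closure_eq_empty[of X \<Omega>] by blast
    then show False
      using assms(2) by (simp add: frontier_def)
  qed
  ultimately show ?thesis by simp
qed

text \<open>\<open>N\<close> is orthogonal to the kernel of \<open>D\<close>, and subtracting a
  multiple of \<open>N\<close> moves any vector into that kernel, so the linear form
  \<open>D\<close> is a multiple of the inner product with \<open>N\<close>.\<close>

lemma normal_derivative:
  fixes r :: "complex ^ 'n::finite \<Rightarrow> real"
  assumes "inner_unit_normal r P N" "(r has_derivative D) (at P)"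
  shows "D N < 0" "D v = D N * (N \<bullet> v)"
proof -
  have D: "frechet_derivative r (at P) = D"
    using assms(2) by (metis frechet_derivative_at)
  have lin: "linear D"
    using assms(2) by (rule has_derivative_linear)
  have N: "norm N = 1" "\<And>v. D v = 0 \<Longrightarrow> N \<bullet> v = 0" "D N < 0"
    using assms(1) by (auto simp: inner_unit_normal_def D)
  show "D N < 0" by (rule N(3))
  have "D (v - (D v / D N) *\<^sub>R N) = 0"
    using N(3) by (simp add: linear_diff[OF lin] linear_scale[OF lin])
  then have "N \<bullet> (v - (D v / D N) *\<^sub>R N) = 0"
    by (rule N(2))
  then have "N \<bullet> v = D v / D N"
    using N(1) by (simp add: inner_diff_right power2_norm_eq_inner[symmetric])
  then show "D v = D N * (N \<bullet> v)"
    using N(3) by simp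
qed

text \<open>Taylor's formula divided by \<open>k\<close>, the inward decrease of \<open>r\<close>.
  The constant \<open>M\<close> collects half the second derivative and the Taylor error 1. This is
  the geometric input of the lower bounds for the Kobayashi and Sibony metrics.\<close>

lemma outer_quadratic_bound:
  fixes r :: "complex ^ 'n::finite \<Rightarrow> real"
  assumes "open \<Omega>" "P \<in> frontier \<Omega>" "local_defining_function \<Omega> P U r" "inner_unit_normal r P N"
  obtains M R where "M > 0" "R > 0"
    "\<And>v. norm v < R \<Longrightarrow> P + v \<in> \<Omega> \<Longrightarrow> 0 < N \<bullet> v + M * (norm v)\<^sup>2"
proof -
  have U: "open U" "P \<in> U" "\<Omega> \<inter> U = {z \<in> U. r z < 0}" "C2_on U r"
    using assms(3) by (auto simp: local_defining_function_def)
  obtain f' f'' where f': "\<And>y. y \<in> U \<Longrightarrow> (r has_derivative blinfun_apply (f' y)) (at y)"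
    and f'': "\<And>y. y \<in> U \<Longrightarrow> (f' has_derivative blinfun_apply (f'' y)) (at y)"
    using U(4) unfolding C2_on_def by blast
  define k where "k = - f' P N"
  note nd = normal_derivative[OF assms(4) f'[OF U(2)]]
  have k: "k > 0" and Dv: "f' P v = - k * (N \<bullet> v)" for v
    using nd(1) nd(2)[of v] by (simp_all add: k_def)
  have r0: "r P = 0"
    using assms by (intro defining_function_eq_0)
  obtain d where d: "d > 0" "\<And>v. norm v < d \<Longrightarrow> P + v \<in> U"
    "\<And>v. norm v < d \<Longrightarrow> \<bar>r (P + v) - r P - f' P v - f'' P v v / 2\<bar> \<le> 1 * (norm v)\<^sup>2"
    by (rule taylor_second_order[OF U(1,2) f' f''[OF U(2)] zero_less_one]) (assumption, rule that)
  show ?thesis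
  proof (rule that[of "(norm (f'' P) / 2 + 1) / k" d])
    show "0 < (norm (f'' P) / 2 + 1) / k"
      using k by (intro divide_pos_pos add_nonneg_pos) auto
    show "d > 0" by (rule d(1))
    fix v assume v: "norm v < d" "P + v \<in> \<Omega>"
    have "r (P + v) < 0"
      using v d(2)[OF v(1)] U(3) by blast
    have "norm (f'' P v v) \<le> norm (f'' P v) * norm v"
      by (rule norm_blinfun)
    also have "\<dots> \<le> norm (f'' P) * norm v * norm v"
      by (intro mult_right_mono norm_blinfun) auto
    finally have "\<bar>f'' P v v\<bar> \<le> norm (f'' P) * (norm v)\<^sup>2"
      by (simp add: power2_eq_square mult.assoc)
    then have "0 < k * (N \<bullet> v) + (norm (f'' P) / 2 + 1) * (norm v)\<^sup>2"
      using d(3)[OF v(1)] \<open>r (P + v) < 0\<close> by (simp add: r0 Dv algebra_simps abs_le_iff)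
    then show "0 < N \<bullet> v + (norm (f'' P) / 2 + 1) / k * (norm v)\<^sup>2"
      using k by (simp add: field_simps)
  qed
qed

lemma abs_blinfun2_le: "\<bar>blinfun_apply (blinfun_apply B x) y\<bar> \<le> norm B * norm x * norm y"
proof -
  have "norm (B x y) \<le> norm (B x) * norm y"
    by (rule norm_blinfun)
  also have "\<dots> \<le> norm B * norm x * norm y"
    by (intro mult_right_mono norm_blinfun) auto
  finally show ?thesis by simp
qed

text \<open>The term \<open>a \<zeta>\<^sup>2\<close> cancels the pure second derivatives of \<open>r\<close> along \<open>T\<close>, which leaves the
  negative Levi form.\<close>

lemma inner_model_at_concave_point:
  fixes r :: "complex ^ 'n::finite \<Rightarrow> real"
  assumes "open \<Omega>" "P \<in> frontier \<Omega>" "local_defining_function \<Omega> P U r" "inner_unit_normal r P N"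
    and "levi_eigenvalue r P \<mu>" "\<mu> < 0"
  obtains T a l \<rho> where "norm T = 1" "l > 0" "\<rho> > 0"
    "\<And>w \<zeta>. cmod w \<le> \<rho> \<Longrightarrow> cmod \<zeta> \<le> \<rho> \<Longrightarrow> cmod w / 4 < Re w + l * (cmod \<zeta>)\<^sup>2 \<Longrightarrow>
       P + (w + a * \<zeta>\<^sup>2) *s N + \<zeta> *s T \<in> \<Omega>"
proof -
  have U: "open U" "P \<in> U" "\<Omega> \<inter> U = {z \<in> U. r z < 0}" "C2_on U r"
    using assms(3) by (auto simp: local_defining_function_def)
  obtain f' f'' where f': "\<And>y. y \<in> U \<Longrightarrow> (r has_derivative blinfun_apply (f' y)) (at y)"
    and f'': "\<And>y. y \<in> U \<Longrightarrow> (f' has_derivative blinfun_apply (f'' y)) (at y)"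
    using U(4) unfolding C2_on_def by blast
  define k where "k = - f' P N"
  note nd = normal_derivative[OF assms(4) f'[OF U(2)]]
  have k: "k > 0" and Dv: "f' P v = - k * (N \<bullet> v)" for v
    using nd(1) nd(2)[of v] by (simp_all add: k_def)
  have N1: "norm N = 1"
    using assms(4) by (simp add: inner_unit_normal_def)
  have r0: "r P = 0"
    using assms by (intro defining_function_eq_0)
  obtain \<xi> where \<xi>: "\<xi> \<in> complex_tangent_space r P" "\<xi> \<noteq> 0"
    "complex_hessian r P \<xi> \<xi> = of_real \<mu> * herm_inner \<xi> \<xi>"
    using assms(5) by (auto simp: levi_eigenvalue_def)
  define Q where "Q = f'' P"
  define T where "T = (1 / norm \<xi>) *\<^sub>R \<xi>"
  have T1: "norm T = 1"
    using \<xi>(2) by (simp add: T_def)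
  have iT: "\<i> *s T = (1 / norm \<xi>) *\<^sub>R (\<i> *s \<xi>)"
    by (simp add: T_def vec_eq_iff)
  have "complex_of_real (f' P \<xi>) - \<i> * of_real (f' P (\<i> *s \<xi>)) = 0"
    using \<xi>(1) sum_dz_real[OF f'[OF U(2)], of \<xi>] by (simp add: complex_tangent_space_def)
  then have "f' P \<xi> = 0" "f' P (\<i> *s \<xi>) = 0"
    by (simp_all add: complex_eq_iff)
  then have DT: "f' P (\<zeta> *s T) = 0" for \<zeta>
    unfolding complex_linear_combination[of \<zeta> T] iT
    by (simp add: T_def blinfun.add_right blinfun.scaleR_right)
  have "Re (complex_hessian r P \<xi> \<xi>) = \<mu> * (norm \<xi>)\<^sup>2"
    unfolding \<xi>(3) herm_inner_self by simp
  then have "(Q \<xi> \<xi> + Q (\<i> *s \<xi>) (\<i> *s \<xi>)) / 4 = \<mu> * (norm \<xi>)\<^sup>2"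
    by (subst (asm) complex_hessian_eq[OF U(1,2) f' f''[OF U(2)]]) (simp_all add: Q_def)
  then have levi: "Q T T + Q (\<i> *s T) (\<i> *s T) = 4 * \<mu>"
    unfolding iT using \<xi>(2)
    by (simp add: T_def blinfun.scaleR_left blinfun.scaleR_right field_simps power2_eq_square)
  \<comment> \<open>Splitting of the real quadratic form \<open>Q\<close> on the complex line
    through \<open>T\<close>: \<open>2 * \<mu> |\<zeta>|^2\<close> is its Hermitian part, and
    \<open>Re (b \<zeta>^2)\<close> is its pure part.\<close>
  define b where "b = Complex ((Q T T - Q (\<i> *s T) (\<i> *s T)) / 2) (- (Q T (\<i> *s T) + Q (\<i> *s T) T) / 2)"
  have Q\<zeta>: "Q (\<zeta> *s T) (\<zeta> *s T) = 2 * \<mu> * (cmod \<zeta>)\<^sup>2 + Re (b * \<zeta>\<^sup>2)" for \<zeta>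
  proof -
    have "Q (\<zeta> *s T) (\<zeta> *s T) = (Re \<zeta>)\<^sup>2 * Q T T + (Im \<zeta>)\<^sup>2 * Q (\<i> *s T) (\<i> *s T)
        + Re \<zeta> * Im \<zeta> * (Q T (\<i> *s T) + Q (\<i> *s T) T)"
      unfolding complex_linear_combination[of \<zeta> T]
      by (simp add: blinfun.add_right blinfun.add_left blinfun.scaleR_left blinfun.scaleR_right
          algebra_simps power2_eq_square)
    moreover have "2 * \<mu> = (Q T T + Q (\<i> *s T) (\<i> *s T)) / 2"
      using levi by simp
    ultimately show ?thesis
      unfolding cmod_power2
      by (simp only: b_def power2_eq_square times_complex.sel complex.sel) (simp add: field_simps)
  qed
  \<comment> \<open>Moving by \<open>a \<zeta>^2\<close> along \<open>N\<close> changes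
    \<open>r\<close> to first order by \<open>- k Re (a \<zeta>^2)\<close>, which is minus half of
    \<open>Re (b \<zeta>^2)\<close>; Taylor's formula contains exactly that half.\<close>
  define a where "a = b / of_real (2 * k)"
  define l where "l = - \<mu>"
  have l: "l > 0"
    using assms(6) by (simp add: l_def)
  define e where "e = l / 8"
  have e: "e > 0"
    using l by (simp add: e_def)
  obtain d where d: "d > 0" "\<And>v. norm v < d \<Longrightarrow> P + v \<in> U"
    "\<And>v. norm v < d \<Longrightarrow> \<bar>r (P + v) - r P - f' P v - f'' P v v / 2\<bar> \<le> e * (norm v)\<^sup>2"
    by (rule taylor_second_order[OF U(1,2) f' f''[OF U(2)] e]) (assumption, rule that)
  define K where "K = norm Q"
  define C where "C = (K + 2 * e) * (2 + cmod a)"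
  have K: "K \<ge> 0"
    by (simp add: K_def)
  have C: "C \<ge> 0"
    using K e by (simp add: C_def)
  \<comment> \<open>The bounds keep \<open>v\<close> in the Taylor ball and make the error at most
    \<open>k / 4 * cmod w + l / 4 * (cmod \<zeta>)\<^sup>2\<close>; the bound 1 allows
    \<open>(cmod \<zeta>)\<^sup>2 \<le> \<rho>\<close>.\<close>
  define \<rho> where "\<rho> = Min {1, d / (2 * (2 + cmod a)), k / (4 * (C + 1)), l / (4 * ((C + 1) * (cmod a + 1)))}"
  have \<rho>: "\<rho> > 0" "\<rho> \<le> 1" "\<rho> \<le> d / (2 * (2 + cmod a))" "\<rho> \<le> k / (4 * (C + 1))"
     "\<rho> \<le> l / (4 * ((C + 1) * (cmod a + 1)))"
    unfolding \<rho>_def using d(1) k l C by (simp_all add: add_nonneg_pos add_pos_nonneg)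
  have canc: "c * (x / (m * c)) = x / m" if "c > 0" for c m x :: real
    using that by simp
  have \<rho>1: "(2 + cmod a) * \<rho> < d"
  proof -
    have "(2 + cmod a) * \<rho> \<le> (2 + cmod a) * (d / (2 * (2 + cmod a)))"
      using \<rho>(3) by (intro mult_left_mono) auto
    also have "\<dots> = d / 2"
      by (rule canc) (simp add: add_pos_nonneg)
    finally show ?thesis using d(1) by simp
  qed
  have \<rho>2: "C * \<rho> \<le> k / 4"
  proof -
    have "C * \<rho> \<le> (C + 1) * (k / (4 * (C + 1)))"
      using \<rho>(1,4) C by (intro mult_mono) auto
    also have "\<dots> = k / 4"
      by (rule canc) (use C in simp)
    finally show ?thesis .
  qed
  have \<rho>3: "C * \<rho> * cmod a \<le> l / 4"
  proof -
    have "C * \<rho> * cmod a = (C * cmod a) * \<rho>"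
      by simp
    also have "\<dots> \<le> ((C + 1) * (cmod a + 1)) * (l / (4 * ((C + 1) * (cmod a + 1))))"
      using \<rho>(1,5) C by (intro mult_mono) auto
    also have "\<dots> = l / 4"
      by (rule canc) (use C in \<open>simp add: add_nonneg_pos\<close>)
    finally show ?thesis .
  qed
  \<comment> \<open>Of the Levi gain \<open>l |\<zeta>|^2\<close> half is left after two errors of
    \<open>l / 4\<close>; division by \<open>k\<close> gives \<open>l / (2 * k)\<close>, and the
    error \<open>k / 4 * cmod w\<close> becomes the slack \<open>cmod w / 4\<close> of the
    model.\<close>
  show ?thesis
  proof (rule that[of T "l / (2 * k)" \<rho> a])
    show "norm T = 1" "0 < l / (2 * k)" "0 < \<rho>"
      using T1 l k \<rho> by auto
    fix w \<zeta> assume w: "cmod w \<le> \<rho>" and \<zeta>: "cmod \<zeta> \<le> \<rho>"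
      and cond: "cmod w / 4 < Re w + l / (2 * k) * (cmod \<zeta>)\<^sup>2"
    define \<omega> where "\<omega> = w + a * \<zeta>\<^sup>2"
    define v where "v = \<omega> *s N + \<zeta> *s T"
    have \<omega>_le: "cmod \<omega> \<le> cmod w + cmod a * (cmod \<zeta>)\<^sup>2"
      unfolding \<omega>_def by (rule order_trans[OF norm_triangle_ineq]) (simp add: norm_mult norm_power)
    have "(cmod \<zeta>)\<^sup>2 \<le> \<rho> * 1"
      using \<zeta> \<rho> unfolding power2_eq_square by (intro mult_mono) auto
    then have "cmod a * (cmod \<zeta>)\<^sup>2 \<le> cmod a * \<rho>"
      by (intro mult_left_mono) auto
    then have sum_le: "cmod \<omega> + cmod \<zeta> \<le> (2 + cmod a) * \<rho>"
      using \<omega>_le w \<zeta> by (simp add: algebra_simps)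
    have v_le: "norm v \<le> cmod \<omega> + cmod \<zeta>"
      unfolding v_def by (rule order_trans[OF norm_triangle_ineq]) (simp add: norm_smult_vec N1 T1)
    then have vd: "norm v < d"
      using sum_le \<rho>1 by linarith
    have "N \<bullet> (\<omega> *s N) = Re \<omega>"
      using N1 by (metis Re_herm_inner herm_inner_scale_left herm_inner_self inner_commute mult.right_neutral of_real_1 one_power2)
    then have D: "f' P v = - k * Re \<omega>"
      unfolding v_def by (simp add: blinfun.add_right DT) (simp add: Dv)
    have Qv: "Q v v \<le> K * cmod \<omega> * cmod \<omega> + 2 * (K * cmod \<omega> * cmod \<zeta>) + Q (\<zeta> *s T) (\<zeta> *s T)"
    proof -
      have "Q v v = Q (\<omega> *s N) (\<omega> *s N) + Q (\<omega> *s N) (\<zeta> *s T) + Q (\<zeta> *s T) (\<omega> *s N) + Q (\<zeta> *s T) (\<zeta> *s T)"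
        by (simp add: v_def blinfun.add_left blinfun.add_right)
      moreover have "\<bar>Q (\<omega> *s N) (\<omega> *s N)\<bar> \<le> K * cmod \<omega> * cmod \<omega>"
        "\<bar>Q (\<omega> *s N) (\<zeta> *s T)\<bar> \<le> K * cmod \<omega> * cmod \<zeta>"
        "\<bar>Q (\<zeta> *s T) (\<omega> *s N)\<bar> \<le> K * cmod \<zeta> * cmod \<omega>"
        using abs_blinfun2_le[of Q "\<omega> *s N" "\<omega> *s N"] abs_blinfun2_le[of Q "\<omega> *s N" "\<zeta> *s T"]
          abs_blinfun2_le[of Q "\<zeta> *s T" "\<omega> *s N"]
        by (simp_all add: norm_smult_vec N1 T1 K_def)
      moreover have "K * cmod \<zeta> * cmod \<omega> = K * cmod \<omega> * cmod \<zeta>"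
        by simp
      ultimately show ?thesis
        by linarith
    qed
    have "(norm v)\<^sup>2 \<le> (cmod \<omega> + cmod \<zeta>)\<^sup>2"
      using v_le by (intro power_mono) auto
    also have "\<dots> \<le> 2 * (cmod \<omega>)\<^sup>2 + 2 * (cmod \<zeta>)\<^sup>2"
      using sum_squares_bound[of "cmod \<omega>" "cmod \<zeta>"] by (simp add: power2_sum)
    finally have "e * (norm v)\<^sup>2 \<le> e * (2 * (cmod \<omega>)\<^sup>2 + 2 * (cmod \<zeta>)\<^sup>2)"
      using e by (intro mult_left_mono) auto
    then have err: "e * (norm v)\<^sup>2 \<le> 2 * e * (cmod \<omega> * cmod \<omega>) + l / 4 * (cmod \<zeta>)\<^sup>2"
      by (simp add: e_def power2_eq_square algebra_simps)
    have ab: "k * Re (a * \<zeta>\<^sup>2) = Re (b * \<zeta>\<^sup>2) / 2"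
    proof -
      have "of_real k * (a * \<zeta>\<^sup>2) = b * \<zeta>\<^sup>2 / 2"
        using k by (simp add: a_def field_simps)
      then have "Re (of_real k * (a * \<zeta>\<^sup>2)) = Re (b * \<zeta>\<^sup>2 / 2)"
        by (rule arg_cong)
      then show ?thesis
        by simp
    qed
    have small: "K / 2 * cmod \<omega> * cmod \<omega> + K * cmod \<omega> * cmod \<zeta> + 2 * e * (cmod \<omega> * cmod \<omega>)
        \<le> k / 4 * cmod w + l / 4 * (cmod \<zeta>)\<^sup>2"
    proof -
      have "K / 2 * cmod \<omega> * cmod \<omega> + K * cmod \<omega> * cmod \<zeta> + 2 * e * (cmod \<omega> * cmod \<omega>)
         \<le> cmod \<omega> * (K + 2 * e) * (cmod \<omega> + cmod \<zeta>)"
      proof -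
        have "0 \<le> K / 2 * (cmod \<omega> * cmod \<omega>)" "0 \<le> 2 * e * (cmod \<omega> * cmod \<zeta>)"
          using K e by simp_all
        then show ?thesis
          by (simp add: algebra_simps)
      qed
      also have "\<dots> \<le> cmod \<omega> * (K + 2 * e) * ((2 + cmod a) * \<rho>)"
        using sum_le K e by (intro mult_left_mono) auto
      also have "\<dots> = (C * \<rho>) * cmod \<omega>"
        by (simp add: C_def)
      also have "\<dots> \<le> (C * \<rho>) * (cmod w + cmod a * (cmod \<zeta>)\<^sup>2)"
        using \<omega>_le C \<rho>(1) by (intro mult_left_mono) auto
      also have "\<dots> = (C * \<rho>) * cmod w + (C * \<rho> * cmod a) * (cmod \<zeta>)\<^sup>2"
        by (simp add: algebra_simps)
      also have "\<dots> \<le> k / 4 * cmod w + l / 4 * (cmod \<zeta>)\<^sup>2"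
        using \<rho>2 \<rho>3 by (intro add_mono mult_right_mono) auto
      finally show ?thesis .
    qed
    have "r (P + v) \<le> f' P v + Q v v / 2 + e * (norm v)\<^sup>2"
      using d(3)[OF vd] by (simp add: r0 Q_def abs_le_iff)
    also have "\<dots> \<le> - k * Re w - k * Re (a * \<zeta>\<^sup>2) + Re (b * \<zeta>\<^sup>2) / 2 - l * (cmod \<zeta>)\<^sup>2 + l / 4 * (cmod \<zeta>)\<^sup>2
        + (K / 2 * cmod \<omega> * cmod \<omega> + K * cmod \<omega> * cmod \<zeta> + 2 * e * (cmod \<omega> * cmod \<omega>))"
    proof -
      have "Q v v / 2 \<le> K / 2 * cmod \<omega> * cmod \<omega> + K * cmod \<omega> * cmod \<zeta> + Q (\<zeta> *s T) (\<zeta> *s T) / 2"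
        using Qv by simp
      moreover have "Q (\<zeta> *s T) (\<zeta> *s T) / 2 = - l * (cmod \<zeta>)\<^sup>2 + Re (b * \<zeta>\<^sup>2) / 2"
        unfolding Q\<zeta> l_def add_divide_distrib by simp
      moreover have "f' P v = - k * Re w - k * Re (a * \<zeta>\<^sup>2)"
        unfolding D \<omega>_def plus_complex.sel by (simp only: distrib_left)
      ultimately show ?thesis
        using err by linarith
    qed
    also have "\<dots> \<le> - k * Re w - l / 2 * (cmod \<zeta>)\<^sup>2 + k / 4 * cmod w"
      using small ab by linarith
    also have "\<dots> = k * (cmod w / 4 - (Re w + l / (2 * k) * (cmod \<zeta>)\<^sup>2))"
      using k by (simp add: field_simps)
    also have "\<dots> < 0"
      using cond k by (simp add: mult_less_0_iff)
    finally have "P + v \<in> \<Omega>"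
      using d(2)[OF vd] U(3) by blast
    then show "P + (w + a * \<zeta>\<^sup>2) *s N + \<zeta> *s T \<in> \<Omega>"
      by (simp add: v_def \<omega>_def add.assoc)
  qed
qed

text \<open>The defect \<open>\<xi> = \<nu> - \<kappa> *s N\<close> is Hermitian orthogonal to
  \<open>N\<close>, so \<open>D\<close> annihilates \<open>\<xi>\<close> and
  \<open>\<i> *s \<xi>\<close>, and \<open>\<xi>\<close> is complex tangent. As \<open>\<nu>\<close>
  is orthogonal to tangent vectors, \<open>\<xi>\<close> is orthogonal to itself. All three metrics
  can thus be evaluated at \<open>\<kappa> *s N\<close>.\<close>

lemma unit_complex_normal_eq:
  fixes r :: "complex ^ 'n::finite \<Rightarrow> real"
  assumes "inner_unit_normal r P N" "(r has_derivative D) (at P)" "unit_complex_normal r P \<nu>"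
  obtains \<kappa> where "cmod \<kappa> = 1" "\<nu> = \<kappa> *s N"
proof -
  note nd = normal_derivative[OF assms(1,2)]
  have N1: "norm N = 1" and \<nu>1: "norm \<nu> = 1"
    using assms(1,3) by (simp_all add: inner_unit_normal_def unit_complex_normal_def)
  define \<kappa> where "\<kappa> = herm_inner \<nu> N"
  define \<xi> where "\<xi> = \<nu> - \<kappa> *s N"
  have NN: "herm_inner N N = 1"
    using N1 by (simp add: herm_inner_self)
  have \<xi>N: "herm_inner \<xi> N = 0"
    by (simp add: \<xi>_def herm_inner_diff_left herm_inner_scale_left NN \<kappa>_def)
  have Dv: "D v = D N * Re (herm_inner v N)" for v
    using nd(2)[of v] by (simp add: Re_herm_inner inner_commute)
  have "D \<xi> = 0" "D (\<i> *s \<xi>) = 0"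
    using Dv[of \<xi>] Dv[of "\<i> *s \<xi>"] by (simp_all add: herm_inner_scale_left \<xi>N)
  then have "\<xi> \<in> complex_tangent_space r P"
    by (simp add: complex_tangent_space_def sum_dz_real[OF assms(2)])
  then have "herm_inner \<nu> \<xi> = 0"
    using assms(3) by (simp add: unit_complex_normal_def)
  moreover have "herm_inner \<nu> \<xi> = herm_inner \<xi> \<xi> + \<kappa> * herm_inner N \<xi>"
    by (metis \<xi>_def diff_add_cancel herm_inner_add_left herm_inner_scale_left)
  moreover have "herm_inner N \<xi> = 0"
    using \<xi>N cnj_herm_inner[of \<xi> N] by simp
  ultimately have "\<xi> = 0"
    by (simp add: herm_inner_self)
  then have "\<nu> = \<kappa> *s N"
    by (simp add: \<xi>_def)
  moreover from this have "cmod \<kappa> = 1"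
    using \<nu>1 N1 by (simp add: norm_smult_vec)
  ultimately show ?thesis
    using that by blast
qed

section \<open>The Kobayashi and Caratheodory metrics\<close>

lemma holomorphic_on_unit_disc_rescale:
  assumes "g holomorphic_on ball 0 R" "R > 0"
  shows "(\<lambda>z. g (of_real R * z)) holomorphic_on ball 0 1"
proof -
  have "(\<lambda>z::complex. of_real R * z) ` ball 0 1 \<subseteq> ball 0 R"
    using assms(2) by (auto simp: norm_mult)
  then have "(g \<circ> (\<lambda>z. of_real R * z)) holomorphic_on ball 0 1"
    by (intro holomorphic_on_compose_gen[OF _ assms(1)] holomorphic_intros)
  then show ?thesis
    by (simp add: o_def)
qed

text \<open>The factor 4, rather than 2, makes the normalized function strictly smaller than 1 in
  modulus although the bound by \<open>B\<close> is not strict.\<close>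

lemma schwarz_bound:
  assumes g: "g holomorphic_on ball 0 R" and "R > 0" "B > 0"
    and le: "\<And>t. t \<in> ball 0 R \<Longrightarrow> cmod (g t) \<le> B" and t: "t \<in> ball 0 R"
  shows "cmod (g t - g 0) \<le> 4 * B * cmod t / R"
proof -
  define f where "f z = (g (of_real R * z) - g 0) / of_real (4 * B)" for z
  have in_ball: "of_real R * z \<in> ball 0 R" if "cmod z < 1" for z
    using that \<open>R > 0\<close> by (simp add: norm_mult)
  have "(\<lambda>z. g (of_real R * z)) holomorphic_on ball 0 1"
    using g \<open>R > 0\<close> by (rule holomorphic_on_unit_disc_rescale)
  then have "f holomorphic_on ball 0 1"
    unfolding f_def by (intro holomorphic_intros) (use \<open>B > 0\<close> in auto)
  moreover have "f 0 = 0"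
    by (simp add: f_def)
  moreover have "cmod (f z) < 1" if z: "cmod z < 1" for z
  proof -
    have "cmod (g (of_real R * z) - g 0) \<le> B + B"
      using le[OF in_ball[OF z]] le[of 0] \<open>R > 0\<close> by (intro order_trans[OF norm_triangle_ineq4] add_mono) auto
    then show ?thesis
      using \<open>B > 0\<close> by (simp add: f_def norm_divide)
  qed
  moreover have "cmod (t / of_real R) < 1"
    using t \<open>R > 0\<close> by (simp add: norm_divide)
  ultimately have "cmod (f (t / of_real R)) \<le> cmod (t / of_real R)"
    by (rule Schwarz_Lemma(1))
  then show ?thesis
    using \<open>R > 0\<close> \<open>B > 0\<close> by (simp add: f_def norm_divide field_simps)
qed

text \<open>The Schwarz estimate is applied to \<open>f\<close> and then to \<open>f t / t\<close>,
  which vanishes at 0 because the derivative of \<open>f\<close> does; hence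
  \<open>16 = 4 * 4\<close>.\<close>

lemma schwarz_bound_second_order:
  assumes f: "f holomorphic_on ball 0 1" and "B > 0" "f 0 = 0" "deriv f 0 = 0"
    and le: "\<And>t. t \<in> ball 0 1 \<Longrightarrow> cmod (f t) \<le> B" and t: "t \<in> ball 0 1"
  shows "cmod (f t) \<le> 16 * B * (cmod t)\<^sup>2"
proof -
  obtain h where h: "h holomorphic_on ball 0 1" "\<And>z. cmod z < 1 \<Longrightarrow> f z = z * h z" "deriv f 0 = h 0"
    using Schwarz3[OF f \<open>f 0 = 0\<close>] by blast
  have "cmod (h z) \<le> 4 * B" if "z \<in> ball 0 1" for z
  proof (cases "z = 0")
    case True
    then show ?thesis
      using h(3) \<open>deriv f 0 = 0\<close> \<open>B > 0\<close> by simp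
  next
    case False
    have "cmod (f z - f 0) \<le> 4 * B * cmod z / 1"
      using f _ \<open>B > 0\<close> le that by (rule schwarz_bound) simp
    then show ?thesis
      using False h(2)[of z] that \<open>f 0 = 0\<close> by (simp add: norm_mult)
  qed
  then have "cmod (h t - h 0) \<le> 4 * (4 * B) * cmod t / 1"
    using h(1) \<open>B > 0\<close> t by (intro schwarz_bound) auto
  then have "cmod t * cmod (h t) \<le> cmod t * (16 * B * cmod t)"
    using h(3) \<open>deriv f 0 = 0\<close> by (intro mult_left_mono) auto
  then show ?thesis
    using h(2)[of t] t by (simp add: norm_mult power2_eq_square mult_ac)
qed

text \<open>The Cayley transform centred at \<open>h 0\<close> maps the half plane to the disc and
  \<open>h 0\<close> to 0; the Schwarz lemma bounds the derivative of the composition there.\<close>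

lemma half_plane_deriv_bound:
  assumes h: "h holomorphic_on ball 0 s" and "s > 0" and pos: "\<And>t. t \<in> ball 0 s \<Longrightarrow> Re (h t) > 0"
  shows "cmod (deriv h 0) \<le> 2 * Re (h 0) / s"
proof -
  define g where "g z = (h (of_real s * z) - h 0) / (h (of_real s * z) + cnj (h 0))" for z
  have in_ball: "of_real s * z \<in> ball 0 s" if "cmod z < 1" for z
    using that \<open>s > 0\<close> by (simp add: norm_mult)
  have h0: "Re (h 0) > 0"
    using pos[of 0] \<open>s > 0\<close> by simp
  have nz: "h (of_real s * z) + cnj (h 0) \<noteq> 0" if "cmod z < 1" for z
  proof -
    have "Re (h (of_real s * z) + cnj (h 0)) > 0"
      using pos[OF in_ball[OF that]] h0 by simp
    then show ?thesis by force
  qed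
  have "(\<lambda>z. h (of_real s * z)) holomorphic_on ball 0 1"
    using h \<open>s > 0\<close> by (rule holomorphic_on_unit_disc_rescale)
  then have g: "g holomorphic_on ball 0 1"
    unfolding g_def by (intro holomorphic_intros) (use nz in auto)
  have less: "cmod (g z) < 1" if z: "cmod z < 1" for z
  proof -
    let ?w = "h (of_real s * z)"
    have "(cmod (?w - h 0))\<^sup>2 + 4 * (Re ?w * Re (h 0)) = (cmod (?w + cnj (h 0)))\<^sup>2"
      unfolding cmod_power2 by (simp add: power2_eq_square algebra_simps)
    moreover have "Re ?w * Re (h 0) > 0"
      using pos[OF in_ball[OF z]] h0 by simp
    ultimately have "(cmod (?w - h 0))\<^sup>2 < (cmod (?w + cnj (h 0)))\<^sup>2"
      by linarith
    then have "cmod (?w - h 0) < cmod (?w + cnj (h 0))"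
      by (rule power_less_imp_less_base) simp
    then show ?thesis
      using nz[OF z] by (simp add: g_def norm_divide)
  qed
  have "cmod (deriv g 0) \<le> 1"
    using g _ less by (rule Schwarz_Lemma(2)[where \<xi> = 0]) (simp_all add: g_def)
  have dh: "(h has_field_derivative deriv h 0) (at (of_real s * 0))"
    using h \<open>s > 0\<close> by (simp add: holomorphic_derivI[of h "ball 0 s"])
  have "((\<lambda>z. h (of_real s * z)) has_field_derivative deriv h 0 * of_real s) (at 0)"
    by (rule DERIV_chain2[where g = "\<lambda>z. of_real s * z" and x = 0, OF dh]) (auto intro!: derivative_eq_intros)
  then have "(g has_field_derivative deriv h 0 * of_real s / (h 0 + cnj (h 0))) (at 0)"
    unfolding g_def using nz[of 0]
    by (auto intro!: derivative_eq_intros simp: power2_eq_square divide_simps)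
  then have "deriv g 0 = deriv h 0 * of_real s / (h 0 + cnj (h 0))"
    by (rule DERIV_imp_deriv)
  also have "h 0 + cnj (h 0) = of_real (2 * Re (h 0))"
    by (simp add: complex_eq_iff)
  finally have "cmod (deriv h 0) * s / (2 * Re (h 0)) \<le> 1"
    using \<open>cmod (deriv g 0) \<le> 1\<close> \<open>s > 0\<close> h0 by (simp add: norm_mult norm_divide)
  then show ?thesis
    using \<open>s > 0\<close> h0 by (simp add: field_simps)
qed

lemma comparable_near_0I:
  assumes lower: "c > 0" "\<forall>\<^sub>F \<delta> in at_right 0. ereal (c * b \<delta>) \<le> f \<delta>"
    and upper: "\<forall>\<^sub>F \<delta> in at_right 0. f \<delta> \<le> ereal (C * b \<delta>)"
    and pos: "\<And>\<delta>. \<delta> > 0 \<Longrightarrow> b \<delta> \<ge> 0"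
  shows "comparable_near_0 f b"
  unfolding comparable_near_0_def
proof (intro exI conjI)
  define K where "K = max 1 (max C (1 / c))"
  show "1 \<le> K"
    by (simp add: K_def)
  have "1 \<le> c * K"
  proof -
    have "c * (1 / c) \<le> c * K"
      using \<open>c > 0\<close> by (intro mult_left_mono) (simp_all add: K_def)
    then show ?thesis
      using \<open>c > 0\<close> by simp
  qed
  have "\<forall>\<^sub>F \<delta> in at_right 0. (0::real) < \<delta>"
    by (simp add: eventually_at_right_less)
  with lower(2) upper show "\<forall>\<^sub>F \<delta> in at_right 0. ereal (b \<delta> / K) \<le> f \<delta> \<and> f \<delta> \<le> ereal (K * b \<delta>)"
  proof eventually_elim
    case (elim \<delta>)
    have "b \<delta> / K \<le> c * b \<delta>"
      using mult_right_mono[OF \<open>1 \<le> c * K\<close> pos[OF elim(3)]] \<open>1 \<le> K\<close> by (simp add: field_simps)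
    moreover have "C * b \<delta> \<le> K * b \<delta>"
      using pos[OF elim(3)] by (intro mult_right_mono) (simp_all add: K_def)
    ultimately show ?case
      using elim(1,2) by (meson ereal_less_eq(3) order_trans)
  qed
qed

lemma root_powr_3_4: "\<delta> > 0 \<Longrightarrow> \<delta> powr (3 / 4) = (root 4 \<delta>) ^ 3"
  by (simp add: root_powr_inverse powr_power)

text \<open>The outcome of the local analysis at the concave point, in the form shared by the three
  upper bounds: besides openness they see the domain only through this family of points.\<close>

locale inner_model =
  fixes \<Omega> :: "(complex ^ 'n::finite) set" and P N T a l \<rho>
  assumes N1: "norm N = 1" and T1: "norm T = 1" and l: "l > 0" and \<rho>: "\<rho> > 0"
    and inner: "\<And>w \<zeta>. cmod w \<le> \<rho> \<Longrightarrow> cmod \<zeta> \<le> \<rho> \<Longrightarrow> cmod w / 4 < Re w + l * (cmod \<zeta>)\<^sup>2 \<Longrightarrow>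
       P + (w + a * \<zeta>\<^sup>2) *s N + \<zeta> *s T \<in> \<Omega>"
begin

definition point :: "complex \<Rightarrow> complex \<Rightarrow> complex ^ 'n" where
  "point w \<zeta> = P + (w + a * \<zeta>\<^sup>2) *s N + \<zeta> *s T"

lemma point_mem:
  "cmod w \<le> \<rho> \<Longrightarrow> cmod \<zeta> \<le> \<rho> \<Longrightarrow> cmod w / 4 < Re w + l * (cmod \<zeta>)\<^sup>2 \<Longrightarrow> point w \<zeta> \<in> \<Omega>"
  unfolding point_def by (rule inner)

lemma point_0: "point (of_real \<delta>) 0 = P + \<delta> *\<^sub>R N"
  by (simp add: point_def scaleR_eq_smult)

lemma kobayashi_upper:
  assumes \<kappa>: "cmod \<kappa> = 1"
  obtains C where
    "\<forall>\<^sub>F \<delta> in at_right 0. kobayashi_metric \<Omega> (P + \<delta> *\<^sub>R N) (\<kappa> *s N) \<le> ereal (C * (1 / \<delta> powr (3 / 4)))"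
proof -
  \<comment> \<open>With \<open>s\<close> the fourth root of \<open>\<delta>\<close>, the bound
    \<open>1 / 2\<close> serves the parameters \<open>|t| \<le> s\<close>, where
    \<open>\<delta>\<close> pays for the normal motion, and \<open>l * \<rho>\<^sup>2 / 2\<close>
    serves the larger ones, where the Levi gain pays.\<close>
  define c where "c = min (1 / 2) (l * \<rho>\<^sup>2 / 2)"
  have c: "c > 0" "c \<le> 1 / 2" "c \<le> l * \<rho>\<^sup>2 / 2"
    using l \<rho> by (auto simp: c_def)
  have main: "kobayashi_metric \<Omega> (P + \<delta> *\<^sub>R N) (\<kappa> *s N) \<le> ereal (1 / c * (1 / \<delta> powr (3 / 4)))"
    if \<delta>: "0 < \<delta>" "\<delta> < min 1 ((\<rho> / 2) ^ 4)" for \<delta>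
  proof -
    define s where "s = root 4 \<delta>"
    have s4: "s ^ 4 = \<delta>" and s0: "s > 0"
      using \<delta> by (simp_all add: s_def)
    have s1: "s \<le> 1"
      using \<delta> by (simp add: s_def)
    have s\<rho>: "s \<le> \<rho> / 2"
      using \<delta> \<rho> s0 s4 by (intro power_le_imp_le_base[of s 3]) auto
    define \<alpha> where "\<alpha> = c * s ^ 3"
    have \<alpha>: "\<alpha> > 0"
      using c s0 by (simp add: \<alpha>_def)
    have "s ^ 3 \<le> s"
      using s0 s1 power_decreasing[of 1 3 s] by simp
    then have \<alpha>_le: "\<alpha> \<le> s / 2"
      using c s0 mult_mono[of c "1/2" "s ^ 3" s] by (simp add: \<alpha>_def)
    have \<delta>_le: "\<delta> \<le> s"
      using s0 s1 s4 power_decreasing[of 1 4 s] by simp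
    define \<phi> where "\<phi> t = point (of_real \<delta> + of_real \<alpha> * \<kappa> * t) (of_real \<rho> * t\<^sup>2)" for t
    have \<phi>_i: "\<phi> t $ i = P $ i + (of_real \<delta> + of_real \<alpha> * \<kappa> * t + a * (of_real \<rho> * t\<^sup>2)\<^sup>2) * N $ i + of_real \<rho> * t\<^sup>2 * T $ i"
      for t i by (simp add: \<phi>_def point_def algebra_simps)
    have mem: "\<phi> t \<in> \<Omega>" if "cmod t < 1" for t
      unfolding \<phi>_def
    proof (rule point_mem)
      let ?w = "of_real \<delta> + of_real \<alpha> * \<kappa> * t"
      let ?\<tau> = "cmod t"
      have w1: "cmod ?w \<le> \<delta> + \<alpha> * ?\<tau>"
        using \<delta> \<alpha> \<kappa> by (intro order_trans[OF norm_triangle_ineq]) (simp add: norm_mult)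
      have "\<bar>Re (of_real \<alpha> * \<kappa> * t)\<bar> \<le> \<alpha> * ?\<tau>"
        using abs_Re_le_cmod[of "of_real \<alpha> * \<kappa> * t"] \<alpha> \<kappa> by (simp add: norm_mult)
      then have w2: "Re ?w \<ge> \<delta> - \<alpha> * ?\<tau>"
        unfolding plus_complex.sel Re_complex_of_real by linarith
      have "\<alpha> * ?\<tau> \<le> \<alpha> * 1"
        using that \<alpha> by (intro mult_left_mono) auto
      then show "cmod ?w \<le> \<rho>"
        using w1 \<alpha>_le \<delta>_le s\<rho> s0 by linarith
      have "?\<tau>\<^sup>2 \<le> 1"
        using that by (simp add: power_le_one)
      then show "cmod (of_real \<rho> * t\<^sup>2) \<le> \<rho>"
        using \<rho> by (simp add: norm_mult norm_power mult_left_le)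
      have l4: "l * (cmod (of_real \<rho> * t\<^sup>2))\<^sup>2 = l * \<rho>\<^sup>2 * ?\<tau> ^ 4"
        using \<rho> by (simp add: norm_mult norm_power power_mult_distrib power_mult[symmetric])
      \<comment> \<open>With \<open>|w| \<le> \<delta> + \<alpha> |t|\<close> and
        \<open>Re w \<ge> \<delta> - \<alpha> |t|\<close> the condition of the model reduces to this
        inequality. At \<open>|t| = s\<close> all its terms are of order \<open>s^4\<close>.\<close>
      have key: "5 / 4 * (\<alpha> * ?\<tau>) < 3 / 4 * \<delta> + l * \<rho>\<^sup>2 * ?\<tau> ^ 4"
      proof (cases "?\<tau> \<le> s")
        case True
        have "\<alpha> * ?\<tau> \<le> (1 / 2 * s ^ 3) * s"
          unfolding \<alpha>_def using True c s0 by (intro mult_mono) auto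
        also have "\<dots> = \<delta> / 2"
          by (simp add: s4[symmetric] power_numeral_reduce)
        finally have "5 / 4 * (\<alpha> * ?\<tau>) < 3 / 4 * \<delta>"
          using \<delta> by simp
        moreover have "0 \<le> l * \<rho>\<^sup>2 * ?\<tau> ^ 4"
          using l by simp
        ultimately show ?thesis by linarith
      next
        case False
        have "\<alpha> * ?\<tau> \<le> (l * \<rho>\<^sup>2 / 2 * ?\<tau> ^ 3) * ?\<tau>"
          unfolding \<alpha>_def using False c s0 by (intro mult_mono power_mono) auto
        also have "\<dots> = l * \<rho>\<^sup>2 * ?\<tau> ^ 4 / 2"
          by (simp add: power_numeral_reduce)
        finally have "\<alpha> * ?\<tau> \<le> l * \<rho>\<^sup>2 * ?\<tau> ^ 4 / 2" .
        moreover have "0 \<le> l * \<rho>\<^sup>2 * ?\<tau> ^ 4"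
          using l by simp
        ultimately show ?thesis
          using \<delta> by linarith
      qed
      show "cmod ?w / 4 < Re ?w + l * (cmod (of_real \<rho> * t\<^sup>2))\<^sup>2"
        unfolding l4 using w1 w2 key by linarith
    qed
    have deriv: "deriv (\<lambda>t. \<phi> t $ i) 0 = of_real \<alpha> * \<kappa> * N $ i" for i
      unfolding \<phi>_i by (rule DERIV_imp_deriv) (auto intro!: derivative_eq_intros)
    have "kobayashi_metric \<Omega> (P + \<delta> *\<^sub>R N) (\<kappa> *s N) \<le> ereal (1 / \<alpha>)"
      unfolding kobayashi_metric_def
    proof (rule INF_lower, intro CollectI conjI exI)
      show "0 < 1 / \<alpha>"
        using \<alpha> by simp
      show "\<phi> ` ball 0 1 \<subseteq> \<Omega>"
        using mem by auto
      show "\<forall>i. (\<lambda>z. \<phi> z $ i) holomorphic_on ball 0 1"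
        unfolding \<phi>_i by (intro allI holomorphic_intros)
      show "\<phi> 0 = P + \<delta> *\<^sub>R N"
        by (simp add: \<phi>_def point_0)
      show "(\<chi> i. deriv (\<lambda>z. \<phi> z $ i) 0) = (1 / (1 / \<alpha>)) *\<^sub>R (\<kappa> *s N)"
        by (simp add: vec_eq_iff deriv scaleR_conv_of_real[where 'a = complex])
    qed
    also have "1 / \<alpha> = 1 / c * (1 / \<delta> powr (3 / 4))"
      using \<delta> by (simp add: \<alpha>_def s_def root_powr_3_4)
    finally show ?thesis .
  qed
  show ?thesis
  proof (rule that[of "1 / c"])
    have "0 < min 1 ((\<rho> / 2) ^ 4)"
      using \<rho> by simp
    from eventually_at_right_real[OF this]
    show "\<forall>\<^sub>F \<delta> in at_right 0. kobayashi_metric \<Omega> (P + \<delta> *\<^sub>R N) (\<kappa> *s N) \<le> ereal (1 / c * (1 / \<delta> powr (3 / 4)))"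
      by eventually_elim (rule main, auto)
  qed
qed

lemma has_derivative_point_fst: "((\<lambda>w. point w \<zeta>) has_derivative (\<lambda>h. h *s N)) (at w)"
  unfolding point_def by (auto intro!: derivative_eq_intros)

lemma has_derivative_point_snd:
  "((\<lambda>\<zeta>. point w \<zeta>) has_derivative (\<lambda>h. h *s ((2 * a * \<zeta>) *s N + T))) (at \<zeta>)"
  unfolding point_def
  by (auto intro!: derivative_eq_intros simp: vec_eq_iff algebra_simps fun_eq_iff)

lemma caratheodory_upper:
  assumes \<Omega>: "open \<Omega>" and \<kappa>: "cmod \<kappa> = 1"
  obtains C where
    "\<forall>\<^sub>F \<delta> in at_right 0. caratheodory_metric \<Omega> (P + \<delta> *\<^sub>R N) (\<kappa> *s N) \<le> ereal C"
proof -
  \<comment> \<open>\<open>2 * R \<le> \<rho>\<close> keeps \<open>w\<close> in the model, and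
    \<open>2 * R \<le> l * \<rho>\<^sup>2 / 2\<close> makes the gain on the rim
    \<open>|\<zeta>| = \<rho>\<close> exceed \<open>5 / 4 * |w|\<close>. The factor 2 leaves room
    for a disc of radius \<open>R\<close> about a centre \<open>\<delta> < R\<close>.\<close>
  define R where "R = min \<rho> (l * \<rho>\<^sup>2 / 2) / 2"
  have R: "R > 0" "2 * R \<le> \<rho>" "2 * R \<le> l * \<rho>\<^sup>2 / 2"
    using l \<rho> by (auto simp: R_def)
  have main: "cmod (\<Sum>i\<in>UNIV. dz i f (P + \<delta> *\<^sub>R N) * (\<kappa> *s N) $ i) \<le> 4 / R"
    if \<delta>: "0 < \<delta>" "\<delta> < R" and f: "holomorphic_fun_on f \<Omega>" "f ` \<Omega> \<subseteq> ball 0 1" for \<delta> f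
  proof -
    have mem1: "point (of_real x) \<zeta> \<in> \<Omega>" if "0 < x" "x < 2 * R" "cmod \<zeta> \<le> \<rho>" for x \<zeta>
    proof (rule point_mem)
      have "0 \<le> l * (cmod \<zeta>)\<^sup>2"
        using l by simp
      then show "cmod (of_real x) / 4 < Re (of_real x) + l * (cmod \<zeta>)\<^sup>2"
        using that(1) by simp
    qed (use that R in auto)
    have mem2: "point w \<zeta> \<in> \<Omega>" if "cmod w < 2 * R" "cmod \<zeta> = \<rho>" for w \<zeta>
    proof (rule point_mem)
      have "0 < l * \<rho>\<^sup>2"
        using l \<rho> by simp
      then show "cmod w / 4 < Re w + l * (cmod \<zeta>)\<^sup>2"
        using that R abs_Re_le_cmod[of w] by simp
    qed (use that R in auto)
    have quot: "cmod (f (point (of_real (\<delta> + s)) 0) - f (point (of_real \<delta>) 0)) \<le> 4 / R * s"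
      if s: "0 < s" "s < R" for s
    proof -
      define H where "H \<zeta> = f (point (of_real (\<delta> + s)) \<zeta>) - f (point (of_real \<delta>) \<zeta>)" for \<zeta>
      define W where "W = {\<zeta>. point (of_real (\<delta> + s)) \<zeta> \<in> \<Omega>} \<inter> {\<zeta>. point (of_real \<delta>) \<zeta> \<in> \<Omega>}"
      have open_W: "open {\<zeta>. point w \<zeta> \<in> \<Omega>}" for w
      proof -
        have "continuous_on UNIV (point w)"
          by (rule has_derivative_continuous_on) (rule has_derivative_at_withinI[OF has_derivative_point_snd])
        then show ?thesis
          using \<Omega> by (simp add: continuous_on_open_vimage vimage_def)
      qed
      have hol: "(\<lambda>\<zeta>. f (point w \<zeta>)) holomorphic_on {\<zeta>. point w \<zeta> \<in> \<Omega>}" for w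
        by (rule holomorphic_fun_on_compose[OF f(1) open_W has_derivative_point_snd]) simp
      have HW: "H holomorphic_on W"
        unfolding H_def W_def by (intro holomorphic_intros holomorphic_on_subset[OF hol]) auto
      have sub: "cball 0 \<rho> \<subseteq> W"
        using s \<delta> mem1[of "\<delta> + s"] mem1[of \<delta>] by (auto simp: W_def)
      have "cmod (H 0) \<le> 4 / R * s"
      proof (rule maximum_modulus_frontier[where S = "cball (0::complex) \<rho>" and f = H])
        show "H holomorphic_on interior (cball (0::complex) \<rho>)"
          using HW sub interior_subset by (meson holomorphic_on_subset order_trans)
        show "continuous_on (closure (cball (0::complex) \<rho>)) H"
          using holomorphic_on_imp_continuous_on[OF HW] sub by (auto intro: continuous_on_subset)
        fix \<zeta> assume "\<zeta> \<in> frontier (cball (0::complex) \<rho>)"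
        then have \<zeta>: "cmod \<zeta> = \<rho>"
          using \<rho> by simp
        define g where "g w = f (point (of_real \<delta> + w) \<zeta>)" for w
        have in_\<Omega>: "point (of_real \<delta> + w) \<zeta> \<in> \<Omega>" if "w \<in> ball 0 R" for w
        proof (rule mem2[OF _ \<zeta>])
          show "cmod (of_real \<delta> + w) < 2 * R"
            using that \<delta> norm_triangle_ineq[of "of_real \<delta>" w] by simp
        qed
        have "cmod (g (of_real s) - g 0) \<le> 4 * 1 * cmod (of_real s) / R"
        proof (rule schwarz_bound)
          have "((\<lambda>w. point (of_real \<delta> + w) \<zeta>) has_derivative (\<lambda>h. h *s N)) (at w)" for w
            by (rule has_derivative_compose[OF _ has_derivative_point_fst, of "\<lambda>w. of_real \<delta> + w" "\<lambda>h. h"])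
              (auto intro!: derivative_eq_intros)
          then show "g holomorphic_on ball 0 R"
            unfolding g_def using in_\<Omega>
            by (intro holomorphic_fun_on_compose[OF f(1), of _ _ "\<lambda>_. N"]) auto
          fix t :: complex assume "t \<in> ball 0 R"
          then show "cmod (g t) \<le> 1"
            using in_\<Omega>[of t] f(2) by (force simp: g_def)
        qed (use R s in auto)
        then show "cmod (H \<zeta>) \<le> 4 / R * s"
          using s by (simp add: g_def H_def)
      qed (use \<rho> in auto)
      then show ?thesis
        by (simp add: H_def)
    qed
    have "point (of_real \<delta>) 0 \<in> \<Omega>"
      using \<delta> R \<rho> by (intro mem1) auto
    then obtain D where D: "(f has_derivative D) (at (P + \<delta> *\<^sub>R N))" "\<And>c v. D (c *s v) = c * D v"
      using f(1) by (auto simp: holomorphic_fun_on_def point_0)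
    have der: "((\<lambda>s. f (P + \<delta> *\<^sub>R N + s *\<^sub>R N)) has_derivative (\<lambda>s. D (s *\<^sub>R N))) (at 0)"
      by (rule has_derivative_compose[of "\<lambda>s. P + \<delta> *\<^sub>R N + s *\<^sub>R N"])
         (use D(1) in \<open>auto intro!: derivative_eq_intros\<close>)
    have pt: "point (of_real (\<delta> + s)) 0 = P + \<delta> *\<^sub>R N + s *\<^sub>R N" for s
      unfolding point_0 by (simp add: scaleR_add_left)
    have "cmod (D N) \<le> 4 / R + e" if "e > 0" for e
    proof -
      obtain d where d: "d > 0" "\<And>s. \<bar>s\<bar> < d \<Longrightarrow>
          cmod (f (P + \<delta> *\<^sub>R N + s *\<^sub>R N) - f (P + \<delta> *\<^sub>R N) - D (s *\<^sub>R N)) \<le> e * \<bar>s\<bar>"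
        using der \<open>e > 0\<close> unfolding has_derivative_at_alt by force
      define s where "s = min d R / 2"
      have s: "0 < s" "s < d" "s < R"
        using d(1) R(1) by (auto simp: s_def)
      have "cmod (f (P + \<delta> *\<^sub>R N + s *\<^sub>R N) - f (P + \<delta> *\<^sub>R N)) \<le> 4 / R * s"
        using quot[of s] s unfolding pt unfolding point_0 by simp
      moreover have "cmod (f (P + \<delta> *\<^sub>R N + s *\<^sub>R N) - f (P + \<delta> *\<^sub>R N) - D (s *\<^sub>R N)) \<le> e * s"
        using d(2)[of s] s by simp
      ultimately have "cmod (D (s *\<^sub>R N)) \<le> 4 / R * s + e * s"
        using norm_triangle_sub[of "D (s *\<^sub>R N)" "f (P + \<delta> *\<^sub>R N + s *\<^sub>R N) - f (P + \<delta> *\<^sub>R N)"]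
        by (simp add: norm_minus_commute)
      moreover have "cmod (D (s *\<^sub>R N)) = cmod (D N) * s"
        using s by (simp add: scaleR_eq_smult D(2) norm_mult)
      ultimately have "cmod (D N) * s \<le> (4 / R + e) * s"
        by (simp only: distrib_right)
      then show ?thesis
        using s(1) by (simp only: mult_le_cancel_right_pos)
    qed
    then have "cmod (D N) \<le> 4 / R"
      by (rule field_le_epsilon)
    then show ?thesis
      using sum_dz_holomorphic[OF D, of "\<kappa> *s N"] \<kappa> by (simp add: D(2) norm_mult)
  qed
  show ?thesis
  proof (rule that[of "4 / R"])
    show "\<forall>\<^sub>F \<delta> in at_right 0. caratheodory_metric \<Omega> (P + \<delta> *\<^sub>R N) (\<kappa> *s N) \<le> ereal (4 / R)"
      using eventually_at_right_real[OF R(1)]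
    proof eventually_elim
      case (elim \<delta>)
      then show ?case
        unfolding caratheodory_metric_def using main[of \<delta>] by (intro SUP_least) auto
    qed
  qed
qed

end

text \<open>The candidate is the affine function \<open>herm_inner (z - p) \<nu> / B\<close>, whose
  derivative along \<open>\<nu>\<close> is \<open>1 / B\<close>. The summands \<open>norm N\<close>
  and 1 in \<open>B\<close> cover all base points with \<open>\<delta> < 1\<close> and make the
  values lie strictly inside the disc.\<close>

lemma caratheodory_lower:
  fixes \<Omega> :: "(complex ^ 'n::finite) set"
  assumes "bounded \<Omega>" "norm \<nu> = 1"
  obtains c where "c > 0" "\<forall>\<^sub>F \<delta> in at_right 0. ereal c \<le> caratheodory_metric \<Omega> (P + \<delta> *\<^sub>R N) \<nu>"
proof -
  obtain B0 where B0: "\<And>z. z \<in> \<Omega> \<Longrightarrow> norm z \<le> B0"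
    using assms(1) unfolding bounded_iff by blast
  define B where "B = \<bar>B0\<bar> + norm P + norm N + 1"
  have B: "B > 0"
    by (simp add: B_def add_nonneg_pos)
  show ?thesis
  proof (rule that[of "1 / B"])
    show "1 / B > 0"
      using B by simp
    show "\<forall>\<^sub>F \<delta> in at_right 0. ereal (1 / B) \<le> caratheodory_metric \<Omega> (P + \<delta> *\<^sub>R N) \<nu>"
      using eventually_at_right_real[OF zero_less_one]
    proof eventually_elim
      case (elim \<delta>)
      let ?p = "P + \<delta> *\<^sub>R N"
      define f where "f z = herm_inner (z - ?p) \<nu> / of_real B" for z
      define D where "D v = herm_inner v \<nu> / of_real B" for v
      have D: "(f has_derivative D) (at z)" for z
      proof -
        have "((\<lambda>z. z - ?p) has_derivative (\<lambda>v. v)) (at z)"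
          by (auto intro!: derivative_eq_intros)
        from bounded_linear.has_derivative[OF bounded_linear_divide has_derivative_herm_inner[OF this]]
        show ?thesis
          by (simp add: f_def[abs_def] D_def[abs_def])
      qed
      have hom: "D (c *s v) = c * D v" for c v
        by (simp add: D_def herm_inner_scale_left)
      have "f z \<in> ball 0 1" if "z \<in> \<Omega>" for z
      proof -
        have "norm (\<delta> *\<^sub>R N) \<le> norm N"
          using elim by (simp add: mult_left_le_one_le)
        then have "norm ?p \<le> norm P + norm N"
          using norm_triangle_ineq[of P "\<delta> *\<^sub>R N"] by linarith
        then have "norm (z - ?p) < B"
          using B0[OF that] norm_triangle_ineq4[of z ?p] by (simp add: B_def)
        moreover have "cmod (herm_inner (z - ?p) \<nu>) \<le> norm (z - ?p)"
          using norm_herm_inner_le[of "z - ?p" \<nu>] assms(2) by simp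
        ultimately have "cmod (herm_inner (z - ?p) \<nu>) < B"
          by linarith
        then show ?thesis
          using B by (simp add: f_def norm_divide)
      qed
      then have "f \<in> {f. holomorphic_fun_on f \<Omega> \<and> f ` \<Omega> \<subseteq> ball 0 1 \<and> f ?p = 0}"
        using D hom by (auto simp: holomorphic_fun_on_def f_def)
      moreover have "cmod (\<Sum>i\<in>UNIV. dz i f ?p * \<nu> $ i) = 1 / B"
        unfolding sum_dz_holomorphic[OF D hom] using assms(2) B
        by (simp add: D_def herm_inner_self norm_divide)
      ultimately show ?case
        unfolding caratheodory_metric_def by (intro SUP_upper2[of f]) auto
    qed
  qed
qed

section \<open>Outer estimates and the Kobayashi lower bound\<close>

lemma norm_vec_le_sum: "norm (x :: complex ^ 'n::finite) \<le> (\<Sum>i\<in>UNIV. cmod (x $ i))"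
  unfolding norm_vec_def by (rule L2_set_le_sum) simp

text \<open>The factor \<open>1 / (1 + M \<omega>)\<close> maps the exterior of the disc
  \<open>Re \<omega> + M |\<omega>|\<^sup>2 < 0\<close> to a half plane.\<close>

lemma Re_divide_moebius:
  assumes "0 < Re \<omega> + M * ((cmod \<omega>)\<^sup>2 + y)" "M > 0" "y \<ge> 0" "M * cmod \<omega> \<le> 1 / 2"
  shows "Re (\<omega> / (1 + of_real M * \<omega>)) > - 4 * M * y"
    and "1 + of_real M * \<omega> \<noteq> 0"
proof -
  let ?d = "1 + of_real M * \<omega>"
  have "1 / 2 \<le> cmod ?d"
    using norm_triangle_ineq4[of ?d "of_real M * \<omega>"] assms(2,4) by (simp add: norm_mult)
  then have d: "1 / 4 \<le> (cmod ?d)\<^sup>2" and "?d \<noteq> 0"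
    using power_mono[of "1 / 2" "cmod ?d" 2] by (auto simp: power2_eq_square)
  show "?d \<noteq> 0" by fact
  have "Re (\<omega> / ?d) = (Re \<omega> + M * (cmod \<omega>)\<^sup>2) / (cmod ?d)\<^sup>2"
    unfolding Re_divide cmod_power2 by (simp add: power2_eq_square algebra_simps)
  then have "Re (\<omega> / ?d) * (cmod ?d)\<^sup>2 = Re \<omega> + M * (cmod \<omega>)\<^sup>2"
    using \<open>?d \<noteq> 0\<close> by simp
  moreover have "M * y \<le> 4 * M * y * (cmod ?d)\<^sup>2"
    using mult_left_mono[OF d, of "4 * M * y"] assms(2,3) by simp
  ultimately have "0 < (Re (\<omega> / ?d) + 4 * M * y) * (cmod ?d)\<^sup>2"
    using assms(1) by (simp add: algebra_simps)
  then have "0 < Re (\<omega> / ?d) + 4 * M * y"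
    using d by (simp add: zero_less_mult_iff)
  then show "Re (\<omega> / ?d) > - 4 * M * y"
    by simp
qed

text \<open>Since the tangential part \<open>v\<close> vanishes to second order, it contributes at
  most a constant times \<open>s^4\<close> to the outer bound on \<open>|t| < s\<close>. The choice
  \<open>s^4 = \<delta>\<close> makes this error comparable to \<open>Re (h 0)\<close>, and the
  half-plane estimate divides the resulting multiple of \<open>\<delta>\<close> by the radius
  \<open>s\<close>, which leaves \<open>s^3\<close>.\<close>

lemma kobayashi_lower:
  fixes \<Omega> :: "(complex ^ 'n::finite) set"
  assumes "bounded \<Omega>" and N1: "norm N = 1" and \<kappa>: "cmod \<kappa> = 1" and MR: "M > 0" "R > 0"
    and outer: "\<And>v. norm v < R \<Longrightarrow> P + v \<in> \<Omega> \<Longrightarrow> 0 < N \<bullet> v + M * (norm v)\<^sup>2"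
  obtains c where "c > 0"
    "\<forall>\<^sub>F \<delta> in at_right 0. ereal (c * (1 / \<delta> powr (3 / 4))) \<le> kobayashi_metric \<Omega> (P + \<delta> *\<^sub>R N) (\<kappa> *s N)"
proof -
  obtain B0 where B0: "\<And>z. z \<in> \<Omega> \<Longrightarrow> norm z \<le> B0"
    using assms(1) unfolding bounded_iff by blast
  define B where "B = \<bar>B0\<bar> + norm P + 1"
  have B: "B > 0"
    by (simp add: B_def add_nonneg_pos)
  have B_le: "norm (z - P) \<le> B" if "z \<in> \<Omega>" for z
    using B0[OF that] norm_triangle_ineq4[of z P] by (simp add: B_def)
  \<comment> \<open>Sum over the coordinates of the second-order Schwarz bound
    \<open>16 * (2 * B)\<close>.\<close>
  define C1 where "C1 = real CARD('n) * (32 * B)"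
  have C1: "C1 \<ge> 0"
    using B by (simp add: C1_def)
  define K where "K = 1 + 4 * B + C1"
  have K: "K > 0"
    using B C1 by (simp add: K_def)
  \<comment> \<open>The factor 8 is the 2 of the half-plane estimate times
    \<open>(1 + M * \<delta>)\<^sup>2 \<le> 4\<close>, which comes from the derivative of the
    Moebius map at \<open>\<delta>\<close>.\<close>
  define C2 where "C2 = 8 * (1 + 4 * M * C1\<^sup>2)"
  have C2: "C2 > 0"
    using MR(1) by (simp add: C2_def add_pos_nonneg)
  \<comment> \<open>The bounds give \<open>s < 1\<close>, keep \<open>\<phi> t - P\<close> shorter
    than \<open>R\<close>, and ensure \<open>M * cmod (\<omega> t) \<le> 1 / 2\<close>; the last two
    rest on the size \<open>K * s\<close> of the disc.\<close>
  define s0 where "s0 = Min {1 / 2, R / (2 * K), 1 / (2 * M * K)}"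
  have s0: "s0 > 0" "s0 \<le> 1 / 2" "s0 \<le> R / (2 * K)" "s0 \<le> 1 / (2 * M * K)"
    using K MR by (simp_all add: s0_def)
  have main: "1 / C2 * (1 / \<delta> powr (3 / 4)) \<le> \<alpha>"
    if \<delta>: "0 < \<delta>" "\<delta> < s0 ^ 4" and \<alpha>: "\<alpha> > 0" and \<phi>: "\<phi> ` ball 0 1 \<subseteq> \<Omega>" "\<And>i. (\<lambda>z. \<phi> z $ i) holomorphic_on ball 0 1"
      "\<phi> 0 = P + \<delta> *\<^sub>R N" "(\<chi> i. deriv (\<lambda>z. \<phi> z $ i) 0) = (1 / \<alpha>) *\<^sub>R (\<kappa> *s N)"
    for \<delta> \<alpha> and \<phi> :: "complex \<Rightarrow> complex ^ 'n"
  proof -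
    define s where "s = root 4 \<delta>"
    have s4: "s ^ 4 = \<delta>" and s: "s > 0"
      using \<delta> by (simp_all add: s_def)
    have s_le: "s \<le> s0"
      using \<delta> s0 s s4 by (intro power_le_imp_le_base[of s 3]) auto
    have s1: "s < 1"
      using s_le s0 by linarith
    define \<omega> where "\<omega> t = herm_inner (\<phi> t - P) N" for t
    define v where "v t = \<phi> t - P - \<omega> t *s N" for t
    have NN: "herm_inner N N = 1"
      using N1 by (simp add: herm_inner_self)
    have \<phi>0: "\<phi> 0 - P = of_real \<delta> *s N"
      using \<phi>(3) by (simp add: scaleR_eq_smult)
    have \<omega>0: "\<omega> 0 = of_real \<delta>"
      unfolding \<omega>_def \<phi>0 herm_inner_scale_left NN by simp
    have v0: "v 0 = 0"
      unfolding v_def \<phi>0 \<omega>0 by simp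
    have d\<phi>: "((\<lambda>z. \<phi> z $ i) has_field_derivative (of_real (1 / \<alpha>) * \<kappa> * N $ i)) (at 0)" for i
    proof -
      have "deriv (\<lambda>z. \<phi> z $ i) 0 = ((1 / \<alpha>) *\<^sub>R (\<kappa> *s N)) $ i"
        using \<phi>(4) by (metis vec_lambda_beta)
      also have "\<dots> = of_real (1 / \<alpha>) * \<kappa> * N $ i"
        by (simp add: scaleR_conv_of_real[where 'a = complex])
      finally show ?thesis
        using holomorphic_derivI[OF \<phi>(2)[of i], of 0] by simp
    qed
    have \<omega>_sum: "\<omega> = (\<lambda>t. \<Sum>i\<in>UNIV. (\<phi> t $ i - P $ i) * cnj (N $ i))"
      by (simp add: \<omega>_def herm_inner_def fun_eq_iff)
    have hol\<omega>: "\<omega> holomorphic_on ball 0 1"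
      unfolding \<omega>_sum by (intro holomorphic_intros \<phi>(2))
    have d\<omega>: "(\<omega> has_field_derivative (of_real (1 / \<alpha>) * \<kappa>)) (at 0)"
    proof -
      have "(\<omega> has_field_derivative (\<Sum>i\<in>UNIV. of_real (1 / \<alpha>) * \<kappa> * N $ i * cnj (N $ i))) (at 0)"
        unfolding \<omega>_sum by (rule DERIV_sum) (auto intro!: derivative_eq_intros d\<phi>)
      also have "(\<Sum>i\<in>UNIV. of_real (1 / \<alpha>) * \<kappa> * N $ i * cnj (N $ i)) = of_real (1 / \<alpha>) * \<kappa> * herm_inner N N"
        by (simp add: herm_inner_def sum_distrib_left mult_ac)
      finally show ?thesis
        by (simp add: NN)
    qed
    have \<phi>_in: "\<phi> t \<in> \<Omega>" if "t \<in> ball 0 1" for t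
      using \<phi>(1) that by blast
    have \<omega>_le: "cmod (\<omega> t) \<le> B" if "t \<in> ball 0 1" for t
      using norm_herm_inner_le[of "\<phi> t - P" N] B_le[OF \<phi>_in[OF that]] N1 by (simp add: \<omega>_def)
    have v_le: "norm (v t) \<le> C1 * (cmod t)\<^sup>2" if t: "t \<in> ball 0 1" for t
    proof -
      have "cmod (v t $ i) \<le> 16 * (2 * B) * (cmod t)\<^sup>2" for i
      proof (rule schwarz_bound_second_order[of "\<lambda>t. v t $ i"])
        have vi: "(\<lambda>t. v t $ i) = (\<lambda>t. \<phi> t $ i - P $ i - \<omega> t * N $ i)"
          by (simp add: v_def fun_eq_iff)
        show "(\<lambda>t. v t $ i) holomorphic_on ball 0 1"
          unfolding vi by (intro holomorphic_intros \<phi>(2) hol\<omega>)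
        show "deriv (\<lambda>t. v t $ i) 0 = 0"
          unfolding vi by (rule DERIV_imp_deriv) (auto intro!: derivative_eq_intros d\<phi> d\<omega>)
        show "v 0 $ i = 0"
          by (simp add: v0)
        fix t :: complex assume t: "t \<in> ball 0 1"
        have "cmod (v t $ i) \<le> norm (v t)"
          by (rule Finite_Cartesian_Product.norm_nth_le)
        also have "\<dots> \<le> norm (\<phi> t - P) + norm (\<omega> t *s N)"
          unfolding v_def by (rule norm_triangle_ineq4)
        also have "\<dots> \<le> B + B"
          using B_le[OF \<phi>_in[OF t]] \<omega>_le[OF t] N1 by (intro add_mono) (simp_all add: norm_smult_vec)
        finally show "cmod (v t $ i) \<le> 2 * B"
          by simp
      qed (use B t in auto)
      then have "(\<Sum>i\<in>UNIV. cmod (v t $ i)) \<le> (\<Sum>i\<in>(UNIV::'n set). 16 * (2 * B) * (cmod t)\<^sup>2)"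
        by (intro sum_mono)
      also have "\<dots> = C1 * (cmod t)\<^sup>2"
        by (simp add: C1_def)
      finally show ?thesis
        using norm_vec_le_sum[of "v t"] by linarith
    qed
    have \<omega>_le2: "cmod (\<omega> t) \<le> \<delta> + 4 * B * cmod t" if t: "t \<in> ball 0 1" for t
    proof -
      have "cmod (\<omega> t - \<omega> 0) \<le> 4 * B * cmod t / 1"
        using hol\<omega> _ B \<omega>_le t by (rule schwarz_bound) simp
      then show ?thesis
        using norm_triangle_sub[of "\<omega> t" "\<omega> 0"] \<delta> by (simp add: \<omega>0)
    qed
    define h where "h t = \<omega> t / (1 + of_real M * \<omega> t)" for t
    have key: "1 + of_real M * \<omega> t \<noteq> 0 \<and> Re (h t) > - (4 * M * C1\<^sup>2 * \<delta>)" if t: "t \<in> ball 0 s" for t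
    proof -
      have t1: "t \<in> ball 0 1" and ts: "cmod t \<le> s"
        using t s1 by auto
      have \<delta>s: "\<delta> \<le> s"
        using s s1 power_decreasing[of 1 4 s] by (simp add: s4)
      have "(cmod t)\<^sup>2 \<le> s\<^sup>2"
        using ts by (intro power_mono) auto
      moreover have "s\<^sup>2 \<le> s"
        using s s1 power_decreasing[of 1 2 s] by simp
      ultimately have vs: "norm (v t) \<le> C1 * s\<^sup>2" and "C1 * s\<^sup>2 \<le> C1 * s"
        using v_le[OF t1] C1 mult_left_mono[of "(cmod t)\<^sup>2" "s\<^sup>2" C1] mult_left_mono[of "s\<^sup>2" s C1] by linarith+
      have "4 * B * cmod t \<le> 4 * B * s"
        using ts B by (intro mult_left_mono) auto
      then have \<omega>s: "cmod (\<omega> t) \<le> (1 + 4 * B) * s"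
        using \<omega>_le2[OF t1] \<delta>s by (simp add: algebra_simps)
      have "\<phi> t - P = v t + \<omega> t *s N"
        by (simp add: v_def)
      then have "norm (\<phi> t - P) \<le> norm (v t) + cmod (\<omega> t)"
        using norm_triangle_ineq[of "v t" "\<omega> t *s N"] N1 by (simp add: norm_smult_vec)
      also have "\<dots> \<le> K * s"
        using vs \<open>C1 * s\<^sup>2 \<le> C1 * s\<close> \<omega>s by (simp add: K_def algebra_simps)
      also have "K * s \<le> K * (R / (2 * K))"
        using s_le s0 K by (intro mult_left_mono) auto
      also have "\<dots> < R"
        using K MR by simp
      finally have "norm (\<phi> t - P) < R" .
      then have "0 < N \<bullet> (\<phi> t - P) + M * (norm (\<phi> t - P))\<^sup>2"
        using \<phi>_in[OF t1] by (intro outer) auto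
      moreover have "N \<bullet> (\<phi> t - P) = Re (\<omega> t)"
        by (simp add: \<omega>_def Re_herm_inner inner_commute)
      moreover have "(norm (\<phi> t - P))\<^sup>2 = (cmod (\<omega> t))\<^sup>2 + (norm (v t))\<^sup>2"
        using norm_decomp[OF N1, of "\<phi> t - P"] by (simp add: \<omega>_def v_def)
      ultimately have pos: "0 < Re (\<omega> t) + M * ((cmod (\<omega> t))\<^sup>2 + (norm (v t))\<^sup>2)"
        by simp
      have "M * cmod (\<omega> t) \<le> M * (K * s)"
      proof (rule mult_left_mono)
        have "0 \<le> C1 * s"
          using C1 s by simp
        then show "cmod (\<omega> t) \<le> K * s"
          using \<omega>s by (simp add: K_def algebra_simps)
      qed (use MR in simp)
      also have "\<dots> \<le> M * (K * (1 / (2 * M * K)))"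
        using s_le s0 K MR by (intro mult_left_mono) auto
      also have "\<dots> = 1 / 2"
        using K MR by simp
      finally have small: "M * cmod (\<omega> t) \<le> 1 / 2" .
      have "(norm (v t))\<^sup>2 \<le> (C1 * s\<^sup>2)\<^sup>2"
        using vs by (intro power_mono) auto
      also have "\<dots> = C1\<^sup>2 * \<delta>"
        by (simp add: s4[symmetric] power_mult_distrib power_mult[symmetric])
      finally have "4 * M * (norm (v t))\<^sup>2 \<le> 4 * M * (C1\<^sup>2 * \<delta>)"
        using MR by (intro mult_left_mono) auto
      then show ?thesis
        using Re_divide_moebius[OF pos MR(1) _ small] by (simp add: h_def)
    qed
    define k where "k t = h t + of_real (4 * M * C1\<^sup>2 * \<delta>)" for t
    have "ball 0 s \<subseteq> ball (0::complex) 1"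
      using s1 by auto
    then have "k holomorphic_on ball 0 s"
      unfolding k_def h_def using key
      by (intro holomorphic_intros holomorphic_on_subset[OF hol\<omega>]) auto
    then have "cmod (deriv k 0) \<le> 2 * Re (k 0) / s"
    proof (rule half_plane_deriv_bound[OF _ s])
      fix t assume "t \<in> ball (0::complex) s"
      then show "Re (k t) > 0"
        using conjunct2[OF key[of t]] unfolding k_def plus_complex.sel Re_complex_of_real by linarith
    qed
    have M\<delta>: "M * \<delta> \<ge> 0"
      using MR \<delta> by simp
    have M\<delta>1: "M * \<delta> \<le> 1"
    proof -
      have "\<delta> \<le> s"
        using s s1 power_decreasing[of 1 4 s] by (simp add: s4)
      also have "s \<le> 1 / (2 * M * K)"
        using s_le s0 by simp
      also have "\<dots> \<le> 1 / (2 * M)"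
        using MR K B C1 by (intro divide_left_mono) (auto simp: K_def)
      finally show ?thesis
        using MR by (simp add: field_simps)
    qed
    have nz: "1 + of_real M * complex_of_real \<delta> \<noteq> 0"
      using key[of 0] s by (simp add: \<omega>0)
    have "(k has_field_derivative (of_real (1 / \<alpha>) * \<kappa> / (1 + of_real M * of_real \<delta>)\<^sup>2)) (at 0)"
    proof -
      have "(k has_field_derivative ((of_real (1 / \<alpha>) * \<kappa> * (1 + of_real M * \<omega> 0) - \<omega> 0 * (of_real M * (of_real (1 / \<alpha>) * \<kappa>)))
          / ((1 + of_real M * \<omega> 0) * (1 + of_real M * \<omega> 0)))) (at 0)"
        unfolding k_def h_def using nz
        by (auto intro!: derivative_eq_intros d\<omega> simp: \<omega>0)
      then show ?thesis
        by (simp add: \<omega>0 power2_eq_square algebra_simps)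
    qed
    then have "deriv k 0 = of_real (1 / \<alpha>) * \<kappa> / (of_real ((1 + M * \<delta>)\<^sup>2))"
      by (simp add: DERIV_imp_deriv)
    then have dk: "cmod (deriv k 0) = 1 / \<alpha> / (1 + M * \<delta>)\<^sup>2"
      using \<alpha> \<kappa> by (simp add: norm_mult norm_divide del: of_real_power of_real_add of_real_divide)
    have "h 0 = of_real (\<delta> / (1 + M * \<delta>))"
      by (simp add: h_def \<omega>0)
    then have "Re (k 0) = \<delta> / (1 + M * \<delta>) + 4 * M * C1\<^sup>2 * \<delta>"
      by (simp add: k_def del: of_real_divide)
    also have "\<delta> / (1 + M * \<delta>) \<le> \<delta> / 1"
      using M\<delta> \<delta> by (intro divide_left_mono) auto
    finally have "Re (k 0) \<le> (1 + 4 * M * C1\<^sup>2) * s ^ 4"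
      by (simp add: s4 algebra_simps)
    then have "2 * Re (k 0) / s \<le> 2 * ((1 + 4 * M * C1\<^sup>2) * s ^ 4) / s"
      using s by (intro divide_right_mono) auto
    also have "\<dots> = 2 * (1 + 4 * M * C1\<^sup>2) * s ^ 3"
      using s by (simp add: power_numeral_reduce)
    finally have "1 / \<alpha> / (1 + M * \<delta>)\<^sup>2 \<le> 2 * (1 + 4 * M * C1\<^sup>2) * s ^ 3"
      using \<open>cmod (deriv k 0) \<le> 2 * Re (k 0) / s\<close> unfolding dk by linarith
    then have "1 / \<alpha> \<le> 2 * (1 + 4 * M * C1\<^sup>2) * s ^ 3 * (1 + M * \<delta>)\<^sup>2"
      using M\<delta> by (subst (asm) pos_divide_le_eq) auto
    also have "(1 + M * \<delta>)\<^sup>2 \<le> 2\<^sup>2"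
      using M\<delta> M\<delta>1 by (intro power_mono) auto
    then have "2 * (1 + 4 * M * C1\<^sup>2) * s ^ 3 * (1 + M * \<delta>)\<^sup>2 \<le> 2 * (1 + 4 * M * C1\<^sup>2) * s ^ 3 * 2\<^sup>2"
      using s MR by (intro mult_left_mono) auto
    also have "\<dots> = C2 * s ^ 3"
      by (simp add: C2_def)
    finally have "1 / \<alpha> \<le> C2 * s ^ 3" .
    then have "1 / (C2 * s ^ 3) \<le> \<alpha>"
      using \<alpha> C2 s by (simp add: field_simps)
    then show ?thesis
      using \<delta> by (simp add: root_powr_3_4 s_def)
  qed
  show ?thesis
  proof (rule that[of "1 / C2"])
    show "1 / C2 > 0"
      using C2 by simp
    have "0 < s0 ^ 4"
      using s0 by simp
    from eventually_at_right_real[OF this]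
    show "\<forall>\<^sub>F \<delta> in at_right 0. ereal (1 / C2 * (1 / \<delta> powr (3 / 4))) \<le> kobayashi_metric \<Omega> (P + \<delta> *\<^sub>R N) (\<kappa> *s N)"
    proof eventually_elim
      case (elim \<delta>)
      show ?case
        unfolding kobayashi_metric_def
      proof (rule INF_greatest)
        fix \<alpha> :: real assume "\<alpha> \<in> {\<alpha>. 0 < \<alpha> \<and> (\<exists>\<phi>. \<phi> ` ball 0 1 \<subseteq> \<Omega> \<and>
          (\<forall>i. (\<lambda>z. \<phi> z $ i) holomorphic_on ball 0 1) \<and> \<phi> 0 = P + \<delta> *\<^sub>R N \<and>
          (\<chi> i. deriv (\<lambda>z. \<phi> z $ i) 0) = (1 / \<alpha>) *\<^sub>R (\<kappa> *s N))}"
        then obtain \<phi> :: "complex \<Rightarrow> complex ^ 'n" where "0 < \<alpha>" and \<phi>: "\<phi> ` ball 0 1 \<subseteq> \<Omega>" "\<forall>i. (\<lambda>z. \<phi> z $ i) holomorphic_on ball 0 1"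
          "\<phi> 0 = P + \<delta> *\<^sub>R N" "(\<chi> i. deriv (\<lambda>z. \<phi> z $ i) 0) = (1 / \<alpha>) *\<^sub>R (\<kappa> *s N)"
          by blast
        then show "ereal (1 / C2 * (1 / \<delta> powr (3 / 4))) \<le> ereal \<alpha>"
          using main[of \<delta> \<alpha> \<phi>] elim by simp
      qed
    qed
  qed
qed

section \<open>The Sibony metric\<close>

text \<open>Summation over the fourth roots of unity cancels the linear terms, the contribution of \<open>\<eta>\<close>
  and the pure second derivatives.\<close>

lemma complex_hessian_four_point:
  fixes u :: "complex ^ 'n::finite \<Rightarrow> real" and \<xi> \<eta> :: "complex ^ 'n"
  defines "\<phi> \<equiv> \<lambda>t. t *s \<xi> + t\<^sup>2 *s \<eta>"
  assumes V: "open V" "p \<in> V" "C2_on V u" and "e > 0"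
  obtains d where "d > 0"
    "\<And>s. 0 < s \<Longrightarrow> s < d \<Longrightarrow>
      \<bar>(\<Sum>c\<in>{1, - 1, \<i>, - \<i>}. u (p + \<phi> (c * of_real s))) - 4 * u p
        - 4 * s\<^sup>2 * Re (complex_hessian u p \<xi> \<xi>)\<bar> \<le> e * s\<^sup>2"
proof -
  obtain f' f'' where f': "\<And>y. y \<in> V \<Longrightarrow> (u has_derivative blinfun_apply (f' y)) (at y)"
    and f'': "\<And>y. y \<in> V \<Longrightarrow> (f' has_derivative blinfun_apply (f'' y)) (at y)"
    using V(3) unfolding C2_on_def by blast
  define Q where "Q = f'' p"
  define m where "m = norm \<xi> + norm \<eta> + 1"
  have m: "m > 0" "norm \<xi> \<le> m" "norm \<eta> \<le> m" "norm \<xi> + norm \<eta> \<le> m"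
    by (simp_all add: m_def add_nonneg_pos)
  \<comment> \<open>Each of the four points may contribute an error of
    \<open>e / 4 * s\<^sup>2\<close>: half of it is the Taylor error, half comes from the terms of
    \<open>Q\<close> that involve \<open>\<eta>\<close>. These are of order \<open>s^3\<close> and
    determine the last bound in \<open>d\<close>.\<close>
  define e' where "e' = e / (8 * m\<^sup>2)"
  have e': "e' > 0"
    using \<open>e > 0\<close> m by (simp add: e'_def)
  obtain d1 where d1: "d1 > 0" "\<And>v. norm v < d1 \<Longrightarrow> p + v \<in> V"
    "\<And>v. norm v < d1 \<Longrightarrow> \<bar>u (p + v) - u p - f' p v - f'' p v v / 2\<bar> \<le> e' * (norm v)\<^sup>2"
    by (rule taylor_second_order[OF V(1,2) f' f''[OF V(2)] e']) (assumption, rule that)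
  define d where "d = Min {1, d1 / m, e / (12 * (norm Q + 1) * m\<^sup>2)}"
  have d: "d > 0" "d \<le> 1" "d \<le> d1 / m" "d \<le> e / (12 * (norm Q + 1) * m\<^sup>2)"
    using d1(1) m \<open>e > 0\<close> by (simp_all add: d_def add_nonneg_pos)
  have H: "Re (complex_hessian u p \<xi> \<xi>) = (Q \<xi> \<xi> + Q (\<i> *s \<xi>) (\<i> *s \<xi>)) / 4"
    by (subst complex_hessian_eq[OF V(1,2) f' f''[OF V(2)]]) (simp_all add: Q_def)
  have each: "\<bar>u (p + \<phi> t) - u p - f' p (\<phi> t) - Q (t *s \<xi>) (t *s \<xi>) / 2\<bar> \<le> e / 4 * s\<^sup>2"
    if s: "0 < s" "s < d" and t: "cmod t = s" for s t
  proof -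
    have s1: "s \<le> 1"
      using s d by simp
    have s2: "s\<^sup>2 \<le> s"
      using s s1 power_decreasing[of 1 2 s] by simp
    have n1: "norm (t *s \<xi>) \<le> s * m"
      unfolding norm_smult_vec t using m s by (intro mult_left_mono) auto
    have n2: "norm (t\<^sup>2 *s \<eta>) \<le> s\<^sup>2 * m"
      unfolding norm_smult_vec norm_power t using m s by (intro mult_left_mono) auto
    have "norm (\<phi> t) \<le> s * norm \<xi> + s\<^sup>2 * norm \<eta>"
      unfolding \<phi>_def by (rule order_trans[OF norm_triangle_ineq]) (simp add: norm_smult_vec norm_power t)
    also have "\<dots> \<le> s * norm \<xi> + s * norm \<eta>"
      using s2 by (intro add_left_mono mult_right_mono) auto
    also have "\<dots> \<le> s * m"
      using m(4) s by (simp add: distrib_left[symmetric])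
    finally have n: "norm (\<phi> t) \<le> s * m" .
    also have "s * m < d1"
    proof -
      have "s * m < d * m"
        using s m(1) by simp
      also have "d * m \<le> d1"
        using d(3) m(1) by (simp add: pos_le_divide_eq)
      finally show ?thesis .
    qed
    finally have T: "\<bar>u (p + \<phi> t) - u p - f' p (\<phi> t) - Q (\<phi> t) (\<phi> t) / 2\<bar> \<le> e' * (norm (\<phi> t))\<^sup>2"
      using d1(3) by (simp add: Q_def)
    have "e' * (norm (\<phi> t))\<^sup>2 \<le> e' * (s * m)\<^sup>2"
      using n e' by (intro mult_left_mono power_mono) auto
    also have "\<dots> = e / 8 * s\<^sup>2"
      using m(1) by (simp add: e'_def power_mult_distrib)
    finally have T1: "e' * (norm (\<phi> t))\<^sup>2 \<le> e / 8 * s\<^sup>2" .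
    let ?x = "t *s \<xi>" and ?y = "t\<^sup>2 *s \<eta>"
    have "Q (\<phi> t) (\<phi> t) = Q ?x ?x + (Q ?x ?y + Q ?y ?x + Q ?y ?y)"
      by (simp add: \<phi>_def blinfun.add_left blinfun.add_right)
    moreover have "\<bar>Q ?x ?y\<bar> \<le> norm Q * (s * m) * (s\<^sup>2 * m)" "\<bar>Q ?y ?x\<bar> \<le> norm Q * (s\<^sup>2 * m) * (s * m)"
       "\<bar>Q ?y ?y\<bar> \<le> norm Q * (s * m) * (s\<^sup>2 * m)"
    proof -
      have n3: "norm ?y \<le> s * m"
        using n2 s2 m(1) mult_right_mono[of "s\<^sup>2" s m] by linarith
      show "\<bar>Q ?x ?y\<bar> \<le> norm Q * (s * m) * (s\<^sup>2 * m)" "\<bar>Q ?y ?x\<bar> \<le> norm Q * (s\<^sup>2 * m) * (s * m)"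
       "\<bar>Q ?y ?y\<bar> \<le> norm Q * (s * m) * (s\<^sup>2 * m)"
        using n1 n2 n3 s m
        by (auto intro!: order_trans[OF abs_blinfun2_le] mult_mono)
    qed
    moreover have "norm Q * (s\<^sup>2 * m) * (s * m) = norm Q * (s * m) * (s\<^sup>2 * m)"
      by simp
    ultimately have "\<bar>Q (\<phi> t) (\<phi> t) - Q ?x ?x\<bar> \<le> 3 * (norm Q * (s * m) * (s\<^sup>2 * m))"
      by linarith
    also have "\<dots> = 3 * norm Q * m\<^sup>2 * s * s\<^sup>2"
      by (simp add: power2_eq_square)
    also have "\<dots> \<le> e / 4 * s\<^sup>2"
    proof (rule mult_right_mono)
      have "3 * norm Q * m\<^sup>2 * s \<le> 3 * (norm Q + 1) * m\<^sup>2 * (e / (12 * (norm Q + 1) * m\<^sup>2))"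
        using s d by (intro mult_mono) auto
      also have "\<dots> = e / 4"
      proof -
        have *: "3 * q * x * (e / (12 * q * x)) = e / 4" if "q > 0" "x > 0" for q x :: real
          using that by simp
        show ?thesis
          by (rule *) (use m(1) in \<open>simp_all add: add_nonneg_pos\<close>)
      qed
      finally show "3 * norm Q * m\<^sup>2 * s \<le> e / 4" .
    qed simp
    finally show ?thesis
      using T T1 by linarith
  qed
  show ?thesis
  proof (rule that[of d])
    show "d > 0" by (rule d(1))
    fix s :: real assume s: "0 < s" "s < d"
    let ?t1 = "of_real s" and ?t2 = "- of_real s" and ?t3 = "\<i> * of_real s" and ?t4 = "- \<i> * of_real s"
    have "f' p (\<phi> ?t1) + f' p (\<phi> ?t2) + f' p (\<phi> ?t3) + f' p (\<phi> ?t4) = f' p (\<phi> ?t1 + \<phi> ?t2 + \<phi> ?t3 + \<phi> ?t4)"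
      by (simp only: blinfun.add_right)
    also have "\<phi> ?t1 + \<phi> ?t2 + \<phi> ?t3 + \<phi> ?t4 = 0"
      by (simp add: \<phi>_def vec_eq_iff power_mult_distrib)
    finally have lin: "f' p (\<phi> ?t1) + f' p (\<phi> ?t2) + f' p (\<phi> ?t3) + f' p (\<phi> ?t4) = 0"
      by (simp only: blinfun.zero_right)
    have t1: "?t1 *s \<xi> = s *\<^sub>R \<xi>" and t2: "?t2 *s \<xi> = - (s *\<^sub>R \<xi>)"
      and t3: "?t3 *s \<xi> = s *\<^sub>R (\<i> *s \<xi>)" and t4: "?t4 *s \<xi> = - (s *\<^sub>R (\<i> *s \<xi>))"
      by (simp_all add: vec_eq_iff scaleR_conv_of_real[where 'a = complex] mult_ac)
    have quad: "Q (?t1 *s \<xi>) (?t1 *s \<xi>) / 2 + Q (?t2 *s \<xi>) (?t2 *s \<xi>) / 2 + Q (?t3 *s \<xi>) (?t3 *s \<xi>) / 2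
        + Q (?t4 *s \<xi>) (?t4 *s \<xi>) / 2 = 4 * s\<^sup>2 * Re (complex_hessian u p \<xi> \<xi>)"
      unfolding H t1 t2 t3 t4
      by (simp add: blinfun.scaleR_left blinfun.scaleR_right blinfun.minus_left blinfun.minus_right
           power2_eq_square algebra_simps)
    have E1: "\<bar>u (p + \<phi> ?t1) - u p - f' p (\<phi> ?t1) - Q (?t1 *s \<xi>) (?t1 *s \<xi>) / 2\<bar> \<le> e / 4 * s\<^sup>2"
      by (rule each[OF s]) (use s in simp)
    have E2: "\<bar>u (p + \<phi> ?t2) - u p - f' p (\<phi> ?t2) - Q (?t2 *s \<xi>) (?t2 *s \<xi>) / 2\<bar> \<le> e / 4 * s\<^sup>2"
      by (rule each[OF s]) (use s in simp)
    have E3: "\<bar>u (p + \<phi> ?t3) - u p - f' p (\<phi> ?t3) - Q (?t3 *s \<xi>) (?t3 *s \<xi>) / 2\<bar> \<le> e / 4 * s\<^sup>2"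
      by (rule each[OF s]) (use s in \<open>simp add: norm_mult\<close>)
    have E4: "\<bar>u (p + \<phi> ?t4) - u p - f' p (\<phi> ?t4) - Q (?t4 *s \<xi>) (?t4 *s \<xi>) / 2\<bar> \<le> e / 4 * s\<^sup>2"
      by (rule each[OF s]) (use s in \<open>simp add: norm_mult\<close>)
    have "(\<Sum>c\<in>{1, - 1, \<i>, - \<i>}. u (p + \<phi> (c * of_real s)))
        = u (p + \<phi> ?t1) + u (p + \<phi> ?t2) + u (p + \<phi> ?t3) + u (p + \<phi> ?t4)"
      by (simp add: complex_eq_iff)
    then show "\<bar>(\<Sum>c\<in>{1, - 1, \<i>, - \<i>}. u (p + \<phi> (c * of_real s))) - 4 * u p
        - 4 * s\<^sup>2 * Re (complex_hessian u p \<xi> \<xi>)\<bar> \<le> e * s\<^sup>2"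
      using E1 E2 E3 E4 lin quad by linarith
  qed
qed

text \<open>The four-point sum does not see the quadratic coefficient \<open>\<eta>\<close>, so the
  Levi form in the direction \<open>\<xi>\<close> can be tested on a curved disc with that
  tangent.\<close>

lemma complex_hessian_le_on_parabola:
  fixes u :: "complex ^ 'n::finite \<Rightarrow> real"
  assumes V: "open V" "p \<in> V" "C2_on V u" and "u p = 0" "d0 > 0"
    and le: "\<And>t. cmod t < d0 \<Longrightarrow> u (p + (t *s \<xi> + t\<^sup>2 *s \<eta>)) \<le> K * (cmod t)\<^sup>2"
  shows "Re (complex_hessian u p \<xi> \<xi>) \<le> K"
proof (rule field_le_epsilon)
  fix e :: real assume e: "e > 0"
  let ?f = "\<lambda>s c. u (p + ((c * of_real s) *s \<xi> + (c * of_real s)\<^sup>2 *s \<eta>))"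
  obtain d where d: "d > 0" "\<And>s. 0 < s \<Longrightarrow> s < d \<Longrightarrow>
      \<bar>sum (?f s) {1, - 1, \<i>, - \<i>} - 4 * u p - 4 * s\<^sup>2 * Re (complex_hessian u p \<xi> \<xi>)\<bar> \<le> e * s\<^sup>2"
    by (rule complex_hessian_four_point[OF V e, of \<xi> \<eta>]) (rule that)
  define s where "s = min d d0 / 2"
  have s: "0 < s" "s < d" "s < d0"
    using d(1) \<open>d0 > 0\<close> by (auto simp: s_def)
  have "?f s c \<le> K * s\<^sup>2" if "c \<in> {1, - 1, \<i>, - \<i>}" for c
    using le[of "c * of_real s"] that s by (auto simp: norm_mult)
  then have "sum (?f s) {1, - 1, \<i>, - \<i>} \<le> (\<Sum>c\<in>{1, - 1, \<i>, - \<i>}. K * s\<^sup>2)"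
    by (rule sum_mono)
  also have "\<dots> = 4 * (K * s\<^sup>2)"
    by (simp add: complex_eq_iff)
  finally have "4 * s\<^sup>2 * Re (complex_hessian u p \<xi> \<xi>) \<le> 4 * (K * s\<^sup>2) + e * s\<^sup>2"
    using d(2)[OF s(1,2)] \<open>u p = 0\<close> by linarith
  then have "s\<^sup>2 * (4 * Re (complex_hessian u p \<xi> \<xi>)) \<le> s\<^sup>2 * (4 * K + e)"
    by (simp add: algebra_simps)
  then have "4 * Re (complex_hessian u p \<xi> \<xi>) \<le> 4 * K + e"
    using s(1) by (simp only: mult_le_cancel_left_pos zero_less_power)
  then show "Re (complex_hessian u p \<xi> \<xi>) \<le> K + e"
    using e by linarith
qed

lemma complex_hessian_ge_on_line:
  fixes u :: "complex ^ 'n::finite \<Rightarrow> real"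
  assumes V: "open V" "p \<in> V" "C2_on V u" and "u p = 0" "d0 > 0"
    and ge: "\<And>t. cmod t < d0 \<Longrightarrow> K * (cmod t)\<^sup>2 \<le> u (p + t *s \<xi>)"
  shows "K \<le> Re (complex_hessian u p \<xi> \<xi>)"
proof (rule field_le_epsilon)
  fix e :: real assume e: "e > 0"
  let ?f = "\<lambda>s c. u (p + ((c * of_real s) *s \<xi> + (c * of_real s)\<^sup>2 *s 0))"
  obtain d where d: "d > 0" "\<And>s. 0 < s \<Longrightarrow> s < d \<Longrightarrow>
      \<bar>sum (?f s) {1, - 1, \<i>, - \<i>} - 4 * u p - 4 * s\<^sup>2 * Re (complex_hessian u p \<xi> \<xi>)\<bar> \<le> e * s\<^sup>2"
    by (rule complex_hessian_four_point[OF V e, of \<xi> 0]) (rule that)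
  define s where "s = min d d0 / 2"
  have s: "0 < s" "s < d" "s < d0"
    using d(1) \<open>d0 > 0\<close> by (auto simp: s_def)
  have "K * s\<^sup>2 \<le> ?f s c" if "c \<in> {1, - 1, \<i>, - \<i>}" for c
    using ge[of "c * of_real s"] that s by (auto simp: norm_mult)
  then have "(\<Sum>c\<in>{1, - 1, \<i>, - \<i>}. K * s\<^sup>2) \<le> sum (?f s) {1, - 1, \<i>, - \<i>}"
    by (rule sum_mono)
  moreover have "(\<Sum>c\<in>{1, - 1, \<i>, - \<i>::complex}. K * s\<^sup>2) = 4 * (K * s\<^sup>2)"
    by (simp add: complex_eq_iff)
  ultimately have "4 * (K * s\<^sup>2) \<le> 4 * s\<^sup>2 * Re (complex_hessian u p \<xi> \<xi>) + e * s\<^sup>2"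
    using d(2)[OF s(1,2)] \<open>u p = 0\<close> by linarith
  then have "s\<^sup>2 * (4 * K) \<le> s\<^sup>2 * (4 * Re (complex_hessian u p \<xi> \<xi>) + e)"
    by (simp add: algebra_simps)
  then have "4 * K \<le> 4 * Re (complex_hessian u p \<xi> \<xi>) + e"
    using s(1) by (simp only: mult_le_cancel_left_pos zero_less_power)
  then show "K \<le> Re (complex_hessian u p \<xi> \<xi>) + e"
    using e by linarith
qed

lemma complex_hessian_parallelogram:
  "complex_hessian u p (x + y) (x + y) + complex_hessian u p (x - y) (x - y)
    = 2 * complex_hessian u p x x + 2 * complex_hessian u p y y"
  unfolding complex_hessian_def sum.distrib[symmetric] sum_distrib_left
  by (intro sum.cong refl) (simp add: algebra_simps)

lemma complex_hessian_scale:
  "complex_hessian u p (c *s x) (c *s x) = of_real ((cmod c)\<^sup>2) * complex_hessian u p x x"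
proof -
  have c: "of_real ((cmod c)\<^sup>2) = c * cnj c"
    using complex_norm_square[of c] by simp
  show ?thesis
    unfolding complex_hessian_def sum_distrib_left c
    by (intro sum.cong refl) (simp add: mult_ac)
qed

text \<open>\<open>p\<close> is a minimum of \<open>u\<close>, so the gradient vanishes there. The
  constants \<open>M\<close> and \<open>d\<close> may depend on \<open>u\<close>: they only control
  a competitor near the centre of a disc and do not survive in the Schwarz-type bound that uses
  them.\<close>

lemma quadratic_bound_at_minimum:
  fixes u :: "'a::real_normed_vector \<Rightarrow> real"
  assumes V: "open V" "p \<in> V" "C2_on V u" and "open \<Omega>" "p \<in> \<Omega>" "u p = 0"
    and nonneg: "\<And>z. z \<in> \<Omega> \<Longrightarrow> 0 \<le> u z"
  obtains M d where "M > 0" "d > 0" "\<And>v. norm v < d \<Longrightarrow> u (p + v) \<le> M * (norm v)\<^sup>2"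
proof -
  obtain f' f'' where f': "\<And>y. y \<in> V \<Longrightarrow> (u has_derivative blinfun_apply (f' y)) (at y)"
    and f'': "\<And>y. y \<in> V \<Longrightarrow> (f' has_derivative blinfun_apply (f'' y)) (at y)"
    using V(3) unfolding C2_on_def by blast
  have "blinfun_apply (f' p) = (\<lambda>v. 0)"
    by (rule differential_zero_maxmin[OF \<open>p \<in> \<Omega>\<close> \<open>open \<Omega>\<close> f'[OF V(2)]]) (use nonneg \<open>u p = 0\<close> in auto)
  then have f'0: "f' p v = 0" for v
    by simp
  obtain d1 where d1: "d1 > 0" "\<And>v. norm v < d1 \<Longrightarrow> p + v \<in> V"
    "\<And>v. norm v < d1 \<Longrightarrow> \<bar>u (p + v) - u p - f' p v - f'' p v v / 2\<bar> \<le> 1 * (norm v)\<^sup>2"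
    by (rule taylor_second_order[OF V(1,2) f' f''[OF V(2)] zero_less_one]) (assumption, rule that)
  show ?thesis
  proof (rule that[of "norm (f'' p) + 1" d1])
    fix v :: 'a assume v: "norm v < d1"
    have "\<bar>f'' p v v\<bar> \<le> norm (f'' p) * norm v * norm v"
      by (rule abs_blinfun2_le)
    also have "\<dots> = norm (f'' p) * (norm v)\<^sup>2"
      by (simp add: power2_eq_square)
    finally have "\<bar>f'' p v v\<bar> \<le> norm (f'' p) * (norm v)\<^sup>2" .
    moreover have "\<bar>u (p + v) - f'' p v v / 2\<bar> \<le> (norm v)\<^sup>2"
      using d1(3)[OF v] \<open>u p = 0\<close> by (simp add: f'0)
    ultimately have "u (p + v) \<le> norm (f'' p) * (norm v)\<^sup>2 + (norm v)\<^sup>2"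
      by linarith
    then show "u (p + v) \<le> (norm (f'' p) + 1) * (norm v)\<^sup>2"
      by (simp add: algebra_simps)
  qed (use d1(1) in \<open>simp_all add: add_nonneg_pos\<close>)
qed

text \<open>A competitor is merely upper semicontinuous away from its base point, so the penalized
  maximum needs this form. If every point of \<open>K\<close> had a larger value somewhere in
  \<open>K\<close>, finitely many neighbourhoods would cover \<open>K\<close>, and the largest of
  the finitely many chosen values would itself be exceeded.\<close>

lemma usc_attains_max:
  fixes f :: "'a::topological_space \<Rightarrow> real"
  assumes "compact K" "K \<noteq> {}"
    and usc: "\<And>z c. z \<in> K \<Longrightarrow> f z < c \<Longrightarrow> \<forall>\<^sub>F w in at z within K. f w < c"
  obtains x where "x \<in> K" "\<And>y. y \<in> K \<Longrightarrow> f y \<le> f x"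
proof (rule ccontr)
  assume not: "\<not> thesis"
  have "\<exists>y\<in>K. f x < f y" if "x \<in> K" for x
    using not that \<open>\<And>x. x \<in> K \<Longrightarrow> (\<And>y. y \<in> K \<Longrightarrow> f y \<le> f x) \<Longrightarrow> thesis\<close> by (meson not_le)
  then obtain g where g: "\<And>x. x \<in> K \<Longrightarrow> g x \<in> K \<and> f x < f (g x)"
    by metis
  have "\<exists>S. open S \<and> x \<in> S \<and> (\<forall>w\<in>S \<inter> K. f w < f (g x))" if x: "x \<in> K" for x
  proof -
    have "\<forall>\<^sub>F w in at x within K. f w < f (g x)"
      using usc g x by blast
    then obtain S where "open S" "x \<in> S" "\<forall>w\<in>S. w \<noteq> x \<longrightarrow> w \<in> K \<longrightarrow> f w < f (g x)"
      unfolding eventually_at_topological by blast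
    then show ?thesis
      using g[OF x] by (intro exI[of _ S]) auto
  qed
  then obtain S where S: "\<And>x. x \<in> K \<Longrightarrow> open (S x) \<and> x \<in> S x \<and> (\<forall>w\<in>S x \<inter> K. f w < f (g x))"
    by metis
  obtain D where D: "D \<subseteq> K" "finite D" "K \<subseteq> (\<Union>x\<in>D. S x)"
    by (rule compactE_image[OF \<open>compact K\<close>, of K S]) (use S in auto)
  have "D \<noteq> {}"
    using D \<open>K \<noteq> {}\<close> by auto
  define m where "m = Max ((\<lambda>x. f (g x)) ` D)"
  have "m \<in> (\<lambda>x. f (g x)) ` D"
    unfolding m_def using D \<open>D \<noteq> {}\<close> by (intro Max_in) auto
  then obtain x where x: "x \<in> D" "m = f (g x)"
    by blast
  then obtain y where y: "y \<in> D" "g x \<in> S y"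
    using D g by blast
  then have "f (g x) < f (g y)"
    using S[of y] D(1) g[of x] x(1) by blast
  moreover have "f (g y) \<le> m"
    unfolding m_def using D(2) y(1) by (intro Max_ge) auto
  ultimately show False
    using x(2) by simp
qed

text \<open>A function that is log-plurisubharmonic in the sense of complex lines obeys the Schwarz lemma
  on a parabola.  The penalty \<open>B |W|\<^sup>2\<close> localizes a maximum near the parabola; on the tangent line there
  \<open>W\<close> varies only by \<open>- a \<tau>\<^sup>2\<close>, so the mean of the penalty changes by \<open>O(s\<^sup>4)\<close>, which
  the term \<open>\<epsilon> |\<zeta>|\<^sup>2\<close> beats.\<close>

lemma quadratic_disc_bound:
  fixes u :: "complex ^ 'n::finite \<Rightarrow> real" and p b N :: "complex ^ 'n" and a :: complex
  defines "X \<equiv> \<lambda>W \<zeta>. p + \<zeta> *s b + (W + a * \<zeta>\<^sup>2) *s N"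
  assumes N1: "norm N = 1"
    and psh: "plurisubharmonic_on \<Omega> (\<lambda>z. ereal (u z))" "plurisubharmonic_on \<Omega> (\<lambda>z. ext_ln (u z))"
    and u0: "\<And>z. z \<in> \<Omega> \<Longrightarrow> 0 \<le> u z" and u1: "\<And>z. z \<in> \<Omega> \<Longrightarrow> u z \<le> 1"
    and mem: "\<And>W \<zeta>. cmod W \<le> \<eta> \<Longrightarrow> cmod \<zeta> \<le> \<rho> \<Longrightarrow> X W \<zeta> \<in> \<Omega>"
    and pos: "\<eta> > 0" "\<rho> > 0" "M > 0" "d > 0"
    and quad: "\<And>v. norm v < d \<Longrightarrow> u (p + v) \<le> M * (norm v)\<^sup>2"
    and \<zeta>0: "\<zeta>0 \<noteq> 0" "cmod \<zeta>0 < \<rho>"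
  shows "u (X 0 \<zeta>0) \<le> (cmod \<zeta>0)\<^sup>2 / \<rho>\<^sup>2"
proof (rule ccontr)
  assume "\<not> u (X 0 \<zeta>0) \<le> (cmod \<zeta>0)\<^sup>2 / \<rho>\<^sup>2"
  then have gt: "(cmod \<zeta>0)\<^sup>2 / \<rho>\<^sup>2 < u (X 0 \<zeta>0)"
    by simp
  have cz: "cmod \<zeta>0 > 0"
    using \<zeta>0 by simp
  then have u00: "u (X 0 \<zeta>0) > 0"
    using gt pos by (smt (verit) divide_pos_pos zero_less_power)
  define L where "L = ln \<rho> - ln (cmod \<zeta>0)"
  have L: "L > 0"
    using \<zeta>0 cz pos by (simp add: L_def)
  \<comment> \<open>The excess of \<open>ln u\<close> at \<open>\<zeta>0\<close> over the claimed
    bound, whose logarithm is \<open>- 2 * L\<close>.\<close>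
  define q where "q = ln (u (X 0 \<zeta>0)) + 2 * L"
  have "ln ((cmod \<zeta>0)\<^sup>2 / \<rho>\<^sup>2) < ln (u (X 0 \<zeta>0))"
    using gt u00 cz pos by simp
  moreover have "ln ((cmod \<zeta>0)\<^sup>2 / \<rho>\<^sup>2) = - 2 * L"
    using cz pos by (simp add: L_def ln_div ln_realpow)
  ultimately have q: "q > 0"
    by (simp add: q_def)
  \<comment> \<open>At \<open>\<zeta>0\<close> the weakened pole and the term in
    \<open>|\<zeta>|^2\<close> cost at most \<open>\<epsilon> * (L + \<rho>\<^sup>2)\<close>, which
    has to stay below the excess \<open>q\<close>.\<close>
  define \<epsilon> where "\<epsilon> = min 1 (q / (2 * (L + \<rho>\<^sup>2)))"
  have L\<rho>: "L + \<rho>\<^sup>2 > 0"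
    using L pos by (simp add: add_pos_pos)
  have \<epsilon>: "\<epsilon> > 0" "\<epsilon> \<le> 1" "\<epsilon> * (L + \<rho>\<^sup>2) < q"
  proof -
    show "\<epsilon> > 0" "\<epsilon> \<le> 1"
      using q L\<rho> by (auto simp: \<epsilon>_def)
    have "\<epsilon> * (L + \<rho>\<^sup>2) \<le> q / (2 * (L + \<rho>\<^sup>2)) * (L + \<rho>\<^sup>2)"
      using L\<rho> by (intro mult_right_mono) (auto simp: \<epsilon>_def)
    also have "\<dots> = q / 2"
    proof -
      have *: "q / (2 * c) * c = q / 2" if "c > 0" for c :: real
        using that by simp
      show ?thesis
        by (rule *[OF L\<rho>])
    qed
    finally show "\<epsilon> * (L + \<rho>\<^sup>2) < q"
      using q by simp
  qed
  define K1 where "K1 = norm b + cmod a * \<rho> + 1"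
  have K1: "K1 > 0"
    using pos by (simp add: K1_def add_nonneg_pos)
  \<comment> \<open>On the inner circle \<open>|\<zeta>| = \<sigma>\<close> the quadratic bound
    gives \<open>ln u - pen \<le> \<tau> + \<epsilon> * ln \<sigma>\<close>, and
    \<open>\<sigma>\<close> is chosen so small that the right-hand side is not positive. Lowering
    the pole from 2 to \<open>2 - \<epsilon>\<close> is what produces the term
    \<open>\<epsilon> * ln \<sigma>\<close>.\<close>
  define \<tau> where "\<tau> = ln (M * K1\<^sup>2) + (2 - \<epsilon>) * ln \<rho>"
  define \<sigma> where "\<sigma> = Min {exp (- \<tau> / \<epsilon>), cmod \<zeta>0 / 2, \<eta>, d / (2 * K1), \<rho> / 2}"
  have \<sigma>: "\<sigma> > 0" "\<sigma> \<le> exp (- \<tau> / \<epsilon>)" "\<sigma> < cmod \<zeta>0" "\<sigma> \<le> \<eta>" "\<sigma> \<le> d / (2 * K1)" "\<sigma> < \<rho>"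
  proof -
    have "\<sigma> \<le> cmod \<zeta>0 / 2" "\<sigma> \<le> \<rho> / 2"
      unfolding \<sigma>_def by (rule Min_le, simp, simp)+
    then have "\<sigma> < cmod \<zeta>0 \<and> \<sigma> < \<rho>"
      using cz pos by linarith
    then show "\<sigma> < cmod \<zeta>0" "\<sigma> < \<rho>"
      by simp_all
  qed (use cz pos K1 in \<open>simp_all add: \<sigma>_def\<close>)
  have \<epsilon>ln: "\<epsilon> * ln \<sigma> \<le> - \<tau>"
  proof -
    have "ln \<sigma> \<le> - \<tau> / \<epsilon>"
      using \<sigma>(1,2) by (metis exp_gt_zero ln_exp ln_le_cancel_iff)
    then show ?thesis
      using \<epsilon>(1) by (simp add: field_simps)
  qed
  \<comment> \<open>On \<open>|W| = \<sigma>\<close> the penalty \<open>B |W|^2\<close> is twice the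
    largest value of \<open>ln \<rho> - ln |\<zeta>|\<close> on the annulus, so the pole cannot make
    \<open>pen\<close> negative there.\<close>
  define B where "B = 2 * (ln \<rho> - ln \<sigma>) / \<sigma>\<^sup>2"
  have B: "B > 0" "B * \<sigma>\<^sup>2 = 2 * (ln \<rho> - ln \<sigma>)"
    using \<sigma>(1,6) pos by (simp_all add: B_def)
  define pen where "pen W \<zeta> = (2 - \<epsilon>) * (ln (cmod \<zeta>) - ln \<rho>) + B * (cmod W)\<^sup>2 + \<epsilon> * (\<rho>\<^sup>2 - (cmod \<zeta>)\<^sup>2)"
    for W \<zeta> :: complex
  define K where "K = cball (0::complex) \<sigma> \<times> (cball (0::complex) \<rho> - ball 0 \<sigma>)"
  \<comment> \<open>Maximizing \<open>u * exp (- pen)\<close> instead of \<open>ln u - pen\<close>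
    avoids infinite values where \<open>u\<close> vanishes.\<close>
  define F where "F x = u (X (fst x) (snd x)) * exp (- pen (fst x) (snd x))" for x
  have K_iff: "(W, \<zeta>) \<in> K \<longleftrightarrow> cmod W \<le> \<sigma> \<and> \<sigma> \<le> cmod \<zeta> \<and> cmod \<zeta> \<le> \<rho>" for W \<zeta>
    by (auto simp: K_def)
  have "compact K"
    unfolding K_def by (intro compact_Times compact_diff compact_cball open_ball)
  have zK: "(0, \<zeta>0) \<in> K"
    using \<zeta>0 \<sigma> by (simp add: K_iff)
  have XK: "X (fst x) (snd x) \<in> \<Omega>" if "x \<in> K" for x
    using that \<sigma> by (cases x) (auto simp: K_iff intro!: mem)
  have contX: "continuous_on UNIV (\<lambda>x. X (fst x) (snd x))"
    unfolding X_def by (intro continuous_intros)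
  have contpen: "continuous_on K (\<lambda>x. pen (fst x) (snd x))"
    unfolding pen_def using \<sigma>(1) by (intro continuous_intros) (auto simp: K_iff)
  have usc: "\<forall>\<^sub>F w in at x within K. F w < c" if x: "x \<in> K" and c: "F x < c" for x c
  proof -
    let ?z = "X (fst x) (snd x)" and ?E = "\<lambda>x. exp (- pen (fst x) (snd x))"
    define m where "m = (u ?z + c / ?E x) / 2"
    have m1: "u ?z < m" and m2: "m * ?E x < c"
      using c by (auto simp: m_def F_def field_simps)
    have "usc_on \<Omega> (\<lambda>z. ereal (u z))"
      using psh(1) by (simp add: plurisubharmonic_on_def)
    from bspec[OF this[unfolded usc_on_def] XK[OF x], THEN spec, of "ereal m"]
    have "\<forall>\<^sub>F w in at ?z within \<Omega>. ereal (u w) < ereal m"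
      using m1 by simp
    then have ev: "\<forall>\<^sub>F w in nhds ?z. w \<in> \<Omega> \<longrightarrow> u w < m"
      using m1 by (auto simp: eventually_at_filter elim!: eventually_mono)
    have "filterlim (\<lambda>x. X (fst x) (snd x)) (nhds ?z) (at x within K)"
      using contX continuous_on_subset[OF contX, of K] x by (auto simp: continuous_on_def)
    then have "\<forall>\<^sub>F w in at x within K. X (fst w) (snd w) \<in> \<Omega> \<longrightarrow> u (X (fst w) (snd w)) < m"
      by (rule eventually_compose_filterlim[OF ev])
    moreover have "((\<lambda>x. m * ?E x) \<longlongrightarrow> m * ?E x) (at x within K)"
      using contpen x by (intro tendsto_intros) (auto simp: continuous_on_def)
    then have "\<forall>\<^sub>F w in at x within K. m * ?E w < c"
      using m2 by (rule order_tendstoD)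
    moreover have "\<forall>\<^sub>F w in at x within K. w \<in> K"
      by (simp add: eventually_at_filter)
    ultimately show ?thesis
    proof eventually_elim
      case (elim w)
      then have "u (X (fst w) (snd w)) * ?E w < m * ?E w"
        using XK by simp
      then show ?case
        unfolding F_def using elim(2) by (rule less_trans)
    qed
  qed
  obtain x where x: "x \<in> K" "\<And>y. y \<in> K \<Longrightarrow> F y \<le> F x"
    using usc_attains_max[OF \<open>compact K\<close> _ usc] zK by blast
  define W1 where "W1 = fst x"
  define \<zeta>1 where "\<zeta>1 = snd x"
  define z1 where "z1 = X W1 \<zeta>1"
  have x1: "cmod W1 \<le> \<sigma>" "\<sigma> \<le> cmod \<zeta>1" "cmod \<zeta>1 \<le> \<rho>"
    using x(1) by (cases x, simp add: K_iff W1_def \<zeta>1_def)+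
  have z1: "z1 \<in> \<Omega>"
    using XK[OF x(1)] by (simp add: z1_def W1_def \<zeta>1_def)
  have "1 < F (0, \<zeta>0)"
  proof -
    have "pen 0 \<zeta>0 < ln (u (X 0 \<zeta>0))"
    proof -
      have "pen 0 \<zeta>0 = - 2 * L + \<epsilon> * (L + \<rho>\<^sup>2) - \<epsilon> * (cmod \<zeta>0)\<^sup>2"
        by (simp add: pen_def L_def algebra_simps)
      also have "\<dots> \<le> - 2 * L + \<epsilon> * (L + \<rho>\<^sup>2)"
        using \<epsilon>(1) by simp
      also have "\<dots> < - 2 * L + q"
        using \<epsilon>(3) by simp
      finally show ?thesis
        by (simp add: q_def)
    qed
    then have "exp (pen 0 \<zeta>0) < u (X 0 \<zeta>0)"
      using u00 by (metis exp_less_cancel_iff exp_ln)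
    then show ?thesis
      by (simp add: F_def exp_minus field_simps)
  qed
  \<comment> \<open>The maximum exceeds 1, while \<open>F \<le> 1\<close> on the boundary of
    \<open>K\<close>: on the outer circle and on \<open>|W| = \<sigma>\<close> because
    \<open>u \<le> 1\<close> and \<open>pen \<ge> 0\<close>, on the inner circle by the quadratic
    bound. Hence it is attained in the interior.\<close>
  then have F1: "1 < F x"
    using x(2)[OF zK] by linarith
  have big: "exp (pen W1 \<zeta>1) < u z1"
    using F1 by (simp add: F_def W1_def \<zeta>1_def z1_def exp_minus field_simps)
  have pen_nonneg: "0 \<le> B * (cmod W1)\<^sup>2" "0 \<le> \<epsilon> * (\<rho>\<^sup>2 - (cmod \<zeta>1)\<^sup>2)"
    using B(1) \<epsilon>(1) x1 by (simp_all add: power_mono)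
  have no_pen: "pen W1 \<zeta>1 < 0"
  proof -
    have "exp (pen W1 \<zeta>1) < exp 0"
      unfolding exp_zero using big u1[OF z1] by (rule less_le_trans)
    then show ?thesis
      by (simp only: exp_less_cancel_iff)
  qed
  have \<zeta>1_lt: "cmod \<zeta>1 < \<rho>"
  proof (rule ccontr)
    assume "\<not> cmod \<zeta>1 < \<rho>"
    then have "cmod \<zeta>1 = \<rho>"
      using x1 by simp
    then show False
      using no_pen pen_nonneg by (simp add: pen_def)
  qed
  have ln\<sigma>: "ln \<sigma> \<le> ln (cmod \<zeta>1)"
    using x1 \<sigma>(1) by (intro ln_mono) linarith+
  have W1_lt: "cmod W1 < \<sigma>"
  proof (rule ccontr)
    assume "\<not> cmod W1 < \<sigma>"
    then have "cmod W1 = \<sigma>"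
      using x1 by simp
    then have "pen W1 \<zeta>1 \<ge> (2 - \<epsilon>) * (ln (cmod \<zeta>1) - ln \<rho>) + 2 * (ln \<rho> - ln \<sigma>)"
      using pen_nonneg B(2) by (simp add: pen_def)
    moreover have "(2 - \<epsilon>) * (ln (cmod \<zeta>1) - ln \<rho>) \<ge> (2 - \<epsilon>) * (ln \<sigma> - ln \<rho>)"
      using ln\<sigma> \<epsilon>(2) by (intro mult_left_mono) auto
    moreover have "(2 - \<epsilon>) * (ln \<sigma> - ln \<rho>) = - 2 * (ln \<rho> - ln \<sigma>) + \<epsilon> * (ln \<rho> - ln \<sigma>)"
      by (simp add: algebra_simps)
    moreover have "\<epsilon> * (ln \<rho> - ln \<sigma>) \<ge> 0"
      using \<epsilon>(1) \<sigma>(1,6) pos by simp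
    ultimately show False
      using no_pen by linarith
  qed
  have \<zeta>1_gt: "\<sigma> < cmod \<zeta>1"
  proof (rule ccontr)
    assume "\<not> \<sigma> < cmod \<zeta>1"
    then have \<sigma>1: "cmod \<zeta>1 = \<sigma>"
      using x1 by simp
    define v where "v = \<zeta>1 *s b + (W1 + a * \<zeta>1\<^sup>2) *s N"
    have "norm v \<le> cmod \<zeta>1 * norm b + cmod (W1 + a * \<zeta>1\<^sup>2)"
      unfolding v_def
      by (rule order_trans[OF norm_triangle_ineq]) (simp only: norm_smult_vec N1 mult_1_right order_refl)
    also have "\<dots> \<le> \<sigma> * norm b + (\<sigma> + cmod a * \<sigma>\<^sup>2)"
      using x1(1) norm_triangle_ineq[of W1 "a * \<zeta>1\<^sup>2"] by (simp add: \<sigma>1 norm_mult norm_power)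
    also have "cmod a * \<sigma>\<^sup>2 \<le> cmod a * (\<rho> * \<sigma>)"
      using \<sigma> by (intro mult_left_mono) (auto simp: power2_eq_square)
    finally have nv: "norm v \<le> K1 * \<sigma>"
      by (simp add: K1_def algebra_simps)
    also have "K1 * \<sigma> \<le> K1 * (d / (2 * K1))"
      using \<sigma>(5) K1 by (intro mult_left_mono) auto
    also have "\<dots> < d"
      using K1 pos by simp
    finally have "u (p + v) \<le> M * (norm v)\<^sup>2"
      by (rule quad)
    also have "\<dots> \<le> M * (K1 * \<sigma>)\<^sup>2"
      using nv pos by (intro mult_left_mono power_mono) auto
    also have "p + v = z1"
      by (simp add: z1_def X_def v_def)
    finally have uz: "u z1 \<le> M * (K1 * \<sigma>)\<^sup>2" .
    have "0 < u z1"
      using big by (meson exp_gt_zero less_trans)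
    then have "pen W1 \<zeta>1 < ln (u z1)"
      using big by (metis exp_less_cancel_iff exp_ln)
    also have "\<dots> \<le> ln (M * (K1 * \<sigma>)\<^sup>2)"
      using uz \<open>0 < u z1\<close> by (intro ln_mono) auto
    also have "\<dots> = ln (M * K1\<^sup>2) + 2 * ln \<sigma>"
      using pos K1 \<sigma>(1) by (simp add: ln_mult ln_realpow power_mult_distrib)
    finally have "pen W1 \<zeta>1 < ln (M * K1\<^sup>2) + 2 * ln \<sigma>" .
    moreover have "pen W1 \<zeta>1 \<ge> (2 - \<epsilon>) * (ln \<sigma> - ln \<rho>)"
      using pen_nonneg by (simp add: pen_def \<sigma>1)
    ultimately have "0 < \<tau> + \<epsilon> * ln \<sigma>"
      by (simp add: \<tau>_def algebra_simps)
    then show False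
      using \<epsilon>ln by simp
  qed
  \<comment> \<open>Small enough for the disc of radius \<open>s\<close> in the tangent line to stay
    in \<open>K\<close>, and for \<open>B |a|^2 s^4 < \<epsilon> s^2\<close>.\<close>
  define s where "s = Min {(cmod \<zeta>1 - \<sigma>) / 2, (\<rho> - cmod \<zeta>1) / 2, (\<sigma> - cmod W1) / (cmod a + 1), 1, \<epsilon> / (2 * (B + 1) * (cmod a + 1)\<^sup>2)}"
  have s: "0 < s" "s < cmod \<zeta>1 - \<sigma>" "s < \<rho> - cmod \<zeta>1" "s \<le> (\<sigma> - cmod W1) / (cmod a + 1)" "s \<le> 1"
    "s \<le> \<epsilon> / (2 * (B + 1) * (cmod a + 1)\<^sup>2)"
  proof -
    have "s \<le> (cmod \<zeta>1 - \<sigma>) / 2" "s \<le> (\<rho> - cmod \<zeta>1) / 2"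
      unfolding s_def by (rule Min_le, simp, simp)+
    then show "s < cmod \<zeta>1 - \<sigma>" and "s < \<rho> - cmod \<zeta>1"
      using \<zeta>1_gt \<zeta>1_lt by (simp_all add: field_simps)
    have "0 < \<epsilon> / (2 * (B + 1) * (cmod a + 1)\<^sup>2)"
      by (intro divide_pos_pos mult_pos_pos zero_less_power) (use B(1) \<epsilon>(1) in \<open>simp_all add: add_nonneg_pos\<close>)
    moreover have "0 < (\<sigma> - cmod W1) / (cmod a + 1)"
      by (intro divide_pos_pos) (use W1_lt in \<open>simp_all add: add_nonneg_pos\<close>)
    ultimately show "0 < s"
      using \<zeta>1_gt \<zeta>1_lt unfolding s_def by (subst Min_gr_iff) simp_all
  qed (simp_all add: s_def)
  have s2: "s\<^sup>2 \<le> s"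
    using s power_decreasing[of 1 2 s] by simp
  have as2: "cmod a * s\<^sup>2 \<le> \<sigma> - cmod W1"
  proof -
    have "cmod a * s\<^sup>2 \<le> (cmod a + 1) * s"
      using s2 s(1) by (intro mult_mono) auto
    also have "\<dots> \<le> \<sigma> - cmod W1"
      using s(4) by (simp add: pos_le_divide_eq add_nonneg_pos mult.commute)
    finally show ?thesis .
  qed
  have neg: "B * (cmod a)\<^sup>2 * s ^ 4 - \<epsilon> * s\<^sup>2 < 0"
  proof -
    have "B * (cmod a)\<^sup>2 * s\<^sup>2 \<le> ((B + 1) * (cmod a + 1)\<^sup>2) * s"
      using s2 s(1) B(1) by (intro mult_mono power_mono) auto
    also have "\<dots> \<le> ((B + 1) * (cmod a + 1)\<^sup>2) * (\<epsilon> / (2 * (B + 1) * (cmod a + 1)\<^sup>2))"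
      using s(6) B(1) by (intro mult_left_mono) auto
    also have "\<dots> = \<epsilon> / 2"
    proof -
      have *: "(k * m) * (\<epsilon> / (2 * k * m)) = \<epsilon> / 2" if "k > 0" "m > 0" for k m :: real
        using that by simp
      have "0 < cmod a + 1"
        by (simp add: add_nonneg_pos)
      then show ?thesis
        by (intro *) (use B(1) in auto)
    qed
    finally have "B * (cmod a)\<^sup>2 * s\<^sup>2 < \<epsilon>"
      using \<epsilon>(1) by linarith
    then have "(B * (cmod a)\<^sup>2 * s\<^sup>2) * s\<^sup>2 < \<epsilon> * s\<^sup>2"
      using s(1) by (intro mult_strict_right_mono) auto
    then show ?thesis
      by (simp add: power_numeral_reduce mult_ac)
  qed
  \<comment> \<open>The derivative of \<open>X W1\<close> at \<open>\<zeta>1\<close>, so that the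
    line through \<open>z1\<close> is tangent to the parabola.\<close>
  define b1 where "b1 = b + (2 * a * \<zeta>1) *s N"
  have line: "z1 + \<tau> *s b1 = X (W1 - a * \<tau>\<^sup>2) (\<zeta>1 + \<tau>)" for \<tau>
    by (simp add: z1_def X_def b1_def vec_eq_iff power2_eq_square algebra_simps)
  have inK: "(W1 - a * \<tau>\<^sup>2, \<zeta>1 + \<tau>) \<in> K" if "cmod \<tau> \<le> s" for \<tau>
  proof -
    have "cmod (W1 - a * \<tau>\<^sup>2) \<le> cmod W1 + cmod a * (cmod \<tau>)\<^sup>2"
      by (rule order_trans[OF norm_triangle_ineq4]) (simp add: norm_mult norm_power)
    also have "\<dots> \<le> cmod W1 + cmod a * s\<^sup>2"
      using that by (intro add_left_mono mult_left_mono power_mono) auto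
    finally have "cmod (W1 - a * \<tau>\<^sup>2) \<le> \<sigma>"
      using as2 by linarith
    moreover have "\<sigma> \<le> cmod (\<zeta>1 + \<tau>)"
      using norm_triangle_ineq4[of "\<zeta>1 + \<tau>" \<tau>] that s(2) by simp
    moreover have "cmod (\<zeta>1 + \<tau>) \<le> \<rho>"
      using norm_triangle_ineq[of \<zeta>1 \<tau>] that s(3) by simp
    ultimately show ?thesis
      by (simp add: K_iff)
  qed
  \<comment> \<open>\<open>Re h\<close> is the harmonic part of the change of \<open>pen\<close>
    along the line, normalized by \<open>h 0 = 0\<close>. What remains of that change is constant on
    the circle, namely \<open>B |a|^2 s^4 - \<epsilon> s^2\<close>, and goes into
    \<open>C\<close>.\<close>
  define h where "h \<tau> = of_real (2 - \<epsilon>) * Ln (1 + \<tau> / \<zeta>1) - of_real (2 * B) * (cnj W1 * a * \<tau>\<^sup>2) - of_real (2 * \<epsilon>) * (cnj \<zeta>1 * \<tau>)" for \<tau>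
  define C where "C = ln (u z1) + (B * (cmod a)\<^sup>2 * s ^ 4 - \<epsilon> * s\<^sup>2)"
  have \<zeta>1: "\<zeta>1 \<noteq> 0"
    using \<zeta>1_gt \<sigma>(1) by auto
  have Re1: "Re (1 + \<tau> / \<zeta>1) > 0" if "cmod \<tau> < cmod \<zeta>1" for \<tau>
  proof -
    have "cmod (\<tau> / \<zeta>1) < 1"
      using that \<zeta>1 by (simp add: norm_divide)
    then show ?thesis
      using abs_Re_le_cmod[of "\<tau> / \<zeta>1"] by (simp only: plus_complex.sel one_complex.sel)
  qed
  have uz1: "0 < u z1"
    using big by (meson exp_gt_zero less_trans)
  have hol: "h holomorphic_on ball 0 (cmod \<zeta>1)"
    unfolding h_def
  proof (intro holomorphic_intros)
    fix \<tau> :: complex assume "\<tau> \<in> ball 0 (cmod \<zeta>1)"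
    then show "1 + \<tau> / \<zeta>1 \<notin> \<real>\<^sub>\<le>\<^sub>0"
      using Re1[of \<tau>] complex_nonpos_Reals_iff by fastforce
  qed (use \<zeta>1 in auto)
  have up: "ext_ln (u (z1 + \<tau> *s b1)) \<le> ereal (Re (h \<tau>) + C)" if \<tau>: "cmod \<tau> = s" for \<tau>
  proof (cases "u (z1 + \<tau> *s b1) = 0")
    case True
    then show ?thesis
      by (simp add: ext_ln_def)
  next
    case False
    let ?W = "W1 - a * \<tau>\<^sup>2" and ?\<zeta> = "\<zeta>1 + \<tau>"
    have K': "(?W, ?\<zeta>) \<in> K"
      using \<tau> by (intro inK) simp
    have "z1 + \<tau> *s b1 \<in> \<Omega>"
      using XK[OF K'] by (simp add: line)
    then have pos': "0 < u (z1 + \<tau> *s b1)"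
      using u0 False by (simp add: less_le)
    have "u (z1 + \<tau> *s b1) * exp (- pen ?W ?\<zeta>) \<le> u z1 * exp (- pen W1 \<zeta>1)"
      using x(2)[OF K'] unfolding F_def line by (simp add: W1_def \<zeta>1_def z1_def)
    then have "ln (u (z1 + \<tau> *s b1) * exp (- pen ?W ?\<zeta>)) \<le> ln (u z1 * exp (- pen W1 \<zeta>1))"
      using pos' uz1 by (intro ln_mono) auto
    then have 1: "ln (u (z1 + \<tau> *s b1)) \<le> ln (u z1) + pen ?W ?\<zeta> - pen W1 \<zeta>1"
      using pos' uz1 by (simp add: ln_mult)
    have n\<zeta>: "?\<zeta> = \<zeta>1 * (1 + \<tau> / \<zeta>1)"
      using \<zeta>1 by (simp add: field_simps)
    have nz: "1 + \<tau> / \<zeta>1 \<noteq> 0"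
      using Re1[of \<tau>] \<tau> s(2) \<sigma>(1) by fastforce
    have 2: "ln (cmod ?\<zeta>) = ln (cmod \<zeta>1) + Re (Ln (1 + \<tau> / \<zeta>1))"
      unfolding n\<zeta> norm_mult using \<zeta>1 nz by (simp add: ln_mult)
    have sq: "(cmod (x + y))\<^sup>2 = (cmod x)\<^sup>2 + 2 * Re (cnj x * y) + (cmod y)\<^sup>2" for x y
      unfolding cmod_power2 by (simp add: power2_eq_square algebra_simps)
    have 3: "(cmod ?\<zeta>)\<^sup>2 = (cmod \<zeta>1)\<^sup>2 + 2 * Re (cnj \<zeta>1 * \<tau>) + s\<^sup>2"
      using sq[of \<zeta>1 \<tau>] \<tau> by simp
    have "(cmod ?W)\<^sup>2 = (cmod W1)\<^sup>2 + 2 * Re (cnj W1 * (- (a * \<tau>\<^sup>2))) + (cmod (- (a * \<tau>\<^sup>2)))\<^sup>2"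
      using sq[of W1 "- (a * \<tau>\<^sup>2)"] by simp
    also have "(cmod (- (a * \<tau>\<^sup>2)))\<^sup>2 = (cmod a)\<^sup>2 * s ^ 4"
      by (simp add: norm_mult norm_power \<tau> power_mult_distrib power_mult[symmetric])
    also have "cnj W1 * (- (a * \<tau>\<^sup>2)) = - (cnj W1 * a * \<tau>\<^sup>2)"
      by simp
    finally have 4: "(cmod ?W)\<^sup>2 = (cmod W1)\<^sup>2 - 2 * Re (cnj W1 * a * \<tau>\<^sup>2) + (cmod a)\<^sup>2 * s ^ 4"
      by (simp only: uminus_complex.sel)
    have "Re (h \<tau>) = (2 - \<epsilon>) * Re (Ln (1 + \<tau> / \<zeta>1)) - 2 * B * Re (cnj W1 * a * \<tau>\<^sup>2) - 2 * \<epsilon> * Re (cnj \<zeta>1 * \<tau>)"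
      by (simp only: h_def minus_complex.sel Re_complex_of_real Im_complex_of_real times_complex.sel mult_zero_left diff_zero)
    then have "pen ?W ?\<zeta> = pen W1 \<zeta>1 + Re (h \<tau>) + (B * (cmod a)\<^sup>2 * s ^ 4 - \<epsilon> * s\<^sup>2)"
      unfolding pen_def 2 3 4 by (simp only: algebra_simps)
    then show ?thesis
      using 1 pos' by (simp add: ext_ln_def C_def)
  qed
  have "subharmonic_on {\<tau>. z1 + \<tau> *s b1 \<in> \<Omega>} (\<lambda>\<tau>. ext_ln (u (z1 + \<tau> *s b1)))"
    using psh(2) by (simp add: plurisubharmonic_on_def)
  moreover have "cball 0 s \<subseteq> {\<tau>. z1 + \<tau> *s b1 \<in> \<Omega>}"
    using XK[OF inK] by (auto simp: line)
  ultimately have "ext_ln (u (z1 + 0 *s b1)) \<le> circle_mean (\<lambda>\<tau>. ext_ln (u (z1 + \<tau> *s b1))) 0 s"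
    using s(1) unfolding subharmonic_on_def by blast
  also have "\<dots> \<le> ereal C"
  proof (rule circle_mean_le)
    have sub: "cball 0 s \<subseteq> ball 0 (cmod \<zeta>1)"
      using s(2) \<sigma>(1) by auto
    have cont: "continuous_on (ball 0 (cmod \<zeta>1)) h"
      using hol by (rule holomorphic_on_imp_continuous_on)
    have "continuous_on {0..2 * pi} (\<lambda>t. h (0 + of_real s * cis t))"
      by (rule continuous_on_compose2[OF cont])
         (use \<sigma>(1) s(1,2) in \<open>auto intro!: continuous_intros simp: norm_mult\<close>)
    then show "continuous_on {0..2 * pi} (\<lambda>t. Re (h (0 + of_real s * cis t)) + C)"
      by (intro continuous_intros)
    have "((\<lambda>t. Re (h (0 + of_real s * cis t))) has_integral (2 * pi * Re (h 0))) {0..2*pi}"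
      using Re_holomorphic_mean_value[OF hol open_ball sub s(1)] .
    moreover have "h 0 = 0"
      by (simp add: h_def)
    ultimately show "((\<lambda>t. Re (h (0 + of_real s * cis t)) + C) has_integral 2 * pi * C) {0..2 * pi}"
      using has_integral_add[of "\<lambda>t. Re (h (0 + of_real s * cis t))" 0 "{0..2*pi}" "\<lambda>t. C" "2 * pi * C"]
        has_integral_const_real[of C 0 "2 * pi"] by (simp add: mult.commute)
    fix t
    show "ext_ln (u (z1 + (0 + of_real s * cis t) *s b1)) \<le> ereal (Re (h (0 + of_real s * cis t)) + C)"
      by (rule up) (use s(1) in \<open>simp add: norm_mult\<close>)
  qed
  finally have "ln (u z1) \<le> C"
    using uz1 by (simp add: ext_ln_def)
  then show False
    using neg by (simp add: C_def)
qed

context inner_model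
begin

lemma sibony_upper:
  assumes \<Omega>: "open \<Omega>" and \<kappa>: "cmod \<kappa> = 1"
  obtains C where
    "\<forall>\<^sub>F \<delta> in at_right 0. sibony_metric \<Omega> (P + \<delta> *\<^sub>R N) (\<kappa> *s N) \<le> ereal (C * (1 / \<delta> powr (1 / 2)))"
proof -
  have main: "sqrt (Re (complex_hessian u p (\<kappa> *s N) (\<kappa> *s N))) \<le> 2 / (\<rho> * sqrt l) * (1 / \<delta> powr (1 / 2))"
    if \<delta>: "0 < \<delta>" "\<delta> < min (\<rho> / 4) (1 / l)" and p: "p = P + \<delta> *\<^sub>R N" and u: "u \<in> sibony_class \<Omega> p" for \<delta> u p
  proof -
    obtain V where V: "open V" "p \<in> V" "C2_on V u"
      using u by (auto simp: sibony_class_def)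
    have psh: "plurisubharmonic_on \<Omega> (\<lambda>z. ereal (u z))" "plurisubharmonic_on \<Omega> (\<lambda>z. ext_ln (u z))"
      and up: "u p = 0" and u0: "\<And>z. z \<in> \<Omega> \<Longrightarrow> 0 \<le> u z" and u1: "\<And>z. z \<in> \<Omega> \<Longrightarrow> u z \<le> 1"
      using u by (auto simp: sibony_class_def)
    have p_pt: "p = point (of_real \<delta>) 0"
      by (simp add: p point_0)
    have p\<Omega>: "p \<in> \<Omega>"
      unfolding p_pt using \<delta> \<rho> by (intro point_mem) auto
    obtain M d where Md: "M > 0" "d > 0" "\<And>v. norm v < d \<Longrightarrow> u (p + v) \<le> M * (norm v)\<^sup>2"
      by (rule quadratic_bound_at_minimum[OF V \<Omega> p\<Omega> up u0]) (assumption, rule that)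
    define c where "c = sqrt (l * \<delta>) / 2"
    have c: "c > 0" and c2: "c\<^sup>2 = l * \<delta> / 4"
      using l \<delta> by (simp_all add: c_def power_divide)
    have c_le: "c \<le> 1 / 2"
    proof -
      have "l * \<delta> \<le> 1"
        using \<delta> l by (simp add: field_simps)
      then have "sqrt (l * \<delta>) \<le> 1"
        by simp
      then show ?thesis
        by (simp add: c_def)
    qed
    have disc: "Re (complex_hessian u p (of_real c' *s N + T) (of_real c' *s N + T)) \<le> 1 / \<rho>\<^sup>2" if c': "\<bar>c'\<bar> = c" for c' :: real
    proof -
      define b where "b = of_real c' *s N + T"
      have X: "p + \<zeta> *s b + (W + a * \<zeta>\<^sup>2) *s N = point (of_real \<delta> + of_real c' * \<zeta> + W) \<zeta>" for W \<zeta>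
        by (simp add: p_pt point_def b_def vec_eq_iff algebra_simps)
      \<comment> \<open>The parabola is needed together with a neighbourhood, since the penalized
        maximum is sought there; its width \<open>\<delta> / 8\<close> does not enter the resulting
        bound.\<close>
      have mem: "p + \<zeta> *s b + (W + a * \<zeta>\<^sup>2) *s N \<in> \<Omega>" if W: "cmod W \<le> \<delta> / 8" and \<zeta>: "cmod \<zeta> \<le> \<rho>" for W \<zeta>
        unfolding X
      proof (rule point_mem)
        let ?w = "of_real \<delta> + of_real c' * \<zeta> + W"
        have n1: "cmod (of_real c' * \<zeta>) = c * cmod \<zeta>"
          using c' by (simp add: norm_mult)
        have "cmod ?w \<le> cmod (of_real \<delta>) + cmod (of_real c' * \<zeta>) + cmod W"
          by (intro order_trans[OF norm_triangle_ineq] add_right_mono norm_triangle_ineq)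
        then have w1: "cmod ?w \<le> \<delta> + c * cmod \<zeta> + \<delta> / 8"
          unfolding n1 using W \<delta> by simp
        have "Re ?w = \<delta> + Re (of_real c' * \<zeta>) + Re W"
          by simp
        then have w2: "Re ?w \<ge> \<delta> - c * cmod \<zeta> - \<delta> / 8"
          using abs_Re_le_cmod[of "of_real c' * \<zeta>"] abs_Re_le_cmod[of W] W unfolding n1 by linarith
        have "c * cmod \<zeta> \<le> 1 / 2 * \<rho>"
          using c_le \<zeta> c by (intro mult_mono) auto
        then show "cmod ?w \<le> \<rho>"
          using w1 \<delta> by simp
        \<comment> \<open>Arithmetic-geometric mean: by the choice of \<open>c\<close> the normal
          motion \<open>c |\<zeta>|\<close> costs at most a quarter of
          \<open>\<delta> + l |\<zeta>|^2\<close>. What is left absorbs \<open>W\<close> and the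
          slack of the model.\<close>
        have "0 \<le> (c - l * cmod \<zeta> / 2)\<^sup>2"
          by simp
        then have "l * (c * cmod \<zeta>) \<le> l * (\<delta> / 4 + l * (cmod \<zeta>)\<^sup>2 / 4)"
          by (simp add: power2_diff c2 power_mult_distrib power_divide) (simp add: power2_eq_square algebra_simps)
        then have "c * cmod \<zeta> \<le> \<delta> / 4 + l * (cmod \<zeta>)\<^sup>2 / 4"
          using l by (simp only: mult_le_cancel_left_pos)
        moreover have "0 \<le> l * (cmod \<zeta>)\<^sup>2"
          using l by simp
        ultimately show "cmod ?w / 4 < Re ?w + l * (cmod \<zeta>)\<^sup>2"
          using w1 w2 \<delta> by linarith
      qed (use \<zeta> in simp)
      have bound: "u (p + \<zeta> *s b + (0 + a * \<zeta>\<^sup>2) *s N) \<le> (cmod \<zeta>)\<^sup>2 / \<rho>\<^sup>2" if \<zeta>: "cmod \<zeta> < \<rho>" for \<zeta>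
      proof (cases "\<zeta> = 0")
        case True
        then show ?thesis
          by (simp add: up)
      next
        case False
        show ?thesis
          using \<delta> \<rho> Md(1,2)
          by (intro quadratic_disc_bound[where \<eta> = "\<delta> / 8", OF N1 psh u0 u1 mem _ _ _ _ Md(3) False \<zeta>]) simp_all
      qed
      have "Re (complex_hessian u p b b) \<le> 1 / \<rho>\<^sup>2"
      proof (rule complex_hessian_le_on_parabola[OF V up \<rho>])
        fix t assume "cmod t < \<rho>"
        then show "u (p + (t *s b + t\<^sup>2 *s (a *s N))) \<le> 1 / \<rho>\<^sup>2 * (cmod t)\<^sup>2"
          using bound by (simp add: mult.commute add.assoc vector_smult_assoc)
      qed
      then show ?thesis
        by (simp add: b_def)
    qed
    obtain R where R: "R > 0" "ball p R \<subseteq> \<Omega>"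
      using \<Omega> p\<Omega> open_contains_ball by blast
    have T_nonneg: "0 \<le> Re (complex_hessian u p T T)"
    proof (rule complex_hessian_ge_on_line[OF V up R(1)])
      fix t assume "cmod t < R"
      then have "p + t *s T \<in> ball p R"
        using T1 by (simp add: dist_norm norm_smult_vec)
      then show "0 * (cmod t)\<^sup>2 \<le> u (p + t *s T)"
        using u0 R(2) by auto
    qed
    let ?H = "\<lambda>x. Re (complex_hessian u p x x)"
    have "?H (of_real c *s N - T) = ?H ((- 1) *s (of_real (- c) *s N + T))"
      by (rule arg_cong[of _ _ ?H]) (simp add: vec_eq_iff)
    also have "\<dots> = ?H (of_real (- c) *s N + T)"
      unfolding complex_hessian_scale by simp
    finally have H2: "?H (of_real c *s N - T) \<le> 1 / \<rho>\<^sup>2"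
      using disc[of "- c"] c by simp
    have "?H (of_real c *s N + T) + ?H (of_real c *s N - T) = 2 * ?H (of_real c *s N) + 2 * ?H T"
      using arg_cong[OF complex_hessian_parallelogram[of u p "of_real c *s N" T], of Re] by simp
    moreover have "?H (of_real c *s N) = c\<^sup>2 * ?H N"
      unfolding complex_hessian_scale by simp
    ultimately have "c\<^sup>2 * ?H N \<le> 1 / \<rho>\<^sup>2"
      using H2 disc[of c] c T_nonneg by simp
    then have HN: "?H N \<le> 4 / (\<rho>\<^sup>2 * l * \<delta>)"
      using l \<delta> \<rho> by (simp add: c2 field_simps)
    have "?H (\<kappa> *s N) = ?H N"
      unfolding complex_hessian_scale using \<kappa> by simp
    then have "sqrt (?H (\<kappa> *s N)) \<le> sqrt (4 / (\<rho>\<^sup>2 * l * \<delta>))"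
      using HN by simp
    also have "\<dots> = 2 / (\<rho> * sqrt l) * (1 / \<delta> powr (1 / 2))"
      using \<rho> \<delta> by (simp add: real_sqrt_divide real_sqrt_mult powr_half_sqrt)
    finally show ?thesis .
  qed
  show ?thesis
  proof (rule that[of "2 / (\<rho> * sqrt l)"])
    have "0 < min (\<rho> / 4) (1 / l)"
      using \<rho> l by simp
    from eventually_at_right_real[OF this]
    show "\<forall>\<^sub>F \<delta> in at_right 0. sibony_metric \<Omega> (P + \<delta> *\<^sub>R N) (\<kappa> *s N) \<le> ereal (2 / (\<rho> * sqrt l) * (1 / \<delta> powr (1 / 2)))"
    proof eventually_elim
      case (elim \<delta>)
      show ?case
        unfolding sibony_metric_def
      proof (rule SUP_least)
        fix u assume "u \<in> sibony_class \<Omega> (P + \<delta> *\<^sub>R N)"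
        then show "ereal (sqrt (Re (complex_hessian u (P + \<delta> *\<^sub>R N) (\<kappa> *s N) (\<kappa> *s N)))) \<le> ereal (2 / (\<rho> * sqrt l) * (1 / \<delta> powr (1 / 2)))"
          using main[of \<delta> _ u] elim by simp
      qed
    qed
  qed
qed

end

section \<open>Twice continuous differentiability of the competitor\<close>

lemma C2_onI:
  fixes f' :: "'a::real_normed_vector \<Rightarrow> 'a \<Rightarrow>\<^sub>L real"
  assumes "\<And>x. x \<in> U \<Longrightarrow> (f has_derivative blinfun_apply (f' x)) (at x)"
    and "\<And>x. x \<in> U \<Longrightarrow> (f' has_derivative blinfun_apply (f'' x)) (at x)"
    and "continuous_on U f''"
  shows "C2_on U f"
  unfolding C2_on_def using assms by blast

lemma C2_on_open_cong:
  assumes "open U" "\<And>x. x \<in> U \<Longrightarrow> f x = g x" "C2_on U f"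
  shows "C2_on U g"
proof -
  obtain f' f'' where f': "\<And>y. y \<in> U \<Longrightarrow> (f has_derivative blinfun_apply (f' y)) (at y)"
    and f'': "\<And>y. y \<in> U \<Longrightarrow> (f' has_derivative blinfun_apply (f'' y)) (at y)" and c: "continuous_on U f''"
    using assms(3) unfolding C2_on_def by blast
  show ?thesis
  proof (rule C2_onI[OF _ f'' c])
    fix x assume x: "x \<in> U"
    show "(g has_derivative blinfun_apply (f' x)) (at x)"
      by (rule has_derivative_transform_within_open[OF f'[OF x] assms(1) x assms(2)])
  qed
qed

lemma C2_on_add:
  assumes "C2_on U f" "C2_on U g"
  shows "C2_on U (\<lambda>x. f x + g x)"
proof -
  obtain f' f'' where f: "\<And>y. y \<in> U \<Longrightarrow> (f has_derivative blinfun_apply (f' y)) (at y)"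
    "\<And>y. y \<in> U \<Longrightarrow> (f' has_derivative blinfun_apply (f'' y)) (at y)" "continuous_on U f''"
    using assms(1) unfolding C2_on_def by blast
  obtain g' g'' where g: "\<And>y. y \<in> U \<Longrightarrow> (g has_derivative blinfun_apply (g' y)) (at y)"
    "\<And>y. y \<in> U \<Longrightarrow> (g' has_derivative blinfun_apply (g'' y)) (at y)" "continuous_on U g''"
    using assms(2) unfolding C2_on_def by blast
  show ?thesis
  proof (rule C2_onI)
    fix x assume x: "x \<in> U"
    show "((\<lambda>x. f x + g x) has_derivative blinfun_apply (f' x + g' x)) (at x)"
      using has_derivative_add[OF f(1)[OF x] g(1)[OF x]] by (simp add: plus_blinfun.rep_eq)
    show "((\<lambda>x. f' x + g' x) has_derivative blinfun_apply (f'' x + g'' x)) (at x)"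
      using has_derivative_add[OF f(2)[OF x] g(2)[OF x]] by (simp add: plus_blinfun.rep_eq)
  qed (intro continuous_intros f g)
qed

lemma C2_on_scale:
  assumes "C2_on U f"
  shows "C2_on U (\<lambda>x. c * f x)"
proof -
  obtain f' f'' where f: "\<And>y. y \<in> U \<Longrightarrow> (f has_derivative blinfun_apply (f' y)) (at y)"
    "\<And>y. y \<in> U \<Longrightarrow> (f' has_derivative blinfun_apply (f'' y)) (at y)" "continuous_on U f''"
    using assms(1) unfolding C2_on_def by blast
  show ?thesis
  proof (rule C2_onI)
    fix x assume x: "x \<in> U"
    show "((\<lambda>x. c * f x) has_derivative blinfun_apply (c *\<^sub>R f' x)) (at x)"
      using has_derivative_mult_right[OF f(1)[OF x], of c] by (simp add: scaleR_blinfun.rep_eq)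
    show "((\<lambda>x. c *\<^sub>R f' x) has_derivative blinfun_apply (c *\<^sub>R f'' x)) (at x)"
      using has_derivative_scaleR_right[OF f(2)[OF x], of c] by (simp add: scaleR_blinfun.rep_eq)
  qed (intro continuous_intros f)
qed

lemma C2_on_norm_sq: "C2_on U (\<lambda>x::'a::real_inner. (norm (x - p))\<^sup>2)"
proof (rule C2_onI)
  fix x :: 'a assume "x \<in> U"
  have "((\<lambda>x. (x - p) \<bullet> (x - p)) has_derivative (\<lambda>h. (x - p) \<bullet> h + h \<bullet> (x - p))) (at x)"
    by (auto intro!: derivative_eq_intros)
  then show "((\<lambda>x. (norm (x - p))\<^sup>2) has_derivative blinfun_apply (2 *\<^sub>R blinfun_inner_right (x - p))) (at x)"
    by (simp add: power2_norm_eq_inner inner_commute scaleR_blinfun.rep_eq)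
  have "((\<lambda>x. x - p) has_derivative (\<lambda>h. h)) (at x)"
    by (auto intro!: derivative_eq_intros)
  from has_derivative_scaleR_right[OF bounded_linear.has_derivative[OF bounded_linear_blinfun_inner_right this], of 2]
  show "((\<lambda>x. 2 *\<^sub>R blinfun_inner_right (x - p)) has_derivative blinfun_apply (2 *\<^sub>R Blinfun blinfun_inner_right)) (at x)"
    by (simp add: scaleR_blinfun.rep_eq bounded_linear_Blinfun_apply bounded_linear_blinfun_inner_right)
qed (intro continuous_intros)

lemma C2_on_compose_affine:
  fixes L :: "'a::real_normed_vector \<Rightarrow> 'b::real_normed_vector"
  assumes L: "bounded_linear L" and "C2_on V f" and sub: "\<And>x. x \<in> U \<Longrightarrow> L (x - p) \<in> V"
  shows "C2_on U (\<lambda>x. f (L (x - p)))"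
proof -
  obtain f' f'' where f: "\<And>y. y \<in> V \<Longrightarrow> (f has_derivative blinfun_apply (f' y)) (at y)"
    "\<And>y. y \<in> V \<Longrightarrow> (f' has_derivative blinfun_apply (f'' y)) (at y)" "continuous_on V f''"
    using assms(2) unfolding C2_on_def by blast
  define BL where "BL = Blinfun L"
  have BL: "blinfun_apply BL = L"
    using L by (simp add: BL_def bounded_linear_Blinfun_apply)
  have dL: "((\<lambda>x. L (x - p)) has_derivative L) (at x)" for x
  proof -
    have "((\<lambda>x. x - p) has_derivative (\<lambda>h. h)) (at x)"
      by (auto intro!: derivative_eq_intros)
    from bounded_linear.has_derivative[OF L this] show ?thesis .
  qed
  have K: "bounded_linear (\<lambda>h :: 'b \<Rightarrow>\<^sub>L real. h o\<^sub>L BL)"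
    by (rule bounded_bilinear.bounded_linear_left[OF bounded_bilinear_blinfun_compose])
  show ?thesis
  proof (rule C2_onI)
    fix x assume x: "x \<in> U"
    have "((\<lambda>x. f (L (x - p))) has_derivative (\<lambda>h. f' (L (x - p)) (L h))) (at x)"
      by (rule has_derivative_compose[OF dL f(1)[OF sub[OF x]]])
    then show "((\<lambda>x. f (L (x - p))) has_derivative blinfun_apply (f' (L (x - p)) o\<^sub>L BL)) (at x)"
      by (simp add: blinfun_compose.rep_eq BL o_def)
    have "((\<lambda>x. f' (L (x - p))) has_derivative (\<lambda>h. f'' (L (x - p)) (L h))) (at x)"
      by (rule has_derivative_compose[OF dL f(2)[OF sub[OF x]]])
    from bounded_linear.has_derivative[OF K this]
    show "((\<lambda>x. f' (L (x - p)) o\<^sub>L BL) has_derivative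
        blinfun_apply (Blinfun (\<lambda>h. h o\<^sub>L BL) o\<^sub>L (f'' (L (x - p)) o\<^sub>L BL))) (at x)"
      by (simp add: blinfun_compose.rep_eq BL o_def bounded_linear_Blinfun_apply[OF K])
  next
    have "continuous_on U (\<lambda>x. L (x - p))"
      by (intro bounded_linear.continuous_on[OF L] continuous_intros)
    then have "continuous_on U (\<lambda>x. f'' (L (x - p)))"
      by (rule continuous_on_compose2[OF f(3)]) (use sub in auto)
    then show "continuous_on U (\<lambda>x. Blinfun (\<lambda>h. h o\<^sub>L BL) o\<^sub>L (f'' (L (x - p)) o\<^sub>L BL))"
      by (intro bounded_bilinear.continuous_on[OF bounded_bilinear_blinfun_compose] continuous_on_const)
  qed
qed

text \<open>The differential of \<open>|G|^2\<close> sends \<open>v\<close> to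
  \<open>Re (2 * cnj G * G' * v)\<close>. The map \<open>J\<close> identifies a complex number with
  such a real functional, so the second derivative reduces to differentiating the complex
  coefficient.\<close>

lemma C2_on_cmod_sq_holomorphic:
  assumes G: "G holomorphic_on V" and V: "open V"
  shows "C2_on V (\<lambda>w. (cmod (G w))\<^sup>2)"
proof -
  define J :: "complex \<Rightarrow> complex \<Rightarrow>\<^sub>L real" where "J k = Blinfun Re o\<^sub>L blinfun_mult_right k" for k
  have J: "blinfun_apply (J k) v = Re (k * v)" for k v
    by (simp add: J_def bounded_linear_Blinfun_apply bounded_linear_Re)
  have bJ: "bounded_linear J"
    unfolding J_def
    by (rule bounded_linear_compose[OF bounded_bilinear.bounded_linear_right[OF bounded_bilinear_blinfun_compose]
        bounded_linear_blinfun_mult_right])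
  define k where "k w = 2 * (cnj (G w) * deriv G w)" for w
  define A where "A w = 2 * (cnj (deriv G w) * deriv G w)" for w
  define B where "B w = 2 * (cnj (G w) * deriv (deriv G) w)" for w
  have dG: "(G has_field_derivative deriv G w) (at w)" if "w \<in> V" for w
    using holomorphic_derivI[OF G V that] .
  have hG': "deriv G holomorphic_on V"
    by (rule holomorphic_deriv[OF G V])
  have dG': "(deriv G has_field_derivative deriv (deriv G) w) (at w)" if "w \<in> V" for w
    using holomorphic_derivI[OF hG' V that] .
  have hG'': "deriv (deriv G) holomorphic_on V"
    by (rule holomorphic_deriv[OF hG' V])
  define f'' where "f'' w = Blinfun J o\<^sub>L ((blinfun_mult_right (A w) o\<^sub>L Blinfun cnj) + blinfun_mult_right (B w))" for w
  show ?thesis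
  proof (rule C2_onI)
    fix w assume w: "w \<in> V"
    have g: "(G has_derivative (\<lambda>h. deriv G w * h)) (at w)"
      using dG[OF w] by (simp add: has_field_derivative_def)
    have g': "(deriv G has_derivative (\<lambda>h. deriv (deriv G) w * h)) (at w)"
      using dG'[OF w] by (simp add: has_field_derivative_def)
    have cg: "((\<lambda>w. cnj (G w)) has_derivative (\<lambda>h. cnj (deriv G w * h))) (at w)"
      by (rule bounded_linear.has_derivative[OF bounded_linear_cnj g])
    have "((\<lambda>w. Re (cnj (G w) * G w)) has_derivative
        (\<lambda>h. Re (cnj (G w) * (deriv G w * h) + cnj (deriv G w * h) * G w))) (at w)"
      by (rule bounded_linear.has_derivative[OF bounded_linear_Re has_derivative_mult[OF cg g]])
    moreover have "(\<lambda>w. Re (cnj (G w) * G w)) = (\<lambda>w. (cmod (G w))\<^sup>2)"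
      unfolding cmod_power2 by (simp add: power2_eq_square)
    moreover have "(\<lambda>h. Re (cnj (G w) * (deriv G w * h) + cnj (deriv G w * h) * G w)) = blinfun_apply (J (k w))"
      by (simp add: fun_eq_iff J k_def algebra_simps)
    ultimately show "((\<lambda>w. (cmod (G w))\<^sup>2) has_derivative blinfun_apply (J (k w))) (at w)"
      by simp
    have "(k has_derivative (\<lambda>h. 2 * (cnj (G w) * (deriv (deriv G) w * h) + cnj (deriv G w * h) * deriv G w))) (at w)"
      unfolding k_def by (rule has_derivative_mult_right[OF has_derivative_mult[OF cg g']])
    from bounded_linear.has_derivative[OF bJ this]
    have "((\<lambda>w. J (k w)) has_derivative
        (\<lambda>h. J (2 * (cnj (G w) * (deriv (deriv G) w * h) + cnj (deriv G w * h) * deriv G w)))) (at w)" .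
    moreover have "(\<lambda>h. J (2 * (cnj (G w) * (deriv (deriv G) w * h) + cnj (deriv G w * h) * deriv G w))) = blinfun_apply (f'' w)"
      by (simp add: fun_eq_iff f''_def bounded_linear_Blinfun_apply bJ bounded_linear_cnj plus_blinfun.rep_eq A_def B_def algebra_simps)
    ultimately show "((\<lambda>w. J (k w)) has_derivative blinfun_apply (f'' w)) (at w)"
      by simp
  next
    have c: "continuous_on V A" "continuous_on V B"
      unfolding A_def B_def
      by (intro continuous_intros holomorphic_on_imp_continuous_on G hG' hG'')+
    show "continuous_on V f''"
      unfolding f''_def
      by (intro bounded_bilinear.continuous_on[OF bounded_bilinear_blinfun_compose] continuous_on_const
          continuous_on_add bounded_linear.continuous_on[OF bounded_linear_blinfun_mult_right] c)
  qed
qed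

text \<open>The constant \<open>1 / 4\<close> is a loss from bounding \<open>|G|\<close> below by half its linearization.\<close>

lemma complex_hessian_cmod_sq_lower:
  fixes u :: "complex ^ 'n::finite \<Rightarrow> real"
  assumes V: "open V" "p \<in> V" "C2_on V u" and up: "u p = 0" and "k > 0"
    and G: "(G has_field_derivative D) (at w0)" "G w0 = 0" "D \<noteq> 0" and N1: "norm N = 1" and \<kappa>: "cmod \<kappa> = 1"
    and ge: "\<And>z. z \<in> V \<Longrightarrow> k * (cmod (G (w0 + herm_inner (z - p) N)))\<^sup>2 \<le> u z"
  shows "k * (cmod D)\<^sup>2 / 4 \<le> Re (complex_hessian u p (\<kappa> *s N) (\<kappa> *s N))"
proof -
  have D: "cmod D > 0"
    using \<open>D \<noteq> 0\<close> by simp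
  obtain d0 where d0: "d0 > 0" "\<And>t. cmod t < d0 \<Longrightarrow> cmod D * cmod t / 2 \<le> cmod (G (w0 + t))"
  proof -
    have "(G has_derivative (\<lambda>h. D * h)) (at w0)"
      using G(1) by (simp add: has_field_derivative_def)
    then obtain d where d: "d > 0" "\<And>y. cmod (y - w0) < d \<Longrightarrow> cmod (G y - G w0 - D * (y - w0)) \<le> cmod D / 2 * cmod (y - w0)"
      using D unfolding has_derivative_at_alt by (meson half_gt_zero)
    show ?thesis
    proof (rule that[OF d(1)])
      fix t assume t: "cmod t < d"
      have "cmod (G (w0 + t) - D * t) \<le> cmod D / 2 * cmod t"
        using d(2)[of "w0 + t"] t G(2) by simp
      moreover have "cmod (D * t) \<le> cmod (G (w0 + t)) + cmod (G (w0 + t) - D * t)"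
        using norm_triangle_sub[of "D * t" "G (w0 + t)"] by (simp add: norm_minus_commute)
      ultimately show "cmod D * cmod t / 2 \<le> cmod (G (w0 + t))"
        by (simp add: norm_mult)
    qed
  qed
  obtain R where R: "R > 0" "ball p R \<subseteq> V"
    using V open_contains_ball by blast
  show ?thesis
  proof (rule complex_hessian_ge_on_line[OF V up, of "min R d0"])
    fix t assume t: "cmod t < min R d0"
    have "norm (t *s (\<kappa> *s N)) < R"
      using t N1 \<kappa> by (simp add: norm_smult_vec norm_mult)
    then have "p + t *s (\<kappa> *s N) \<in> V"
      using R(2) by (auto simp: dist_norm)
    then have "k * (cmod (G (w0 + herm_inner (t *s (\<kappa> *s N)) N)))\<^sup>2 \<le> u (p + t *s (\<kappa> *s N))"
      using ge[of "p + t *s (\<kappa> *s N)"] by simp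
    moreover have "herm_inner (t *s (\<kappa> *s N)) N = t * \<kappa>"
      using N1 by (simp add: herm_inner_scale_left herm_inner_self)
    moreover have "cmod D * cmod (t * \<kappa>) / 2 \<le> cmod (G (w0 + t * \<kappa>))"
      using t \<kappa> by (intro d0) (simp add: norm_mult)
    then have "k * (cmod D * cmod t / 2)\<^sup>2 \<le> k * (cmod (G (w0 + t * \<kappa>)))\<^sup>2"
      using \<kappa> \<open>k > 0\<close> by (intro mult_left_mono power_mono) (simp_all add: norm_mult)
    ultimately show "k * (cmod D)\<^sup>2 / 4 * (cmod t)\<^sup>2 \<le> u (p + t *s (\<kappa> *s N))"
      by (simp add: power_mult_distrib power_divide)
  qed (use R(1) d0(1) in simp)
qed

text \<open>The competitor \<open>max u1 u2\<close> is \<open>u1 = |csqrt h - s0|\<^sup>2 + |z - p|\<^sup>2\<close> near \<open>p\<close> and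
  \<open>u2 = A |z - p| powr (2 + 2 \<eta>)\<close> where \<open>Re h\<close> is negative.  Since \<open>\<eta> = 1 / ln (1 / \<delta>)\<close>, the factor
  \<open>|z - p| powr (2 \<eta>)\<close> is at least \<open>exp (- 2)\<close> where \<open>|z - p| \<ge> \<delta>\<close> and still tends to 0 at \<open>p\<close>.\<close>

lemma sibony_lower:
  fixes \<Omega> :: "(complex ^ 'n::finite) set"
  assumes "bounded \<Omega>" and N1: "norm N = 1" and \<kappa>: "cmod \<kappa> = 1" and MR: "M > 0" "R > 0"
    and outer: "\<And>v. norm v < R \<Longrightarrow> P + v \<in> \<Omega> \<Longrightarrow> 0 < N \<bullet> v + M * (norm v)\<^sup>2"
  obtains c where "c > 0"
    "\<forall>\<^sub>F \<delta> in at_right 0. ereal (c * (1 / \<delta> powr (1 / 2))) \<le> sibony_metric \<Omega> (P + \<delta> *\<^sub>R N) (\<kappa> *s N)"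
proof -
  obtain B0 where B0: "\<And>z. z \<in> \<Omega> \<Longrightarrow> norm z \<le> B0"
    using assms(1) unfolding bounded_iff by blast
  define D where "D = \<bar>B0\<bar> + norm P + 2"
  have D: "D \<ge> 1"
    by (simp add: D_def add_nonneg_nonneg)
  define r1 where "r1 = min R (1 / (2 * M))"
  have r1: "r1 > 0" "r1 \<le> R" "M * r1 \<le> 1 / 2"
  proof -
    have "M * r1 \<le> M * (1 / (2 * M))"
      using MR by (intro mult_left_mono) (auto simp: r1_def)
    then show "M * r1 \<le> 1 / 2"
      using MR by simp
  qed (use MR in \<open>auto simp: r1_def\<close>)
  define r0 where "r0 = r1 / 2"
  have r0: "r0 > 0" "r0 < r1"
    using r1 by (auto simp: r0_def)
  \<comment> \<open>\<open>exp 2\<close> compensates the lower bound \<open>exp (- 2)\<close> of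
    \<open>|z - p| powr (2 * \<eta>)\<close>. In the bracket, \<open>64 * M\<close> covers the
    frontier of \<open>Q\<close> inside the ball, \<open>28 / r0\<close> the sphere of radius
    \<open>r0\<close>, and 2 the summand \<open>|z - p|^2\<close> of \<open>u1\<close> with room for
    a strict inequality.\<close>
  define A where "A = exp 2 * (64 * M + 28 / r0 + 2)"
  have A: "A > 0" "A * exp (- 2) = 64 * M + 28 / r0 + 2"
    using MR r0 by (simp_all add: A_def exp_minus add_pos_pos)
  \<comment> \<open>A bound for the glued function on the domain: \<open>\<eta> \<le> 1\<close>
    makes the exponent in \<open>u2\<close> at most 4, and \<open>u1\<close> is at most
    \<open>7 * r0 + D\<^sup>2\<close> on \<open>Q\<close>. The competitor is divided by it.\<close>
  define M0 where "M0 = A * D ^ 4 + 7 * r0 + D\<^sup>2"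
  have M0: "M0 > 0"
    using A(1) D r0 by (simp add: M0_def add_pos_nonneg)
  define k where "k = 1 / M0"
  have k: "k > 0"
    using M0 by (simp add: k_def)
  have NN: "herm_inner N N = 1"
    using N1 by (simp add: herm_inner_self)
  define \<omega> where "\<omega> z = herm_inner (z - P) N" for z
  have \<omega>_le: "cmod (\<omega> z) \<le> norm (z - P)" for z
    using norm_herm_inner_le[of "z - P" N] N1 by (simp add: \<omega>_def)
  have cont_\<omega>: "continuous_on S \<omega>" for S
    unfolding \<omega>_def by (intro continuous_intros)
  define mob where "mob w = w / (1 + of_real M * w)" for w :: complex
  have nz: "1 / 2 \<le> cmod (1 + of_real M * w) \<and> 1 + of_real M * w \<noteq> 0" if "cmod w < r1" for w
  proof -
    have "M * cmod w \<le> M * r1"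
      using that MR by (intro mult_left_mono) auto
    then have "M * cmod w \<le> 1 / 2"
      using r1(3) by linarith
    then have "cmod (of_real M * w) \<le> 1 / 2"
      using MR by (simp add: norm_mult)
    then have "1 / 2 \<le> cmod (1 + of_real M * w)"
      using norm_triangle_ineq4[of "1 + of_real M * w" "of_real M * w"] by simp
    then show ?thesis by auto
  qed
  have mob_le: "cmod (mob w) \<le> 2 * cmod w" if "cmod w < r1" for w
  proof -
    have "cmod w / cmod (1 + of_real M * w) \<le> cmod w / (1 / 2)"
      using nz[OF that] by (intro divide_left_mono mult_pos_pos) auto
    then show ?thesis
      by (simp add: mob_def norm_divide mult.commute)
  qed
  have hol_mob: "mob holomorphic_on ball 0 r1"
    unfolding mob_def using nz by (intro holomorphic_intros) auto
  \<comment> \<open>The bound \<open>exp (- 1)\<close> gives \<open>\<eta> \<le> 1\<close>,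
    \<open>r0 / 2\<close> puts \<open>p\<close> well inside the ball, and \<open>1 / (8 * M)\<close>
    yields \<open>\<delta> \<le> |z - p|\<close> on the frontier of \<open>Q\<close> inside the
    ball.\<close>
  have main: "\<exists>u \<in> sibony_class \<Omega> p. k / (512 * \<delta>) \<le> Re (complex_hessian u p (\<kappa> *s N) (\<kappa> *s N))"
    if \<delta>: "0 < \<delta>" "\<delta> < exp (- 1)" "\<delta> < r0 / 2" "\<delta> < 1 / (8 * M)" and p: "p = P + \<delta> *\<^sub>R N" for \<delta> p
  proof -
    have "exp (- 1) < (1::real)"
      by simp
    then have \<delta>1: "\<delta> < 1"
      using \<delta>(2) by linarith
    have ln\<delta>: "ln \<delta> \<le> - 1"
      using \<delta>(1,2) by (metis ln_exp ln_le_cancel_iff exp_gt_zero less_imp_le)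
    define \<eta> where "\<eta> = - 1 / ln \<delta>"
    have \<eta>: "\<eta> > 0" "\<eta> \<le> 1" "\<eta> * ln \<delta> = - 1"
      using ln\<delta> by (simp_all add: \<eta>_def field_simps)
    \<comment> \<open>The shift by \<open>\<delta>\<close> pushes the singular set of the root away
      from \<open>p\<close>: within the ball of radius \<open>r0\<close>, a point of the domain with
      \<open>q \<le> \<delta> / 8\<close> has tangential part at least of order
      \<open>sqrt \<delta>\<close>.\<close>
    define h where "h w = mob w + of_real \<delta>" for w
    have hol_h: "h holomorphic_on ball 0 r1"
      unfolding h_def by (intro holomorphic_intros hol_mob)
    have cont_h: "continuous_on (ball 0 r1) h"
      by (rule holomorphic_on_imp_continuous_on[OF hol_h])
    define W where "W = ball 0 r1 \<inter> h -` (- \<real>\<^sub>\<le>\<^sub>0)"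
    have "open W"
      unfolding W_def by (intro continuous_open_preimage cont_h) (auto simp: closed_nonpos_Reals_complex open_Compl)
    define s0 where "s0 = csqrt (h (of_real \<delta>))"
    define G where "G w = csqrt (h w) - s0" for w
    have hol_G: "G holomorphic_on W"
    proof -
      have "h holomorphic_on W"
        by (rule holomorphic_on_subset[OF hol_h]) (auto simp: W_def)
      then show ?thesis
        unfolding G_def by (intro holomorphic_intros) (auto simp: W_def)
    qed
    define V where "V = ball P r1 \<inter> \<omega> -` W"
    have "open V"
      unfolding V_def by (intro continuous_open_preimage cont_\<omega> \<open>open W\<close> open_ball)
    define g where "g z = G (\<omega> z)" for z
    have hol_g: "holomorphic_fun_on g V"
      unfolding holomorphic_fun_on_def
    proof
      fix z assume "z \<in> V"
      then have dG: "(G has_derivative (*) (deriv G (\<omega> z))) (at (\<omega> z))"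
        using holomorphic_derivI[OF hol_G \<open>open W\<close>, of "\<omega> z"] by (simp add: V_def has_field_derivative_def)
      have d\<omega>: "(\<omega> has_derivative (\<lambda>v. herm_inner v N)) (at z)"
      proof -
        have "((\<lambda>z. z - P) has_derivative (\<lambda>v. v)) (at z)"
          by (auto intro!: derivative_eq_intros)
        from has_derivative_herm_inner[OF this] show ?thesis
          by (simp add: \<omega>_def[abs_def])
      qed
      have "(g has_derivative (\<lambda>v. deriv G (\<omega> z) * herm_inner v N)) (at z)"
        unfolding g_def by (rule has_derivative_compose[OF d\<omega> dG])
      then show "\<exists>D. (g has_derivative D) (at z) \<and> (\<forall>c v. D (c *s v) = c * D v)"
        by (intro exI conjI) (auto simp: herm_inner_scale_left)
    qed
    \<comment> \<open>The condition \<open>q > 0\<close> excludes a sector around the negative axis,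
      where the root is discontinuous. The term \<open>cmod (h (\<omega> z)) / 4\<close> makes the
      outer bound control all of \<open>|h|\<close>, and not only its real part, where
      \<open>q \<le> \<delta> / 8\<close>.\<close>
    define q where "q z = Re (h (\<omega> z)) + cmod (h (\<omega> z)) / 4" for z
    have h_q: "continuous_on (ball P r1) (\<lambda>z. h (\<omega> z))"
      by (rule continuous_on_compose2[OF cont_h cont_\<omega>])
         (auto simp: dist_norm norm_minus_commute intro: le_less_trans[OF \<omega>_le])
    have cont_q: "continuous_on (ball P r1) q"
      unfolding q_def by (intro continuous_intros h_q) auto
    define Q where "Q = ball P r0 \<inter> q -` {\<delta> / 8 <..}"
    have "open Q"
      unfolding Q_def using r0
      by (intro continuous_open_preimage continuous_on_subset[OF cont_q]) auto
    have closed_C: "closed (cball P r0 \<inter> q -` {\<delta> / 8..})"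
      using r0 by (intro continuous_closed_preimage continuous_on_subset[OF cont_q]) auto
    have cl_Q: "closure Q \<subseteq> cball P r0 \<inter> q -` {\<delta> / 8..}"
      by (rule closure_minimal[OF _ closed_C]) (auto simp: Q_def)
    have "cball P r0 \<inter> q -` {\<delta> / 8..} \<subseteq> V"
    proof
      fix z assume z: "z \<in> cball P r0 \<inter> q -` {\<delta> / 8..}"
      then have zr: "norm (z - P) < r1"
        using r0 by (simp add: dist_norm norm_minus_commute)
      have "q z > 0"
        using z \<delta>(1) by simp
      have "h (\<omega> z) \<notin> \<real>\<^sub>\<le>\<^sub>0"
      proof
        assume "h (\<omega> z) \<in> \<real>\<^sub>\<le>\<^sub>0"
        then have "Re (h (\<omega> z)) \<le> 0" "cmod (h (\<omega> z)) = - Re (h (\<omega> z))"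
          by (auto simp: complex_nonpos_Reals_iff cmod_eq_Re)
        then show False
          using \<open>q z > 0\<close> by (simp add: q_def)
      qed
      then show "z \<in> V"
        using zr \<omega>_le[of z] by (simp add: V_def W_def dist_norm norm_minus_commute)
    qed
    then have "closure Q \<subseteq> V"
      using cl_Q by blast
    have hd: "h (of_real \<delta>) = of_real (\<delta> / (1 + M * \<delta>) + \<delta>)"
      by (simp add: h_def mob_def)
    have M\<delta>: "0 < M * \<delta>" "M * \<delta> \<le> 1"
      using \<delta> MR by (simp_all add: field_simps)
    have hd_pos: "0 < \<delta> / (1 + M * \<delta>)" "\<delta> / (1 + M * \<delta>) \<le> \<delta>"
    proof -
      show "0 < \<delta> / (1 + M * \<delta>)"
        using \<delta>(1) M\<delta> by simp
      have "\<delta> / (1 + M * \<delta>) \<le> \<delta> / 1"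
        using \<delta>(1) M\<delta> by (intro divide_left_mono) auto
      then show "\<delta> / (1 + M * \<delta>) \<le> \<delta>"
        by simp
    qed
    have hd_norm: "cmod (h (of_real \<delta>)) = \<delta> / (1 + M * \<delta>) + \<delta>"
      unfolding hd norm_of_real using hd_pos \<delta>(1) by simp
    have \<omega>p: "\<omega> p = of_real \<delta>"
      by (simp add: \<omega>_def p herm_inner_scaleR_left NN)
    define u1 where "u1 z = (cmod (g z))\<^sup>2 + (norm (z - p))\<^sup>2" for z
    define u2 where "u2 z = A * norm (z - p) powr (2 + 2 * \<eta>)" for z
    define u where "u z = (if z \<in> Q then max (u1 z) (u2 z) else u2 z)" for z
    have g_le: "(cmod (g z))\<^sup>2 \<le> 2 * cmod (h (\<omega> z)) + 4 * \<delta>" for z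
    proof -
      have sq: "(cmod (csqrt x))\<^sup>2 = cmod x" for x
        by (simp add: norm_power[symmetric])
      have "cmod (g z) \<le> cmod (csqrt (h (\<omega> z))) + cmod s0"
        unfolding g_def G_def by (rule norm_triangle_ineq4)
      then have "(cmod (g z))\<^sup>2 \<le> (cmod (csqrt (h (\<omega> z))) + cmod s0)\<^sup>2"
        by (intro power_mono) auto
      also have "\<dots> \<le> 2 * (cmod (csqrt (h (\<omega> z))))\<^sup>2 + 2 * (cmod s0)\<^sup>2"
        using sum_squares_bound[of "cmod (csqrt (h (\<omega> z)))" "cmod s0"] by (simp add: power2_sum)
      also have "(cmod s0)\<^sup>2 \<le> 2 * \<delta>"
        unfolding s0_def sq hd_norm using hd_pos by simp
      finally show ?thesis
        unfolding sq by simp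
    qed
    have u2_ge: "(64 * M + 28 / r0 + 2) * x\<^sup>2 \<le> A * x powr (2 + 2 * \<eta>)" if x: "x \<ge> \<delta>" for x
    proof -
      have x0: "x > 0"
        using x \<delta>(1) by simp
      have "\<delta> powr (2 * \<eta>) = exp (- 2)"
        using \<delta>(1) \<eta>(3) by (simp add: powr_def mult.assoc)
      then have "exp (- 2) \<le> x powr (2 * \<eta>)"
        using powr_mono2[of "2 * \<eta>" \<delta> x] x \<delta>(1) \<eta>(1) by simp
      then have "A * exp (- 2) * x\<^sup>2 \<le> A * x powr (2 * \<eta>) * x\<^sup>2"
        using A(1) by (intro mult_right_mono mult_left_mono) auto
      also have "\<dots> = A * x powr (2 + 2 * \<eta>)"
        using x0 by (simp add: powr_add)
      finally show ?thesis
        unfolding A(2) .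
    qed
    have bd: "u1 z < u2 z" if z: "z \<in> \<Omega> \<inter> frontier Q" for z
    proof -
      have z': "z \<in> closure Q" "z \<notin> Q"
        using z \<open>open Q\<close> by (auto simp: frontier_def interior_open)
      have "z \<in> cball P r0 \<inter> q -` {\<delta> / 8..}"
        using z'(1) cl_Q by (rule rev_subsetD)
      then have zC: "norm (z - P) \<le> r0" "\<delta> / 8 \<le> q z"
        by (auto simp: dist_norm norm_minus_commute)
      have zQ: "\<not> (norm (z - P) < r0 \<and> \<delta> / 8 < q z)"
        using z'(2) by (auto simp: Q_def dist_norm norm_minus_commute)
      have zr1: "cmod (\<omega> z) < r1"
        using zC(1) r0 \<omega>_le[of z] by linarith
      define x where "x = norm (z - p)"
      consider "norm (z - P) = r0" | "norm (z - P) < r0" "q z \<le> \<delta> / 8"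
        using zC zQ by linarith
      then have "x \<ge> \<delta> \<and> x > 0 \<and> (cmod (g z))\<^sup>2 \<le> (64 * M + 28 / r0) * x\<^sup>2"
      proof cases
        case 1
        have "norm (z - P) \<le> x + norm (p - P)"
          using norm_triangle_ineq[of "z - p" "p - P"] by (simp add: x_def)
        then have x: "x \<ge> r0 / 2"
          using 1 N1 \<delta> by (simp add: p)
        then have "x\<^sup>2 \<ge> (r0 / 2)\<^sup>2"
          using r0 by (intro power_mono) auto
        then have "28 / r0 * (r0 / 2)\<^sup>2 \<le> 28 / r0 * x\<^sup>2"
          using r0 by (intro mult_left_mono) auto
        then have "7 * r0 \<le> 28 / r0 * x\<^sup>2"
          using r0 by (simp add: power2_eq_square)
        moreover have "cmod (h (\<omega> z)) \<le> 2 * r0 + \<delta>"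
          using mob_le[OF zr1] \<omega>_le[of z] zC(1) \<delta>(1) norm_triangle_ineq[of "mob (\<omega> z)" "of_real \<delta>"]
          by (simp add: h_def)
        then have "(cmod (g z))\<^sup>2 \<le> 7 * r0"
          using g_le[of z] \<delta>(3) by linarith
        moreover have "0 \<le> 64 * M * x\<^sup>2"
          using MR by simp
        ultimately have "(cmod (g z))\<^sup>2 \<le> (64 * M + 28 / r0) * x\<^sup>2"
          by (simp add: distrib_right)
        then show ?thesis
          using x \<delta> r0 by simp
      next
        case 2
        define y where "y = (norm (z - P - \<omega> z *s N))\<^sup>2"
        have "0 < N \<bullet> (z - P) + M * (norm (z - P))\<^sup>2"
          using z 2(1) r0 r1 by (intro outer) auto
        moreover have "N \<bullet> (z - P) = Re (\<omega> z)"
          by (simp add: \<omega>_def Re_herm_inner inner_commute)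
        ultimately have pos: "0 < Re (\<omega> z) + M * ((cmod (\<omega> z))\<^sup>2 + y)"
          using norm_decomp[OF N1, of "z - P"] by (simp add: \<omega>_def y_def)
        have "M * cmod (\<omega> z) \<le> M * r1"
          using zr1 MR by (intro mult_left_mono) auto
        then have "M * cmod (\<omega> z) \<le> 1 / 2"
          using r1(3) by linarith
        then have Rem: "Re (mob (\<omega> z)) > - 4 * M * y"
          unfolding mob_def using MR by (intro Re_divide_moebius(1)[OF pos]) (simp_all add: y_def)
        have hy: "7 / 8 * \<delta> + cmod (h (\<omega> z)) / 4 \<le> 4 * M * y"
          using 2(2) Rem by (simp add: q_def h_def)
        have hz: "herm_inner (z - p) N = \<omega> z - of_real \<delta>"
          by (simp add: p \<omega>_def herm_inner_diff_left herm_inner_add_left herm_inner_scaleR_left NN)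
        \<comment> \<open>The tangential parts of \<open>z - p\<close> and \<open>z - P\<close>
          agree because \<open>p - P\<close> is a multiple of \<open>N\<close>; hence the tangential
          distance is at most \<open>|z - p|\<close>.\<close>
        have eq: "z - p - herm_inner (z - p) N *s N = z - P - \<omega> z *s N"
          unfolding hz by (simp add: p scaleR_eq_smult vec_eq_iff algebra_simps)
        have "y \<le> x\<^sup>2"
          using norm_decomp[OF N1, of "z - p"] unfolding x_def y_def eq by simp
        then have My: "M * y \<le> M * x\<^sup>2"
          using MR by (intro mult_left_mono) auto
        have "\<delta>\<^sup>2 \<le> x\<^sup>2"
        proof -
          have "M * (8 * \<delta>\<^sup>2) \<le> \<delta>"
            using \<delta>(1,4) MR by (simp add: field_simps power2_eq_square)
          also have "\<delta> \<le> M * (8 * x\<^sup>2)"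
            using hy My norm_ge_zero[of "h (\<omega> z)"] \<delta>(1) by (simp only: mult.assoc mult.left_commute[of M])
          finally show ?thesis
            using MR by simp
        qed
        then have "\<delta> \<le> x"
          by (rule power2_le_imp_le) (simp add: x_def)
        moreover have "(cmod (g z))\<^sup>2 \<le> 64 * M * x\<^sup>2"
          using g_le[of z] hy My norm_ge_zero[of "h (\<omega> z)"] \<delta>(1) by linarith
        moreover have "0 \<le> 28 / r0 * x\<^sup>2"
          using r0 by simp
        ultimately show ?thesis
          using \<delta>(1) by (simp add: distrib_right)
      qed
      then have x: "x \<ge> \<delta>" "x > 0" "(cmod (g z))\<^sup>2 \<le> (64 * M + 28 / r0) * x\<^sup>2"
        by auto
      have "u1 z \<le> (64 * M + 28 / r0) * x\<^sup>2 + x\<^sup>2"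
        using x(3) by (simp add: u1_def x_def)
      also have "\<dots> < (64 * M + 28 / r0) * x\<^sup>2 + 2 * x\<^sup>2"
        using x(2) by simp
      also have "\<dots> = (64 * M + 28 / r0 + 2) * x\<^sup>2"
        by (simp add: distrib_right)
      also have "\<dots> \<le> u2 z"
        using u2_ge[OF x(1)] by (simp add: u2_def x_def)
      finally show ?thesis .
    qed
    have s: "2 + 2 * \<eta> > 0"
      using \<eta> by simp
    note glued = plurisubharmonic_glued[OF \<open>open Q\<close> \<open>open V\<close> \<open>closure Q \<subseteq> V\<close> hol_g A(1) s k u1_def u2_def bd u_def]
    have u_nonneg: "0 \<le> u z" for z
      using A(1) by (simp add: u_def u2_def le_max_iff_disj)
    have u_le: "u z \<le> M0" if z: "z \<in> \<Omega>" for z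
    proof -
      have "norm p \<le> norm P + 1"
        using norm_triangle_ineq[of P "\<delta> *\<^sub>R N"] N1 \<delta>(1) \<delta>1 by (simp add: p)
      then have n: "norm (z - p) \<le> D"
        using B0[OF z] norm_triangle_ineq4[of z p] by (simp add: D_def)
      have "norm (z - p) powr (2 + 2 * \<eta>) \<le> D powr (2 + 2 * \<eta>)"
        using n s by (intro powr_mono2) auto
      also have "\<dots> \<le> D powr 4"
        using D \<eta>(2) by (intro powr_mono) auto
      also have "\<dots> = D ^ 4"
        using D by simp
      finally have "u2 z \<le> A * D ^ 4"
        using A(1) by (simp add: u2_def)
      then have 2: "u2 z \<le> M0"
        using r0 by (simp add: M0_def add_nonneg_nonneg add_increasing2)
      have 1: "u1 z \<le> M0" if zQ: "z \<in> Q"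
      proof -
        have zr: "norm (z - P) < r0"
          using zQ by (simp add: Q_def dist_norm norm_minus_commute)
        then have zr1: "cmod (\<omega> z) < r1"
          using r0 \<omega>_le[of z] by linarith
        have "cmod (h (\<omega> z)) \<le> 2 * r0 + \<delta>"
          using mob_le[OF zr1] \<omega>_le[of z] zr \<delta>(1) norm_triangle_ineq[of "mob (\<omega> z)" "of_real \<delta>"]
          by (simp add: h_def)
        then have "(cmod (g z))\<^sup>2 \<le> 7 * r0"
          using g_le[of z] \<delta>(3) by linarith
        moreover have "(norm (z - p))\<^sup>2 \<le> D\<^sup>2"
          using n by (intro power_mono) auto
        moreover have "0 \<le> A * D ^ 4"
          using A(1) D by simp
        ultimately show ?thesis
          by (simp add: u1_def M0_def)
      qed
      show ?thesis
        using 1 2 by (simp add: u_def)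
    qed
    \<comment> \<open>Chosen with \<open>A * d powr (2 * \<eta>) = 1\<close>: within this distance
      \<open>u2\<close> is at most \<open>|z - p|^2\<close>, so the glued function equals the smooth
      \<open>u1\<close> near \<open>p\<close>.\<close>
    define d where "d = A powr (- 1 / (2 * \<eta>))"
    have d: "d > 0"
      using A(1) by (simp add: d_def)
    have u2_le: "u2 z \<le> u1 z" if "norm (z - p) < d" for z
    proof (cases "z = p")
      case True
      then show ?thesis
        by (simp add: u1_def u2_def)
    next
      case False
      define x where "x = norm (z - p)"
      have x0: "x > 0"
        using False by (simp add: x_def)
      have "x powr (2 * \<eta>) \<le> d powr (2 * \<eta>)"
        using that x0 \<eta>(1) by (intro powr_mono2) (auto simp: x_def)
      also have "d powr (2 * \<eta>) = A powr (- 1 / (2 * \<eta>) * (2 * \<eta>))"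
        unfolding d_def powr_powr ..
      also have "- 1 / (2 * \<eta>) * (2 * \<eta>) = - 1"
        using \<eta>(1) by simp
      also have "A powr - 1 = 1 / A"
        using A(1) by (rule powr_neg_one)
      finally have "A * x powr (2 * \<eta>) \<le> 1"
        using A(1) by (simp add: field_simps)
      then have "A * x powr (2 * \<eta>) * x\<^sup>2 \<le> 1 * x\<^sup>2"
        by (rule mult_right_mono) simp
      then have "u2 z \<le> x\<^sup>2"
        using x0 by (simp add: u2_def x_def[symmetric] powr_add mult_ac)
      then show ?thesis
        by (simp add: u1_def x_def add_increasing)
    qed
    define X where "X = V \<inter> Q \<inter> ball p d"
    have "open X"
      unfolding X_def by (intro open_Int \<open>open V\<close> \<open>open Q\<close> open_ball)
    have pQ: "p \<in> Q"
    proof -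
      have "\<delta> / 8 < q p"
      proof -
        have *: "\<delta> / 8 < x + \<delta> + (x + \<delta>) / 4" if "x > 0" for x
          using that \<delta>(1) by (simp add: add_divide_distrib)
        show ?thesis
          unfolding q_def \<omega>p unfolding hd_norm unfolding hd Re_complex_of_real by (rule *[OF hd_pos(1)])
      qed
      moreover have "norm (p - P) < r0"
        using N1 \<delta>(1,3) r0 by (simp add: p)
      ultimately show ?thesis
        by (simp add: Q_def dist_norm norm_minus_commute)
    qed
    then have "p \<in> X"
      using \<open>closure Q \<subseteq> V\<close> closure_subset d by (auto simp: X_def)
    have u_X: "u z = u1 z" if "z \<in> X" for z
      using that u2_le[of z] by (simp add: X_def u_def dist_norm norm_minus_commute)
    have g_p: "g p = 0"
      by (simp add: g_def \<omega>p G_def s0_def)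
    have up: "u p = 0"
      using u_X[OF \<open>p \<in> X\<close>] g_p by (simp add: u1_def)
    have C2: "C2_on X (\<lambda>z. k * u z)"
    proof (rule C2_on_open_cong[OF \<open>open X\<close>])
      show "C2_on X (\<lambda>z. k * ((cmod (G (herm_inner (z - P) N)))\<^sup>2 + (norm (z - p))\<^sup>2))"
      proof (intro C2_on_scale C2_on_add C2_on_norm_sq)
        show "C2_on X (\<lambda>z. (cmod (G (herm_inner (z - P) N)))\<^sup>2)"
          by (rule C2_on_compose_affine[OF bounded_linear_herm_inner C2_on_cmod_sq_holomorphic[OF hol_G \<open>open W\<close>]])
             (simp add: X_def V_def \<omega>_def)
      qed
    qed (simp add: u_X u1_def g_def \<omega>_def)
    have in_class: "(\<lambda>z. k * u z) \<in> sibony_class \<Omega> p"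
    proof -
      have "k * u z \<le> 1" if "z \<in> \<Omega>" for z
        using u_le[OF that] M0 by (simp add: k_def)
      then show ?thesis
        unfolding sibony_class_def using glued up C2 \<open>open X\<close> \<open>p \<in> X\<close> u_nonneg k by auto
    qed
    \<comment> \<open>The derivative of \<open>csqrt h\<close> at \<open>\<delta>\<close>. Since
      \<open>h\<close> is there at most \<open>2 * \<delta>\<close>, division by the root makes
      \<open>|E|^2\<close> of order \<open>1 / \<delta>\<close>; the constant 128 is
      \<open>4 * 2 * 16\<close>, with 16 bounding \<open>(1 + M * \<delta>) ^ 4\<close>.\<close>
    define E where "E = (1 / (1 + of_real M * of_real \<delta>)\<^sup>2) / (2 * s0)"
    have nzd: "1 + of_real M * complex_of_real \<delta> = of_real (1 + M * \<delta>)"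
      by simp
    have s0: "s0 \<noteq> 0"
      using hd_pos \<delta>(1) by (simp add: s0_def hd del: of_real_add of_real_divide)
    have dG: "(G has_field_derivative E) (at (of_real \<delta>))"
    proof -
      have nz': "1 + of_real M * complex_of_real \<delta> \<noteq> 0"
        unfolding nzd of_real_eq_0_iff using M\<delta> by simp
      have "(h has_field_derivative (1 / (1 + of_real M * of_real \<delta>)\<^sup>2)) (at (of_real \<delta>))"
        unfolding h_def mob_def using nz'
        by (auto intro!: derivative_eq_intros simp: power2_eq_square)
      moreover have "h (of_real \<delta>) \<notin> \<real>\<^sub>\<le>\<^sub>0"
        using hd_pos \<delta>(1) by (simp add: hd complex_nonpos_Reals_iff del: of_real_add of_real_divide)
      ultimately have "((\<lambda>w. csqrt (h w)) has_field_derivative E) (at (of_real \<delta>))"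
        unfolding E_def s0_def by (rule has_field_derivative_csqrt')
      from DERIV_diff[OF this DERIV_const[of s0]]
      show ?thesis
        by (simp add: G_def[abs_def])
    qed
    have E_ge: "1 / (128 * \<delta>) \<le> (cmod E)\<^sup>2"
    proof -
      have "(cmod s0)\<^sup>2 = cmod (h (of_real \<delta>))"
        by (simp add: s0_def norm_power[symmetric])
      also have "\<dots> \<le> 2 * \<delta>"
        unfolding hd_norm using hd_pos by simp
      finally have s0_le: "(cmod s0)\<^sup>2 \<le> 2 * \<delta>" .
      have "(1 + M * \<delta>)\<^sup>2 \<le> 2\<^sup>2"
        using M\<delta> by (intro power_mono) auto
      then have "((1 + M * \<delta>)\<^sup>2)\<^sup>2 \<le> 4\<^sup>2"
        by (intro power_mono) auto
      then have "((1 + M * \<delta>)\<^sup>2)\<^sup>2 * (4 * (cmod s0)\<^sup>2) \<le> 4\<^sup>2 * (4 * (2 * \<delta>))"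
        using s0_le by (intro mult_mono) auto
      moreover have "0 < ((1 + M * \<delta>)\<^sup>2)\<^sup>2 * (4 * (cmod s0)\<^sup>2)"
        using s0 M\<delta> by (intro mult_pos_pos zero_less_power) auto
      ultimately have "1 / (4\<^sup>2 * (4 * (2 * \<delta>))) \<le> 1 / (((1 + M * \<delta>)\<^sup>2)\<^sup>2 * (4 * (cmod s0)\<^sup>2))"
        using \<delta>(1) by (intro divide_left_mono mult_pos_pos) auto
      moreover have "cmod E = 1 / ((1 + M * \<delta>)\<^sup>2 * (2 * cmod s0))"
        unfolding E_def nzd using M\<delta> by (simp add: norm_mult norm_divide norm_power del: of_real_add)
      ultimately show ?thesis
        by (simp add: power_divide power_mult_distrib)
    qed
    have E0: "E \<noteq> 0"
      using E_ge \<delta>(1) by auto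
    have "k * (cmod E)\<^sup>2 / 4 \<le> Re (complex_hessian (\<lambda>z. k * u z) p (\<kappa> *s N) (\<kappa> *s N))"
    proof (rule complex_hessian_cmod_sq_lower[OF \<open>open X\<close> \<open>p \<in> X\<close> C2 _ k dG _ E0 N1 \<kappa>])
      show "k * u p = 0"
        using up by simp
      show "G (of_real \<delta>) = 0"
        by (simp add: G_def s0_def)
      fix z assume z: "z \<in> X"
      have "of_real \<delta> + herm_inner (z - p) N = \<omega> z"
        by (simp add: p \<omega>_def herm_inner_diff_left herm_inner_add_left herm_inner_scaleR_left NN)
      then show "k * (cmod (G (of_real \<delta> + herm_inner (z - p) N)))\<^sup>2 \<le> k * u z"
        using k by (simp add: u_X[OF z] u1_def g_def)
    qed
    moreover have "k * (1 / (128 * \<delta>)) / 4 \<le> k * (cmod E)\<^sup>2 / 4"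
      using E_ge k by (intro divide_right_mono mult_left_mono) auto
    ultimately have "k / (512 * \<delta>) \<le> Re (complex_hessian (\<lambda>z. k * u z) p (\<kappa> *s N) (\<kappa> *s N))"
      by simp
    then show ?thesis
      using in_class by blast
  qed
  \<comment> \<open>\<open>512 = 4 * 128\<close> combines the loss in the Hessian estimate with the
    constant in the bound for \<open>E\<close>.\<close>
  show ?thesis
  proof (rule that[of "sqrt (k / 512)"])
    show "sqrt (k / 512) > 0"
      using k by simp
    have "0 < min (exp (- 1)) (min (r0 / 2) (1 / (8 * M)))"
      using r0 MR by simp
    from eventually_at_right_real[OF this]
    show "\<forall>\<^sub>F \<delta> in at_right 0. ereal (sqrt (k / 512) * (1 / \<delta> powr (1 / 2))) \<le> sibony_metric \<Omega> (P + \<delta> *\<^sub>R N) (\<kappa> *s N)"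
    proof eventually_elim
      case (elim \<delta>)
      then obtain u where u: "u \<in> sibony_class \<Omega> (P + \<delta> *\<^sub>R N)"
        "k / (512 * \<delta>) \<le> Re (complex_hessian u (P + \<delta> *\<^sub>R N) (\<kappa> *s N) (\<kappa> *s N))"
        using main[of \<delta> "P + \<delta> *\<^sub>R N"] by auto
      have "sqrt (k / 512) * (1 / \<delta> powr (1 / 2)) = sqrt (k / (512 * \<delta>))"
        using elim by (simp add: powr_half_sqrt real_sqrt_divide real_sqrt_mult)
      also have "\<dots> \<le> sqrt (Re (complex_hessian u (P + \<delta> *\<^sub>R N) (\<kappa> *s N) (\<kappa> *s N)))"
        using u(2) by simp
      finally show ?case
        unfolding sibony_metric_def by (intro SUP_upper2[OF u(1)]) simp
    qed
  qed
qed

theorem theorem1: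
  fixes \<Omega> U :: "(complex ^ 'n::finite) set"
    and P N \<nu> :: "complex ^ 'n"
    and r :: "complex ^ 'n \<Rightarrow> real"
    and \<mu> :: real
  assumes "CARD('n) > 1"
    and "open \<Omega>" and "connected \<Omega>" and "bounded \<Omega>"
    and "has_C2_boundary \<Omega>"
    and "P \<in> frontier \<Omega>"
    and "local_defining_function \<Omega> P U r"
    and "levi_eigenvalue r P \<mu>" and "\<mu> < 0"
    and "inner_unit_normal r P N"
    and "unit_complex_normal r P \<nu>"
  shows "comparable_near_0 (\<lambda>\<delta>. kobayashi_metric \<Omega> (P + \<delta> *\<^sub>R N) \<nu>) (\<lambda>\<delta>. 1 / \<delta> powr (3 / 4))
       \<and> comparable_near_0 (\<lambda>\<delta>. sibony_metric \<Omega> (P + \<delta> *\<^sub>R N) \<nu>) (\<lambda>\<delta>. 1 / \<delta> powr (1 / 2))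
       \<and> comparable_near_0 (\<lambda>\<delta>. caratheodory_metric \<Omega> (P + \<delta> *\<^sub>R N) \<nu>) (\<lambda>\<delta>. 1)"
proof -
  obtain D where D: "(r has_derivative D) (at P)"
    using assms(7) unfolding local_defining_function_def C2_on_def by blast
  have N1: "norm N = 1"
    using assms(10) by (simp add: inner_unit_normal_def)
  obtain \<kappa> where \<kappa>: "cmod \<kappa> = 1" "\<nu> = \<kappa> *s N"
    using unit_complex_normal_eq[OF assms(10) D assms(11)] .
  have \<nu>1: "norm \<nu> = 1"
    using assms(11) by (simp add: unit_complex_normal_def)
  obtain M R where outer: "M > 0" "R > 0"
    "\<And>v. norm v < R \<Longrightarrow> P + v \<in> \<Omega> \<Longrightarrow> 0 < N \<bullet> v + M * (norm v)\<^sup>2"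
    by (rule outer_quadratic_bound[OF assms(2,6,7,10)]) (rule that)
  obtain T a l \<rho> where "inner_model \<Omega> P N T a l \<rho>"
    by (rule inner_model_at_concave_point[OF assms(2,6,7,10,8,9)]) (rule that, rule inner_model.intro[OF N1])
  then interpret inner_model \<Omega> P N T a l \<rho> .
  show ?thesis
  proof (intro conjI)
    obtain C where C: "\<forall>\<^sub>F \<delta> in at_right 0. kobayashi_metric \<Omega> (P + \<delta> *\<^sub>R N) \<nu> \<le> ereal (C * (1 / \<delta> powr (3 / 4)))"
      using kobayashi_upper[OF \<kappa>(1)] unfolding \<kappa>(2) .
    obtain c where c: "c > 0" "\<forall>\<^sub>F \<delta> in at_right 0. ereal (c * (1 / \<delta> powr (3 / 4))) \<le> kobayashi_metric \<Omega> (P + \<delta> *\<^sub>R N) \<nu>"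
      unfolding \<kappa>(2) by (rule kobayashi_lower[OF assms(4) N1 \<kappa>(1) outer])
    show "comparable_near_0 (\<lambda>\<delta>. kobayashi_metric \<Omega> (P + \<delta> *\<^sub>R N) \<nu>) (\<lambda>\<delta>. 1 / \<delta> powr (3 / 4))"
      by (rule comparable_near_0I[OF c C]) simp
  next
    obtain C where C: "\<forall>\<^sub>F \<delta> in at_right 0. sibony_metric \<Omega> (P + \<delta> *\<^sub>R N) \<nu> \<le> ereal (C * (1 / \<delta> powr (1 / 2)))"
      using sibony_upper[OF assms(2) \<kappa>(1)] unfolding \<kappa>(2) .
    obtain c where c: "c > 0" "\<forall>\<^sub>F \<delta> in at_right 0. ereal (c * (1 / \<delta> powr (1 / 2))) \<le> sibony_metric \<Omega> (P + \<delta> *\<^sub>R N) \<nu>"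
      unfolding \<kappa>(2) by (rule sibony_lower[OF assms(4) N1 \<kappa>(1) outer])
    show "comparable_near_0 (\<lambda>\<delta>. sibony_metric \<Omega> (P + \<delta> *\<^sub>R N) \<nu>) (\<lambda>\<delta>. 1 / \<delta> powr (1 / 2))"
      by (rule comparable_near_0I[OF c C]) simp
  next
    obtain C where C: "\<forall>\<^sub>F \<delta> in at_right 0. caratheodory_metric \<Omega> (P + \<delta> *\<^sub>R N) \<nu> \<le> ereal C"
      using caratheodory_upper[OF assms(2) \<kappa>(1)] unfolding \<kappa>(2) .
    obtain c where c: "c > 0" "\<forall>\<^sub>F \<delta> in at_right 0. ereal c \<le> caratheodory_metric \<Omega> (P + \<delta> *\<^sub>R N) \<nu>"
      using caratheodory_lower[OF assms(4) \<nu>1] .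
    show "comparable_near_0 (\<lambda>\<delta>. caratheodory_metric \<Omega> (P + \<delta> *\<^sub>R N) \<nu>) (\<lambda>\<delta>. 1)"
      by (rule comparable_near_0I[of c _ _ C]) (use c C in simp_all)
  qed
qed

end
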